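(* Let $\Gamma$ be a finitely generated group and let $H$ be an infinite, normal subgroup of $\Gamma$ such that the pair $(\Gamma,H)$ has relative property (T). Let $\mathcal G$ be any Cayley graph of $\Gamma$ (with respect to a finite symmetric generating set). Then $p_u(\mathcal G)$-Bernoulli bond percolation on $\mathcal G$ almost surely does not have a unique infinite cluster. In particular, for any Cayley graph $\mathcal G$ of a countable infinite group with property (T), $p_u(\mathcal G)$-Bernoulli bond percolation almost surely does not have a unique infinite cluster.
   Context: In $p$-Bernoulli bond percolation on a graph, each edge is kept independently with probability $p\in[0,1]$; clusters are the connected components of the resulting random subgraph. The uniqueness threshold $p_u(\mathcal G)$ is the infimum of all $p\in[0,1]$ such that $p$-Bernoulli bond percolation on $\mathcal G$ has a unique infinite cluster almost surely. (On a Cayley graph the number of infinite clusters is almost surely constant, equal to $0$, $1$ or $\infty$.) The pair $(\Gamma,H)$ has relative property (T) if every unitary representation $\pi$ of $\Gamma$ on a Hilbert space which almost has invariant vectors (for every $\varepsilon>0$ and finite $K\subset\Gamma$ there is a unit vector $\varphi$ with $\sup_{s\in K}\|\pi(s)\varphi-\varphi\|<\varepsilon$) has a non-zero $H$-invariant vector. $\Gamma$ has property (T) if there exist $\varepsilon>0$ and a finite $K\subset\Gamma$ such that every unitary representation of $\Gamma$ having a unit vector $\varphi$ with $\sup_{s\in K}\|\pi(s)\varphi-\varphi\|<\varepsilon$ has a non-zero invariant vector. A countable group with property (T) is finitely generated. *)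

theory Defs
  imports
    "HOL-Algebra.Algebra"
    "HOL-Algebra.Algebraic_Closure_Type"
    "HOL-Probability.Probability"
begin

section \<open>Complex Hilbert spaces and unitary representations\<close>

text \<open>
  Hilbert spaces are rendered as carrier-based modules over the field of complex numbers, so that
  one can quantify over all of them inside a formula. The fields \<open>mult\<close> and \<open>one\<close>, which
  the record type of modules inherits from rings, play no role.
\<close>

record 'v hilbert = "(complex, 'v) module" +
  cinner :: "'v \<Rightarrow> 'v \<Rightarrow> complex"

definition hnorm :: "('v, 'm) hilbert_scheme \<Rightarrow> 'v \<Rightarrow> real" where
  "hnorm V x = sqrt (Re (cinner V x x))"

locale hilbert_space =
  module "ring_of_type_algebra :: complex ring" V
  for V :: "('v, 'm) hilbert_scheme" (structure) +
  assumes cinner_add_left: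
      "\<lbrakk>x \<in> carrier V; y \<in> carrier V; z \<in> carrier V\<rbrakk>
        \<Longrightarrow> cinner V (x \<oplus> y) z = cinner V x z + cinner V y z"
    and cinner_smult_left:
      "\<lbrakk>x \<in> carrier V; y \<in> carrier V\<rbrakk> \<Longrightarrow> cinner V (a \<odot> x) y = a * cinner V x y"
    and cinner_commute:
      "\<lbrakk>x \<in> carrier V; y \<in> carrier V\<rbrakk> \<Longrightarrow> cinner V y x = cnj (cinner V x y)"
    and cinner_nonneg: "x \<in> carrier V \<Longrightarrow> 0 \<le> Re (cinner V x x)"
    and cinner_definite: "\<lbrakk>x \<in> carrier V; cinner V x x = 0\<rbrakk> \<Longrightarrow> x = \<zero>"
    and complete:
      "\<lbrakk>\<forall>n. u n \<in> carrier V;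
        \<forall>\<epsilon>>0. \<exists>N. \<forall>m\<ge>N. \<forall>n\<ge>N. hnorm V (u m \<ominus> u n) < \<epsilon>\<rbrakk>
        \<Longrightarrow> \<exists>x\<in>carrier V. (\<lambda>n. hnorm V (u n \<ominus> x)) \<longlonglongrightarrow> 0"

text \<open>
  \<open>group_action\<close> says that \<open>\<pi>\<close> is a homomorphism into the group of all
  bijections of \<open>carrier V\<close>; a unitary operator is a bijective linear isometry.
\<close>

locale unitary_representation =
  hilbert_space V + group_action G "carrier V" \<pi>
  for G :: "('a, 'b) monoid_scheme"
    and V :: "('v, 'm) hilbert_scheme"
    and \<pi> :: "'a \<Rightarrow> 'v \<Rightarrow> 'v" +
  assumes rep_add:
      "\<lbrakk>g \<in> carrier G; x \<in> carrier V; y \<in> carrier V\<rbrakk>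
        \<Longrightarrow> \<pi> g (x \<oplus>\<^bsub>V\<^esub> y) = \<pi> g x \<oplus>\<^bsub>V\<^esub> \<pi> g y"
    and rep_smult:
      "\<lbrakk>g \<in> carrier G; x \<in> carrier V\<rbrakk> \<Longrightarrow> \<pi> g (a \<odot>\<^bsub>V\<^esub> x) = a \<odot>\<^bsub>V\<^esub> \<pi> g x"
    and rep_cinner:
      "\<lbrakk>g \<in> carrier G; x \<in> carrier V; y \<in> carrier V\<rbrakk>
        \<Longrightarrow> cinner V (\<pi> g x) (\<pi> g y) = cinner V x y"


section \<open>Property (T) and relative property (T)\<close>

definition has_almost_invariant_unit_vector ::
    "('v, 'm) hilbert_scheme \<Rightarrow> ('a \<Rightarrow> 'v \<Rightarrow> 'v) \<Rightarrow> real \<Rightarrow> 'a set \<Rightarrow> bool" where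
  "has_almost_invariant_unit_vector V \<pi> \<epsilon> K \<longleftrightarrow>
     (\<exists>\<phi>\<in>carrier V. hnorm V \<phi> = 1 \<and> (\<forall>s\<in>K. hnorm V (\<pi> s \<phi> \<ominus>\<^bsub>V\<^esub> \<phi>) < \<epsilon>))"

definition almost_has_invariant_vectors ::
    "('a, 'b) monoid_scheme \<Rightarrow> ('v, 'm) hilbert_scheme \<Rightarrow> ('a \<Rightarrow> 'v \<Rightarrow> 'v) \<Rightarrow> bool" where
  "almost_has_invariant_vectors G V \<pi> \<longleftrightarrow>
     (\<forall>\<epsilon>>0. \<forall>K. finite K \<and> K \<subseteq> carrier G \<longrightarrow> has_almost_invariant_unit_vector V \<pi> \<epsilon> K)"

definition has_nonzero_invariant_vector ::
    "('v, 'm) hilbert_scheme \<Rightarrow> ('a \<Rightarrow> 'v \<Rightarrow> 'v) \<Rightarrow> 'a set \<Rightarrow> bool" where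
  "has_nonzero_invariant_vector V \<pi> H \<longleftrightarrow>
     (\<exists>\<phi>\<in>carrier V. \<phi> \<noteq> \<zero>\<^bsub>V\<^esub> \<and> (\<forall>h\<in>H. \<pi> h \<phi> = \<phi>))"

text \<open>
  HOL cannot quantify over types inside a formula, so the Hilbert spaces below have their elements
  in the type \<open>'a \<times> nat \<Rightarrow> complex\<close>, where \<open>'a\<close> is the type of group elements; the
  vector space operations and the inner product remain arbitrary. This loses nothing: every Hilbert
  space with a dense subset of cardinality at most \<open>max |'a| |nat|\<close>
  is isometric to some \<open>\<ell>\<^sup>2(J)\<close> with \<open>J \<subseteq> 'a \<times> nat\<close> and hence has a copy
  in this type. If some unitary representation refutes property (T), or relative property (T), then
  so does the closed subrepresentation generated by one almost invariant unit vector, or by one such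
  vector for each finite \<open>K\<close> and each \<open>\<epsilon> = 1/n\<close>, and this subrepresentation has such
  a dense subset.
\<close>

type_synonym 'a rep_space = "('a \<times> nat \<Rightarrow> complex) hilbert"

definition relative_property_T :: "('a, 'b) monoid_scheme \<Rightarrow> 'a set \<Rightarrow> bool" where
  "relative_property_T G H \<longleftrightarrow>
     (\<forall>(V :: 'a rep_space) \<pi>.
        unitary_representation G V \<pi> \<and> almost_has_invariant_vectors G V \<pi> \<longrightarrow>
        has_nonzero_invariant_vector V \<pi> H)"

definition property_T :: "('a, 'b) monoid_scheme \<Rightarrow> bool" where
  "property_T G \<longleftrightarrow>
     (\<exists>\<epsilon>>0. \<exists>K. finite K \<and> K \<subseteq> carrier G \<and>
        (\<forall>(V :: 'a rep_space) \<pi>.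
           unitary_representation G V \<pi> \<and> has_almost_invariant_unit_vector V \<pi> \<epsilon> K \<longrightarrow>
           has_nonzero_invariant_vector V \<pi> (carrier G)))"


section \<open>Bernoulli bond percolation\<close>

text \<open>
  A graph is given by a vertex set \<open>V\<close> and a set \<open>E\<close> of edges, each edge being the set
  of its endpoints (a singleton for a loop).
\<close>

definition clusters :: "'v set \<Rightarrow> 'v set set \<Rightarrow> 'v set set" where
  "clusters V F = V // {(x, y). {x, y} \<in> F}\<^sup>*"

definition unique_infinite_cluster :: "'v set \<Rightarrow> 'v set set \<Rightarrow> bool" where
  "unique_infinite_cluster V F \<longleftrightarrow> (\<exists>!C. C \<in> clusters V F \<and> infinite C)"

definition bernoulli_percolation :: "'v set set \<Rightarrow> real \<Rightarrow> ('v set \<Rightarrow> bool) measure" where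
  "bernoulli_percolation E p = PiM E (\<lambda>_. measure_pmf (bernoulli_pmf p))"

definition open_edges :: "'v set set \<Rightarrow> ('v set \<Rightarrow> bool) \<Rightarrow> 'v set set" where
  "open_edges E \<omega> = {e \<in> E. \<omega> e}"

definition uniqueness_threshold :: "'v set \<Rightarrow> 'v set set \<Rightarrow> real" where
  "uniqueness_threshold V E =
     Inf {p \<in> {0..1}. AE \<omega> in bernoulli_percolation E p.
                        unique_infinite_cluster V (open_edges E \<omega>)}"


section \<open>Cayley graphs\<close>

definition finite_symmetric_generating_set :: "('a, 'b) monoid_scheme \<Rightarrow> 'a set \<Rightarrow> bool" where
  "finite_symmetric_generating_set G S \<longleftrightarrow>
     finite S \<and> S \<subseteq> carrier G \<and> (\<forall>s\<in>S. inv\<^bsub>G\<^esub> s \<in> S) \<and> generate G S = carrier G"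

definition cayley_edges :: "('a, 'b) monoid_scheme \<Rightarrow> 'a set \<Rightarrow> 'a set set" where
  "cayley_edges G S = {{g, g \<otimes>\<^bsub>G\<^esub> s} | g s. g \<in> carrier G \<and> s \<in> S}"

end

theory Submission
  imports Defs
begin

text \<open>
  Suppose that there is a unique infinite cluster at \<open>p\<^sub>u\<close>; by ergodicity this then holds almost
  surely. Take a sequence \<open>p\<^sub>n\<close> increasing to \<open>p\<^sub>u\<close> and let the group act on the direct sum of the
  spaces of square-summable random functions on the clusters of \<open>p\<^sub>n\<close>-percolation. The indicator
  function of the first large cluster in a fixed enumeration of the group is almost invariant,
  because in the limit all translates of this rule select the infinite cluster. Relative property (T)
  yields a nonzero \<open>H\<close>-invariant vector, and a superlevel set of it selects finitely many clusters at
  some \<open>p\<^sub>n\<close>, in an \<open>H\<close>-equivariant way. Since \<open>H\<close> is infinite, an \<open>H\<close>-equivariant random set is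
  almost surely empty or infinite. Hence the selected clusters are infinite, and if some more edges
  are opened, any two of them and of their translates have infinitely many chances to merge. The
  union of all translates is equivariant under the whole group, so by mass transport every infinite
  cluster has infinitely many chances to meet it. Thus there is a unique infinite cluster at some
  parameter below \<open>p\<^sub>u\<close>, a contradiction.
\<close>

section \<open>Koopman representations\<close>

text \<open>Different tolerances and finite sets of group elements force different levels
  \<open>p\<^sub>n\<close>, whereas relative property (T) wants all of them in one representation;
  hence the direct sum over the levels. The levels must lie strictly below \<open>p\<^sub>u\<close>
  to leave room for opening further edges. At such levels infinite clusters are not known to exist,
  so the rule selects a large cluster, and infiniteness comes out only at the end, through
  invariance under \<open>H\<close>. Square summability is what makes the invariant selection
  finite; the set of all clusters is invariant too, but says nothing.

  The obstacle in merging is that the vertices where two clusters come close depend on the very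
  edges that could join them. The cure is to look at the distance from a grown cluster to its
  target. If it is positive, the vertices realising it are either finitely many, which equivariance
  or mass transport excludes, or infinitely many, and then the edges one step closer to the target
  have not been examined yet and give infinitely many independent trials.

  A further constraint is the type of the representation spaces, which forces square-integrable
  functions to be encoded by countably many numbers.\<close>

definition sq_int :: "'x measure \<Rightarrow> ('x \<Rightarrow> complex) \<Rightarrow> bool" where
  "sq_int M f \<longleftrightarrow> f \<in> borel_measurable M \<and> integrable M (\<lambda>x. (cmod (f x))\<^sup>2)"

lemma sq_intD:
  assumes "sq_int M f"
  shows "f \<in> borel_measurable M" "integrable M (\<lambda>x. (cmod (f x))\<^sup>2)"
  using assms by (auto simp: sq_int_def)

lemma sq_int_zero: "sq_int M (\<lambda>x. 0)"
  by (simp add: sq_int_def)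

lemma sq_int_add:
  assumes "sq_int M f" "sq_int M g"
  shows "sq_int M (\<lambda>x. f x + g x)"
  unfolding sq_int_def
proof
  note [measurable] = sq_intD(1)[OF assms(1)] sq_intD(1)[OF assms(2)]
  show "(\<lambda>x. f x + g x) \<in> borel_measurable M" by measurable
  have b: "(cmod (a + b))\<^sup>2 \<le> 2 * (cmod a)\<^sup>2 + 2 * (cmod b)\<^sup>2" for a b
  proof -
    have "(cmod (a + b))\<^sup>2 \<le> (cmod a + cmod b)\<^sup>2"
      by (intro power_mono norm_triangle_ineq) auto
    also have "\<dots> \<le> 2 * (cmod a)\<^sup>2 + 2 * (cmod b)\<^sup>2"
      using zero_le_power2[of "cmod a - cmod b"] by (simp add: power2_eq_square algebra_simps)
    finally show ?thesis .
  qed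
  show "integrable M (\<lambda>x. (cmod (f x + g x))\<^sup>2)"
  proof (rule Bochner_Integration.integrable_bound)
    show "integrable M (\<lambda>x. 2 * (cmod (f x))\<^sup>2 + 2 * (cmod (g x))\<^sup>2)"
      using sq_intD(2)[OF assms(1)] sq_intD(2)[OF assms(2)] by auto
  qed (use b in \<open>auto\<close>)
qed

lemma sq_int_cmult:
  assumes "sq_int M f"
  shows "sq_int M (\<lambda>x. c * f x)"
  using assms unfolding sq_int_def by (auto simp: norm_mult power_mult_distrib)

lemma sq_int_diff:
  assumes "sq_int M f" "sq_int M g"
  shows "sq_int M (\<lambda>x. f x - g x)"
  using sq_int_add[OF assms(1) sq_int_cmult[OF assms(2), of "-1"]] by simp

lemma sq_int_comp:
  assumes "sq_int M f" "t \<in> measurable M M" "distr M M t = M"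
  shows "sq_int M (\<lambda>x. f (t x))"
  unfolding sq_int_def
proof
  note [measurable] = sq_intD(1)[OF assms(1)] assms(2)
  show "(\<lambda>x. f (t x)) \<in> borel_measurable M" by measurable
  have "integrable (distr M M t) (\<lambda>x. (cmod (f x))\<^sup>2)"
    using sq_intD(2)[OF assms(1)] assms(3) by simp
  then show "integrable M (\<lambda>x. (cmod (f (t x)))\<^sup>2)"
    by (subst (asm) integrable_distr_eq) auto
qed

lemma sq_int_mult_integrable:
  assumes "sq_int M f" "sq_int M g"
  shows "integrable M (\<lambda>x. f x * cnj (g x))"
proof (rule Bochner_Integration.integrable_bound)
  note [measurable] = sq_intD(1)[OF assms(1)] sq_intD(1)[OF assms(2)]
  show "integrable M (\<lambda>x. (cmod (f x))\<^sup>2 + (cmod (g x))\<^sup>2)"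
    using sq_intD(2)[OF assms(1)] sq_intD(2)[OF assms(2)] by auto
  have [measurable]: "(\<lambda>x. cnj (g x)) \<in> borel_measurable M"
    by (rule borel_measurable_continuous_on[OF continuous_on_cnj]) auto
  show "(\<lambda>x. f x * cnj (g x)) \<in> borel_measurable M" by measurable
  show "AE x in M. norm (f x * cnj (g x)) \<le> norm ((cmod (f x))\<^sup>2 + (cmod (g x))\<^sup>2)"
  proof (rule AE_I2)
    fix x
    have "cmod (f x) * cmod (g x) \<le> 2 * cmod (f x) * cmod (g x)" by simp
    also have "\<dots> \<le> (cmod (f x))\<^sup>2 + (cmod (g x))\<^sup>2" by (rule sum_squares_bound)
    finally show "norm (f x * cnj (g x)) \<le> norm ((cmod (f x))\<^sup>2 + (cmod (g x))\<^sup>2)"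
      by (simp add: norm_mult)
  qed
qed

lemma sq_int_integral_eq_nn:
  assumes "sq_int M f"
  shows "ennreal (\<integral>x. (cmod (f x))\<^sup>2 \<partial>M) = (\<integral>\<^sup>+x. (cmod (f x))\<^sup>2 \<partial>M)"
  using nn_integral_eq_integral[OF sq_intD(2)[OF assms]] by simp

lemma sq_intI_nn:
  assumes "f \<in> borel_measurable M" "(\<integral>\<^sup>+x. (cmod (f x))\<^sup>2 \<partial>M) < \<infinity>"
  shows "sq_int M f"
  using assms unfolding sq_int_def by (auto intro!: integrableI_bounded)

text \<open>Completeness over an arbitrary measure. A rapidly converging subsequence converges
  almost everywhere, and Fatou's lemma upgrades its pointwise limit to a limit of the whole sequence
  in mean square.\<close>

lemma riesz_fischer:
  fixes u :: "nat \<Rightarrow> 'x \<Rightarrow> complex"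
  assumes u: "\<And>n. sq_int M (u n)"
    and cauchy: "\<And>e. e > 0 \<Longrightarrow> \<exists>N. \<forall>m\<ge>N. \<forall>n\<ge>N. (\<integral>x. (cmod (u m x - u n x))\<^sup>2 \<partial>M) < e"
  shows "\<exists>f. sq_int M f \<and> (\<lambda>n. \<integral>x. (cmod (u n x - f x))\<^sup>2 \<partial>M) \<longlonglongrightarrow> 0"
proof -
  note [measurable] = sq_intD(1)[OF u]
  \<comment> \<open>Squared increments below \<open>(1/4)^k\<close> stay summable after
    multiplication by \<open>2^k\<close>, and the weight then yields geometric decay
    pointwise.\<close>
  have "\<exists>r. strict_mono r \<and> (\<forall>k. \<forall>m\<ge>r k. \<forall>n\<ge>r k. (\<integral>x. (cmod (u m x - u n x))\<^sup>2 \<partial>M) < (1/4)^k)"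
  proof -
    have "\<exists>r. \<forall>k. (\<forall>m\<ge>r k. \<forall>n\<ge>r k. (\<integral>x. (cmod (u m x - u n x))\<^sup>2 \<partial>M) < (1/4)^k) \<and> r k < r (Suc k)"
    proof (rule dependent_nat_choice)
      show "\<exists>x. \<forall>m\<ge>x. \<forall>n\<ge>x. (LINT x|M. (cmod (u m x - u n x))\<^sup>2) < (1 / 4) ^ 0"
        using cauchy[of 1] by simp
    next
      fix x k
      obtain N where N: "\<forall>m\<ge>N. \<forall>n\<ge>N. (\<integral>x. (cmod (u m x - u n x))\<^sup>2 \<partial>M) < (1/4)^(Suc k)"
        using cauchy[of "(1/4)^(Suc k)"] by auto
      show "\<exists>y. (\<forall>m\<ge>y. \<forall>n\<ge>y. (LINT x|M. (cmod (u m x - u n x))\<^sup>2) < (1 / 4) ^ Suc k) \<and> x < y"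
        by (rule exI[of _ "max N (Suc x)"]) (use N in auto)
    qed
    then show ?thesis by (auto simp: strict_mono_Suc_iff)
  qed
  then obtain r where r: "strict_mono r"
    and rb: "\<And>k m n. m \<ge> r k \<Longrightarrow> n \<ge> r k \<Longrightarrow> (\<integral>x. (cmod (u m x - u n x))\<^sup>2 \<partial>M) < (1/4)^k" by blast
  define d where "d k x = (cmod (u (r (Suc k)) x - u (r k) x))\<^sup>2" for k x
  have [measurable]: "d k \<in> borel_measurable M" for k unfolding d_def by measurable
  have dint: "(\<integral>\<^sup>+x. ennreal (d k x) \<partial>M) \<le> ennreal ((1/4)^k)" for k
    unfolding d_def
    by (subst sq_int_integral_eq_nn[OF sq_int_diff[OF u u], symmetric])
       (rule ennreal_leI, rule less_imp_le, rule rb, auto simp: strict_mono_leD[OF r, of k "Suc k"])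
  have "(\<integral>\<^sup>+x. suminf (\<lambda>k. ennreal (2^k * d k x)) \<partial>M) = suminf (\<lambda>k. \<integral>\<^sup>+x. ennreal (2^k * d k x) \<partial>M)"
    by (rule nn_integral_suminf) measurable
  also have "\<dots> \<le> suminf (\<lambda>k. ennreal ((1/2)^k))"
  proof (rule suminf_le)
    fix k
    have "(\<integral>\<^sup>+x. ennreal (2^k * d k x) \<partial>M) = ennreal (2^k) * (\<integral>\<^sup>+x. ennreal (d k x) \<partial>M)"
      by (subst nn_integral_cmult[symmetric]) (auto simp: ennreal_mult d_def)
    also have "\<dots> \<le> ennreal (2^k) * ennreal ((1/4)^k)"
      by (intro mult_left_mono dint) auto
    also have "\<dots> = ennreal ((1/2)^k)"
      by (subst ennreal_mult[symmetric]) (auto simp: power_mult_distrib[symmetric])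
    finally show "(\<integral>\<^sup>+x. ennreal (2^k * d k x) \<partial>M) \<le> ennreal ((1/2)^k)" .
  qed auto
  also have "\<dots> = ennreal (suminf (\<lambda>k. (1/2)^k))"
    by (rule suminf_ennreal2) (auto intro: summable_geometric)
  also have "\<dots> < \<infinity>" by simp
  finally have "(\<integral>\<^sup>+x. suminf (\<lambda>k. ennreal (2^k * d k x)) \<partial>M) \<noteq> \<infinity>" by auto
  then have "AE x in M. suminf (\<lambda>k. ennreal (2^k * d k x)) \<noteq> \<infinity>"
    by (intro nn_integral_noteq_infinite) measurable
  then have ae: "AE x in M. convergent (\<lambda>k. u (r k) x)"
  proof eventually_elim
    fix x assume fin: "suminf (\<lambda>k. ennreal (2^k * d k x)) \<noteq> \<infinity>"
    define S where "S = suminf (\<lambda>k. ennreal (2^k * d k x))"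
    obtain s where s: "S = ennreal s" "s \<ge> 0" using fin[folded S_def] by (cases S) auto
    \<comment> \<open>A finite weighted sum bounds each of its terms, so at almost every point the
      increments decay like \<open>(sqrt (1/2))^k\<close>.\<close>
    have le: "2^k * d k x \<le> s" for k
    proof -
      have "ennreal (2^k * d k x) \<le> S"
        unfolding S_def using sum_le_suminf[OF summableI, of "{k}" "\<lambda>k. ennreal (2^k * d k x)"] by simp
      then show ?thesis using s by (simp add: ennreal_le_iff)
    qed
    have le2: "cmod (u (r (Suc k)) x - u (r k) x) \<le> sqrt s * (sqrt (1/2))^k" for k
    proof -
      have "d k x \<le> s * (1/2)^k" using le[of k] by (simp add: field_simps power_divide)
      then have "sqrt (d k x) \<le> sqrt (s * (1/2)^k)" by (rule real_sqrt_le_mono)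
      then show ?thesis by (simp add: d_def real_sqrt_mult real_sqrt_power)
    qed
    have "summable (\<lambda>k. u (r (Suc k)) x - u (r k) x)"
    proof (rule summable_comparison_test')
      show "summable (\<lambda>k. sqrt s * (sqrt (1/2))^k)"
        by (intro summable_mult summable_geometric) (auto simp: real_sqrt_divide)
    qed (use le2 in auto)
    then show "convergent (\<lambda>k. u (r k) x)" by (simp add: summable_iff_convergent sum_lessThan_telescope[where f="\<lambda>i. u (r i) x"] convergent_diff_const_right_iff)
  qed
  define f where "f x = lim (\<lambda>k. u (r k) x)" for x
  have [measurable]: "f \<in> borel_measurable M" unfolding f_def by measurable
  \<comment> \<open>Fatou along the subsequence with \<open>n\<close> fixed. The case
    \<open>n = r 0\<close> gives square integrability of the limit, large \<open>n\<close> gives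
    convergence.\<close>
  have fatou: "(\<integral>\<^sup>+x. (cmod (u n x - f x))\<^sup>2 \<partial>M) \<le> ennreal ((1/4)^j)" if "n \<ge> r j" for n j
  proof -
    have "(\<integral>\<^sup>+x. (cmod (u n x - f x))\<^sup>2 \<partial>M) = (\<integral>\<^sup>+x. liminf (\<lambda>k. ennreal ((cmod (u n x - u (r k) x))\<^sup>2)) \<partial>M)"
    proof (rule nn_integral_cong_AE, use ae in eventually_elim)
      fix x assume "convergent (\<lambda>k. u (r k) x)"
      then have "(\<lambda>k. u (r k) x) \<longlonglongrightarrow> f x" unfolding f_def by (simp add: convergent_LIMSEQ_iff)
      then have "(\<lambda>k. ennreal ((cmod (u n x - u (r k) x))\<^sup>2)) \<longlonglongrightarrow> ennreal ((cmod (u n x - f x))\<^sup>2)"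
        by (intro tendsto_intros)
      from lim_imp_Liminf[OF _ this]
      show "ennreal ((cmod (u n x - f x))\<^sup>2) = liminf (\<lambda>k. ennreal ((cmod (u n x - u (r k) x))\<^sup>2))" by simp
    qed
    also have "\<dots> \<le> liminf (\<lambda>k. \<integral>\<^sup>+x. ennreal ((cmod (u n x - u (r k) x))\<^sup>2) \<partial>M)"
      by (rule nn_integral_liminf) measurable
    also have "\<dots> \<le> limsup (\<lambda>k. \<integral>\<^sup>+x. ennreal ((cmod (u n x - u (r k) x))\<^sup>2) \<partial>M)"
      by (rule Liminf_le_Limsup) simp
    also have "\<dots> \<le> ennreal ((1/4)^j)"
    proof (rule Limsup_bounded)
      have "eventually (\<lambda>k. k \<ge> j) sequentially" by (rule eventually_ge_at_top)
      then show "\<forall>\<^sub>F k in sequentially. (\<integral>\<^sup>+x. ennreal ((cmod (u n x - u (r k) x))\<^sup>2) \<partial>M) \<le> ennreal ((1/4)^j)"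
      proof eventually_elim
        fix k assume "j \<le> k"
        then have "r j \<le> r k" using r by (simp add: strict_mono_less_eq)
        then show "(\<integral>\<^sup>+x. ennreal ((cmod (u n x - u (r k) x))\<^sup>2) \<partial>M) \<le> ennreal ((1/4)^j)"
          using that
          by (subst sq_int_integral_eq_nn[OF sq_int_diff[OF u u], symmetric])
             (rule ennreal_leI, rule less_imp_le, rule rb, auto)
      qed
    qed
    finally show ?thesis .
  qed
  have "sq_int M (\<lambda>x. u (r 0) x - f x)"
    by (rule sq_intI_nn) (use fatou[of 0 "r 0"] in \<open>auto simp: order_le_less_trans\<close>)
  from sq_int_diff[OF u this, of "r 0"] have f: "sq_int M f" by simp
  have "(\<lambda>n. \<integral>x. (cmod (u n x - f x))\<^sup>2 \<partial>M) \<longlonglongrightarrow> 0"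
  proof (rule LIMSEQ_I)
    fix e :: real assume "e > 0"
    obtain j where j: "(1/4::real)^j < e"
      using real_arch_pow_inv[OF \<open>e > 0\<close>, of "1/4"] by auto
    have "norm ((\<integral>x. (cmod (u n x - f x))\<^sup>2 \<partial>M) - 0) < e" if "n \<ge> r j" for n
    proof -
      have "ennreal (\<integral>x. (cmod (u n x - f x))\<^sup>2 \<partial>M) \<le> ennreal ((1/4)^j)"
        using fatou[OF that] sq_int_integral_eq_nn[OF sq_int_diff[OF u f]] by simp
      then have "(\<integral>x. (cmod (u n x - f x))\<^sup>2 \<partial>M) \<le> (1/4)^j"
        by (subst (asm) ennreal_le_iff) auto
      moreover have "0 \<le> (\<integral>x. (cmod (u n x - f x))\<^sup>2 \<partial>M)"
        by (rule integral_nonneg_AE) auto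
      ultimately show ?thesis using j by simp
    qed
    then show "\<exists>no. \<forall>n\<ge>no. norm ((\<integral>x. (cmod (u n x - f x))\<^sup>2 \<partial>M) - 0) < e" by blast
  qed
  with f show ?thesis by blast
qed

section \<open>Encoding square-integrable functions by integrals over a countable pi-system\<close>

locale pi_generated_measure =
  fixes M :: "'x measure" and C :: "nat \<Rightarrow> 'x set"
  assumes int_stable: "Int_stable (range C)"
    and sub: "range C \<subseteq> Pow (space M)"
    and gen: "sets M = sigma_sets (space M) (range C)"
    and cover: "\<Union>(range C) = space M"
    and finC: "emeasure M (C k) < \<infinity>"
begin

lemma C_sets[measurable]: "C k \<in> sets M"
  unfolding gen by auto

sublocale sigma_finite_measure M
  by standard (rule exI[of _ "range C"], use finC cover in \<open>auto simp: less_top\<close>)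

text \<open>The positive and the negative part of \<open>u\<close>, taken as densities, give
  measures that are finite and equal on the pi-system, hence equal everywhere. Integrability is
  asked over each \<open>C k\<close> only, because over an infinite measure a square-integrable
  function may fail to be integrable.\<close>

lemma real_zero:
  fixes u :: "'x \<Rightarrow> real"
  assumes [measurable]: "u \<in> borel_measurable M"
    and int: "\<And>k. integrable M (\<lambda>x. indicator (C k) x * u x)"
    and zero: "\<And>k. (\<integral>x. indicator (C k) x * u x \<partial>M) = 0"
  shows "AE x in M. u x = 0"
proof -
  let ?p = "\<lambda>x. ennreal (u x)" and ?n = "\<lambda>x. ennreal (- u x)"
  have eq: "emeasure (density M ?p) (C k) = emeasure (density M ?n) (C k)
        \<and> emeasure (density M ?p) (C k) \<noteq> \<infinity>" for k
  proof -
    let ?v = "\<lambda>x. indicator (C k) x * u x"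
    have "emeasure (density M ?p) (C k) = (\<integral>\<^sup>+x. ennreal (?v x) \<partial>M)"
      by (subst emeasure_density) (auto intro!: nn_integral_cong split: split_indicator)
    moreover have "emeasure (density M ?n) (C k) = (\<integral>\<^sup>+x. ennreal (- ?v x) \<partial>M)"
      by (subst emeasure_density) (auto intro!: nn_integral_cong split: split_indicator)
    moreover have fin: "(\<integral>\<^sup>+x. ennreal (?v x) \<partial>M) \<noteq> \<infinity>" "(\<integral>\<^sup>+x. ennreal (- ?v x) \<partial>M) \<noteq> \<infinity>"
      using int[of k] by (auto simp: real_integrable_def)
    moreover have "enn2real (\<integral>\<^sup>+x. ennreal (?v x) \<partial>M) = enn2real (\<integral>\<^sup>+x. ennreal (- ?v x) \<partial>M)"
      using zero[of k] real_lebesgue_integral_def[OF int[of k]] by simp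
    ultimately show ?thesis by (metis ennreal_enn2real_if infinity_ennreal_def)
  qed
  have "density M ?p = density M ?n"
    by (rule measure_eqI_generator_eq[OF int_stable sub, of _ _ C])
       (use conjunct1[OF eq] conjunct2[OF eq] gen cover in auto)
  then have "AE x in M. ?p x = ?n x"
    by (intro density_unique) auto
  then show ?thesis
  proof eventually_elim
    fix x assume *: "ennreal (u x) = ennreal (- u x)"
    show "u x = 0"
    proof (cases "u x \<ge> 0")
      case True
      then have "ennreal (u x) = 0" using * by (simp add: ennreal_neg)
      then show ?thesis using True by (simp add: ennreal_eq_0_iff)
    next
      case False
      then have "ennreal (- u x) = 0" using * by (simp add: ennreal_neg)
      then show ?thesis using False by (simp add: ennreal_eq_0_iff)
    qed
  qed
qed

text \<open>On a set of finite measure square integrability implies integrability, by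
  \<open>c \<le> 1 + c\<^sup>2\<close>. This makes the coefficients below meaningful.\<close>

lemma sq_int_integrable_C:
  assumes "sq_int M f"
  shows "integrable M (\<lambda>x. indicator (C k) x *\<^sub>R f x)"
proof (rule Bochner_Integration.integrable_bound)
  note [measurable] = sq_intD(1)[OF assms]
  show "integrable M (\<lambda>x. indicator (C k) x + (cmod (f x))\<^sup>2)"
    using finC[of k] sq_intD(2)[OF assms] by (intro Bochner_Integration.integrable_add) auto
  show "(\<lambda>x. indicator (C k) x *\<^sub>R f x) \<in> borel_measurable M" by measurable
  have b: "c \<le> 1 + c\<^sup>2" for c :: real
    using zero_le_power2[of "c - 1/2"] by (simp add: power2_eq_square algebra_simps)
  show "AE x in M. norm (indicator (C k) x *\<^sub>R f x) \<le> norm (indicator (C k) x + (cmod (f x))\<^sup>2)"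
    by (rule AE_I2) (use b in \<open>auto split: split_indicator\<close>)
qed

text \<open>
  An \<open>L\<^sup>2\<close> function is encoded by its integrals over the sets \<open>C k\<close>, which
  determine it almost everywhere. In this way every Koopman representation has a copy in the type
  over which relative property (T) quantifies; the first component of the index is a dummy.
\<close>

definition set_coeff :: "('x \<Rightarrow> complex) \<Rightarrow> 'b \<times> nat \<Rightarrow> complex" where
  "set_coeff f = (\<lambda>p. \<integral>x. indicator (C (snd p)) x *\<^sub>R f x \<partial>M)"

text \<open>Injectivity of the encoding up to null sets, by \<open>real_zero\<close> for the real
  and the imaginary part of the difference.\<close>

lemma coeff_eqD:
  assumes f: "sq_int M f" and g: "sq_int M g" and eq: "set_coeff f = set_coeff g"
  shows "AE x in M. f x = g x"
proof -
  define d where "d x = f x - g x" for x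
  have d: "sq_int M d" unfolding d_def by (rule sq_int_diff[OF f g])
  note [measurable] = sq_intD(1)[OF d]
  note i = sq_int_integrable_C[OF d]
  have z: "(\<integral>x. indicator (C k) x *\<^sub>R d x \<partial>M) = 0" for k
    using fun_cong[OF eq, of "(undefined, k)"] sq_int_integrable_C[OF f, of k] sq_int_integrable_C[OF g, of k]
    by (simp add: set_coeff_def d_def scaleR_diff_right)
  have "AE x in M. Re (d x) = 0"
  proof (rule real_zero)
    fix k
    show "integrable M (\<lambda>x. indicator (C k) x * Re (d x))"
      using integrable_Re[OF i[of k]] by simp
    show "(\<integral>x. indicator (C k) x * Re (d x) \<partial>M) = 0"
      using integral_Re[OF i[of k]] z by simp
  qed measurable
  moreover have "AE x in M. Im (d x) = 0"
  proof (rule real_zero)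
    fix k
    show "integrable M (\<lambda>x. indicator (C k) x * Im (d x))"
      using integrable_Im[OF i[of k]] by simp
    show "(\<integral>x. indicator (C k) x * Im (d x) \<partial>M) = 0"
      using integral_Im[OF i[of k]] z by simp
  qed measurable
  ultimately show ?thesis
    by eventually_elim (simp add: d_def complex_eq_iff)
qed

lemma coeff_cong_AE:
  assumes "sq_int M f" "sq_int M g" "AE x in M. f x = g x"
  shows "set_coeff f = set_coeff g"
  unfolding set_coeff_def
proof (rule ext, rule integral_cong_AE)
  note [measurable] = sq_intD(1)[OF assms(1)] sq_intD(1)[OF assms(2)]
  fix p :: "'b \<times> nat"
  show "(\<lambda>x. indicator (C (snd p)) x *\<^sub>R f x) \<in> borel_measurable M"
    "(\<lambda>x. indicator (C (snd p)) x *\<^sub>R g x) \<in> borel_measurable M" by measurable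
  show "AE x in M. indicator (C (snd p)) x *\<^sub>R f x = indicator (C (snd p)) x *\<^sub>R g x"
    using assms(3) by eventually_elim simp
qed

lemma coeff_add:
  assumes "sq_int M f" "sq_int M g"
  shows "set_coeff (\<lambda>x. f x + g x) = (\<lambda>p. set_coeff f p + set_coeff g p)"
  using sq_int_integrable_C[OF assms(1)] sq_int_integrable_C[OF assms(2)]
  by (auto simp: set_coeff_def scaleR_add_right)

lemma coeff_cmult:
  assumes "sq_int M f"
  shows "set_coeff (\<lambda>x. c * f x) = (\<lambda>p. c * set_coeff f p)"
  by (auto simp: set_coeff_def mult_scaleR_right[symmetric] simp del: mult_scaleR_right)

lemma coeff_uminus:
  assumes "sq_int M f"
  shows "set_coeff (\<lambda>x. - f x) = (\<lambda>p. - set_coeff f p)"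
  using coeff_cmult[OF assms, of "-1"] by simp

lemma coeff_zero: "set_coeff (\<lambda>x. 0) = (\<lambda>p. 0)"
  by (simp add: set_coeff_def)

end

section \<open>The Koopman representation of a measure-preserving action\<close>

locale measure_preserving_action = pi_generated_measure M C + group G
  for M :: "'x measure" and C and G :: "('a, 'b) monoid_scheme" +
  fixes act :: "'a \<Rightarrow> 'x \<Rightarrow> 'x"
  assumes act_measurable[measurable]: "g \<in> carrier G \<Longrightarrow> act g \<in> measurable M M"
    and act_distr: "g \<in> carrier G \<Longrightarrow> distr M M (act g) = M"
    and act_mult: "\<lbrakk>g \<in> carrier G; h \<in> carrier G; x \<in> space M\<rbrakk> \<Longrightarrow> act (g \<otimes>\<^bsub>G\<^esub> h) x = act g (act h x)"
    and act_one: "x \<in> space M \<Longrightarrow> act \<one>\<^bsub>G\<^esub> x = x"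
begin

text \<open>Functions that agree almost everywhere have the same coefficients, so a function is
  recovered from them by choice, and only up to a null set.\<close>

definition repr_fn :: "('a \<times> nat \<Rightarrow> complex) \<Rightarrow> 'x \<Rightarrow> complex" where
  "repr_fn u = (SOME f. sq_int M f \<and> set_coeff f = u)"

text \<open>The encoding is linear, so the vector space operations are pointwise on coefficients;
  only the inner product has to go back to representing functions.\<close>

definition koopman_space :: "'a rep_space" where
  "koopman_space = \<lparr>carrier = set_coeff ` {f. sq_int M f}, monoid.mult = (\<lambda>u v. undefined), one = undefined,
     ring.zero = (\<lambda>p. 0), ring.add = (\<lambda>u v p. u p + v p), module.smult = (\<lambda>c u p. c * u p),
     cinner = (\<lambda>u v. \<integral>x. repr_fn u x * cnj (repr_fn v x) \<partial>M)\<rparr>"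

text \<open>The inverse makes \<open>koopman_rep\<close> a homomorphism instead of an
  anti-homomorphism. The restriction to the carrier is there because elements of
  \<open>BijGroup\<close> are extensional.\<close>

definition koopman_rep :: "'a \<Rightarrow> ('a \<times> nat \<Rightarrow> complex) \<Rightarrow> ('a \<times> nat \<Rightarrow> complex)" where
  "koopman_rep g = (\<lambda>u\<in>carrier koopman_space. set_coeff (\<lambda>x. repr_fn u (act (inv\<^bsub>G\<^esub> g) x)))"

lemma koopman_space_simps:
  "carrier koopman_space = set_coeff ` {f. sq_int M f}"
  "\<zero>\<^bsub>koopman_space\<^esub> = (\<lambda>p. 0)"
  "u \<oplus>\<^bsub>koopman_space\<^esub> v = (\<lambda>p. u p + v p)"
  "c \<odot>\<^bsub>koopman_space\<^esub> u = (\<lambda>p. c * u p)"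
  by (auto simp: koopman_space_def)

lemma coeff_in[simp]: "sq_int M f \<Longrightarrow> set_coeff f \<in> carrier koopman_space"
  by (auto simp: koopman_space_simps)

lemma carrierE:
  assumes "u \<in> carrier koopman_space"
  obtains f where "sq_int M f" "u = set_coeff f"
  using assms by (auto simp: koopman_space_simps)

lemma repr_fn_props:
  assumes "u \<in> carrier koopman_space"
  shows "sq_int M (repr_fn u)" "set_coeff (repr_fn u) = u"
proof -
  from assms obtain f where "sq_int M f" "u = set_coeff f" by (rule carrierE)
  then have "sq_int M (repr_fn u) \<and> set_coeff (repr_fn u) = u"
    unfolding repr_fn_def by (intro someI[where P="\<lambda>f. sq_int M f \<and> set_coeff f = u"]) auto
  then show "sq_int M (repr_fn u)" "set_coeff (repr_fn u) = u" by auto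
qed

lemma repr_fn_coeff:
  assumes "sq_int M f"
  shows "AE x in M. repr_fn (set_coeff f) x = f x"
  using repr_fn_props[OF coeff_in[OF assms]] assms by (intro coeff_eqD) auto

lemma cinner_coeff:
  assumes f: "sq_int M f" and g: "sq_int M g"
  shows "cinner koopman_space (set_coeff f) (set_coeff g) = (\<integral>x. f x * cnj (g x) \<partial>M)"
proof -
  note i = sq_int_mult_integrable[OF repr_fn_props(1)[OF coeff_in[OF f]] repr_fn_props(1)[OF coeff_in[OF g]]]
  have "(\<integral>x. repr_fn (set_coeff f) x * cnj (repr_fn (set_coeff g) x) \<partial>M) = (\<integral>x. f x * cnj (g x) \<partial>M)"
    by (rule integral_cong_AE)
       (use i sq_int_mult_integrable[OF f g] repr_fn_coeff[OF f] repr_fn_coeff[OF g] in auto)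
  then show ?thesis by (simp add: koopman_space_def)
qed

lemma cinner_self:
  assumes f: "sq_int M f"
  shows "cinner koopman_space (set_coeff f) (set_coeff f) = of_real (\<integral>x. (cmod (f x))\<^sup>2 \<partial>M)"
  by (simp add: cinner_coeff[OF f f] complex_norm_square[symmetric] del: of_real_power)

lemma hnorm_coeff:
  assumes f: "sq_int M f"
  shows "hnorm koopman_space (set_coeff f) = sqrt (\<integral>x. (cmod (f x))\<^sup>2 \<partial>M)"
  by (simp add: hnorm_def cinner_self[OF f])

lemma add_coeff: "\<lbrakk>sq_int M f; sq_int M g\<rbrakk> \<Longrightarrow>
    set_coeff f \<oplus>\<^bsub>koopman_space\<^esub> set_coeff g = set_coeff (\<lambda>x. f x + g x)"
  by (simp add: koopman_space_simps coeff_add)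

lemma smult_coeff: "sq_int M f \<Longrightarrow> c \<odot>\<^bsub>koopman_space\<^esub> set_coeff f = set_coeff (\<lambda>x. c * f x)"
  by (simp add: koopman_space_simps coeff_cmult)

lemma koopman_abelian_group: "abelian_group koopman_space"
proof (rule abelian_groupI)
  fix x y assume "x \<in> carrier koopman_space" "y \<in> carrier koopman_space"
  then show "x \<oplus>\<^bsub>koopman_space\<^esub> y \<in> carrier koopman_space"
    by (auto elim!: carrierE simp: add_coeff sq_int_add)
next
  show "\<zero>\<^bsub>koopman_space\<^esub> \<in> carrier koopman_space"
    using coeff_in[OF sq_int_zero] by (simp add: coeff_zero koopman_space_simps(2))
next
  fix x assume "x \<in> carrier koopman_space"
  then obtain f where f: "sq_int M f" "x = set_coeff f" by (rule carrierE)
  have "set_coeff (\<lambda>x. (-1) * f x) \<oplus>\<^bsub>koopman_space\<^esub> x = \<zero>\<^bsub>koopman_space\<^esub>"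
    using f by (simp add: koopman_space_simps(2,3) coeff_uminus)
  then show "\<exists>y\<in>carrier koopman_space. y \<oplus>\<^bsub>koopman_space\<^esub> x = \<zero>\<^bsub>koopman_space\<^esub>"
    by (rule bexI[OF _ coeff_in[OF sq_int_cmult[OF f(1), of "-1"]]])
qed (auto simp: koopman_space_simps algebra_simps)

lemma minus_coeff:
  assumes f: "sq_int M f" and g: "sq_int M g"
  shows "set_coeff f \<ominus>\<^bsub>koopman_space\<^esub> set_coeff g = set_coeff (\<lambda>x. f x - g x)"
proof -
  interpret K: abelian_group koopman_space by (rule koopman_abelian_group)
  have g': "sq_int M (\<lambda>x. - g x)" using sq_int_cmult[OF g, of "-1"] by simp
  have "\<ominus>\<^bsub>koopman_space\<^esub> set_coeff g = set_coeff (\<lambda>x. - g x)"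
    by (rule K.minus_equality) (use coeff_in[OF g'] g in \<open>auto simp: koopman_space_simps(2,3) coeff_uminus\<close>)
  then show ?thesis using add_coeff[OF f g'] by (simp add: a_minus_def)
qed

lemma koopman_hilbert: "hilbert_space koopman_space"
proof -
  interpret K: abelian_group koopman_space by (rule koopman_abelian_group)
  interpret C: cring "ring_of_type_algebra :: complex ring" ..
  have "Module.module (ring_of_type_algebra :: complex ring) koopman_space"
  proof (rule moduleI)
    show "cring (ring_of_type_algebra :: complex ring)" ..
    show "abelian_group koopman_space" ..
    fix a x assume "x \<in> carrier koopman_space"
    then show "a \<odot>\<^bsub>koopman_space\<^esub> x \<in> carrier koopman_space"
      by (auto elim!: carrierE simp: smult_coeff sq_int_cmult)
  qed (auto simp: koopman_space_simps ring_of_type_algebra_def algebra_simps)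
  then interpret Module.module "ring_of_type_algebra :: complex ring" koopman_space .
  show ?thesis
  proof
    fix x y z assume "x \<in> carrier koopman_space" "y \<in> carrier koopman_space" "z \<in> carrier koopman_space"
    then obtain f g h where fgh: "sq_int M f" "x = set_coeff f" "sq_int M g" "y = set_coeff g" "sq_int M h" "z = set_coeff h"
      by (blast elim: carrierE)
    show "cinner koopman_space (x \<oplus>\<^bsub>koopman_space\<^esub> y) z = cinner koopman_space x z + cinner koopman_space y z"
      using sq_int_mult_integrable[OF fgh(1) fgh(5)] sq_int_mult_integrable[OF fgh(3) fgh(5)]
      by (simp add: fgh add_coeff cinner_coeff sq_int_add distrib_right)
  next
    fix x y a assume "x \<in> carrier koopman_space" "y \<in> carrier koopman_space"
    then obtain f g where fgh: "sq_int M f" "x = set_coeff f" "sq_int M g" "y = set_coeff g"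
      by (blast elim: carrierE)
    show "cinner koopman_space (a \<odot>\<^bsub>koopman_space\<^esub> x) y = a * cinner koopman_space x y"
      by (simp add: fgh smult_coeff cinner_coeff sq_int_cmult mult.assoc)
    show "cinner koopman_space y x = cnj (cinner koopman_space x y)"
      by (simp add: fgh cinner_coeff Bochner_Integration.integral_cnj[symmetric] mult.commute del: Bochner_Integration.integral_cnj)
  next
    fix x assume "x \<in> carrier koopman_space"
    then obtain f where f: "sq_int M f" "x = set_coeff f" by (blast elim: carrierE)
    show "0 \<le> Re (cinner koopman_space x x)"
      using integral_nonneg_AE[where M=M and f="\<lambda>x. (cmod (f x))\<^sup>2"] by (simp add: f cinner_self)
    assume "cinner koopman_space x x = 0"
    then have "(\<integral>x. (cmod (f x))\<^sup>2 \<partial>M) = 0" by (simp add: f cinner_self)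
    then have "AE x in M. (cmod (f x))\<^sup>2 = 0"
      using integral_nonneg_eq_0_iff_AE[OF sq_intD(2)[OF f(1)]] by simp
    then have "AE x in M. f x = (\<lambda>x. 0) x" by eventually_elim simp
    from coeff_cong_AE[OF f(1) sq_int_zero this]
    show "x = \<zero>\<^bsub>koopman_space\<^esub>" by (simp add: f koopman_space_simps coeff_zero)
  next
    fix u :: "nat \<Rightarrow> 'a \<times> nat \<Rightarrow> complex"
    assume u: "\<forall>n. u n \<in> carrier koopman_space"
      and c: "\<forall>\<epsilon>>0. \<exists>N. \<forall>m\<ge>N. \<forall>n\<ge>N. hnorm koopman_space (u m \<ominus>\<^bsub>koopman_space\<^esub> u n) < \<epsilon>"
    define f where "f n = repr_fn (u n)" for n
    have f: "sq_int M (f n)" "u n = set_coeff (f n)" for n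
      using repr_fn_props u by (auto simp: f_def)
    have "\<exists>F. sq_int M F \<and> (\<lambda>n. \<integral>x. (cmod (f n x - F x))\<^sup>2 \<partial>M) \<longlonglongrightarrow> 0"
    proof (rule riesz_fischer[OF f(1)])
      fix e :: real assume "e > 0"
      then obtain N where N: "\<forall>m\<ge>N. \<forall>n\<ge>N. hnorm koopman_space (u m \<ominus>\<^bsub>koopman_space\<^esub> u n) < sqrt e"
        using c by (metis real_sqrt_gt_zero)
      then have "\<forall>m\<ge>N. \<forall>n\<ge>N. (\<integral>x. (cmod (f m x - f n x))\<^sup>2 \<partial>M) < e"
        by (simp add: f(2) minus_coeff[OF f(1) f(1)] hnorm_coeff[OF sq_int_diff[OF f(1) f(1)]])
      then show "\<exists>N. \<forall>m\<ge>N. \<forall>n\<ge>N. (\<integral>x. (cmod (f m x - f n x))\<^sup>2 \<partial>M) < e" by blast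
    qed
    then obtain F where F: "sq_int M F" "(\<lambda>n. \<integral>x. (cmod (f n x - F x))\<^sup>2 \<partial>M) \<longlonglongrightarrow> 0" by blast
    have "(\<lambda>n. hnorm koopman_space (u n \<ominus>\<^bsub>koopman_space\<^esub> set_coeff F)) \<longlonglongrightarrow> 0"
      using tendsto_real_sqrt[OF F(2)]
      by (simp add: f(2) minus_coeff[OF f(1) F(1)] hnorm_coeff[OF sq_int_diff[OF f(1) F(1)]])
    then show "\<exists>x\<in>carrier koopman_space. (\<lambda>n. hnorm koopman_space (u n \<ominus>\<^bsub>koopman_space\<^esub> x)) \<longlonglongrightarrow> 0"
      by (rule bexI[OF _ coeff_in[OF F(1)]])
  qed
qed

text \<open>The chosen representative agrees with \<open>f\<close> off a null set, and a
  measure-preserving map pulls null sets back to null sets.\<close>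

lemma koopman_rep_coeff:
  assumes g: "g \<in> carrier G" and f: "sq_int M f"
  shows "koopman_rep g (set_coeff f) = set_coeff (\<lambda>x. f (act (inv\<^bsub>G\<^esub> g) x))"
proof -
  have g': "inv\<^bsub>G\<^esub> g \<in> carrier G" using g by simp
  have "AE x in distr M M (act (inv\<^bsub>G\<^esub> g)). repr_fn (set_coeff f) x = f x"
    by (subst act_distr[OF g']) (rule repr_fn_coeff[OF f])
  then have "AE x in M. repr_fn (set_coeff f) (act (inv\<^bsub>G\<^esub> g) x) = f (act (inv\<^bsub>G\<^esub> g) x)"
    by (rule AE_distrD[rotated]) (rule act_measurable[OF g'])
  then have "set_coeff (\<lambda>x. repr_fn (set_coeff f) (act (inv\<^bsub>G\<^esub> g) x)) = set_coeff (\<lambda>x. f (act (inv\<^bsub>G\<^esub> g) x))"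
    by (rule coeff_cong_AE[OF sq_int_comp[OF repr_fn_props(1)[OF coeff_in[OF f]] act_measurable[OF g'] act_distr[OF g']]
          sq_int_comp[OF f act_measurable[OF g'] act_distr[OF g']]])
  then show ?thesis by (simp add: koopman_rep_def f)
qed

lemma koopman_rep_closed:
  "\<lbrakk>g \<in> carrier G; u \<in> carrier koopman_space\<rbrakk> \<Longrightarrow> koopman_rep g u \<in> carrier koopman_space"
  by (auto elim!: carrierE simp: koopman_rep_coeff intro!: coeff_in sq_int_comp[OF _ act_measurable act_distr])

lemma koopman_rep_mult:
  assumes "g \<in> carrier G" "h \<in> carrier G" "u \<in> carrier koopman_space"
  shows "koopman_rep (g \<otimes>\<^bsub>G\<^esub> h) u = koopman_rep g (koopman_rep h u)"
proof -
  from assms(3) obtain f where f: "sq_int M f" "u = set_coeff f" by (rule carrierE)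
  have c: "sq_int M (\<lambda>x. f (act (inv\<^bsub>G\<^esub> k) x))" if "k \<in> carrier G" for k
    by (rule sq_int_comp[OF f(1) act_measurable act_distr]) (use that in auto)
  have c2: "sq_int M (\<lambda>x. f (act (inv\<^bsub>G\<^esub> h) (act (inv\<^bsub>G\<^esub> g) x)))"
    by (rule sq_int_comp[OF c act_measurable act_distr]) (use assms in auto)
  have "set_coeff (\<lambda>x. f (act (inv\<^bsub>G\<^esub> (g \<otimes>\<^bsub>G\<^esub> h)) x)) = set_coeff (\<lambda>x. f (act (inv\<^bsub>G\<^esub> h) (act (inv\<^bsub>G\<^esub> g) x)))"
    by (rule coeff_cong_AE[OF c c2]) (use assms in \<open>auto simp: inv_mult_group act_mult\<close>)
  then show ?thesis using assms by (simp add: f koopman_rep_coeff c)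
qed

lemma koopman_rep_one:
  assumes "u \<in> carrier koopman_space"
  shows "koopman_rep \<one>\<^bsub>G\<^esub> u = u"
proof -
  from assms obtain f where f: "sq_int M f" "u = set_coeff f" by (rule carrierE)
  have c: "sq_int M (\<lambda>x. f (act (inv\<^bsub>G\<^esub> \<one>\<^bsub>G\<^esub>) x))"
    by (rule sq_int_comp[OF f(1) act_measurable act_distr]) auto
  have "set_coeff (\<lambda>x. f (act (inv\<^bsub>G\<^esub> \<one>\<^bsub>G\<^esub>) x)) = set_coeff f"
    by (rule coeff_cong_AE[OF c f(1)]) (auto simp: act_one)
  then show ?thesis by (simp add: f koopman_rep_coeff)
qed

lemma koopman_group_action: "group_action G (carrier koopman_space) koopman_rep"
proof -
  let ?V = "carrier koopman_space"
  have bij: "koopman_rep g \<in> Bij ?V" if g: "g \<in> carrier G" for g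
  proof -
    have "bij_betw (koopman_rep g) ?V ?V"
      by (rule bij_betw_byWitness[where f'="koopman_rep (inv\<^bsub>G\<^esub> g)"])
         (use g in \<open>auto simp: koopman_rep_closed koopman_rep_mult[symmetric] koopman_rep_one\<close>)
    then show ?thesis by (auto simp: Bij_def koopman_rep_def extensional_def)
  qed
  show ?thesis
    unfolding group_action_def group_hom_def group_hom_axioms_def
  proof (intro conjI)
    show "group G" ..
    show "group (BijGroup ?V)" by (rule group_BijGroup)
    show "koopman_rep \<in> hom G (BijGroup ?V)"
    proof (rule homI)
      fix g h assume g: "g \<in> carrier G" and h: "h \<in> carrier G"
      show "koopman_rep g \<in> carrier (BijGroup ?V)" using bij[OF g] by (simp add: BijGroup_def)
      have "koopman_rep (g \<otimes>\<^bsub>G\<^esub> h) = compose ?V (koopman_rep g) (koopman_rep h)"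
      proof
        fix u
        show "koopman_rep (g \<otimes>\<^bsub>G\<^esub> h) u = compose ?V (koopman_rep g) (koopman_rep h) u"
          by (cases "u \<in> ?V") (simp_all add: compose_def koopman_rep_mult g h, simp add: koopman_rep_def)
      qed
      then show "koopman_rep (g \<otimes>\<^bsub>G\<^esub> h) = koopman_rep g \<otimes>\<^bsub>BijGroup ?V\<^esub> koopman_rep h"
        using bij[OF g] bij[OF h] by (simp add: BijGroup_def)
    qed
  qed
qed

lemma koopman_unitary: "unitary_representation G koopman_space koopman_rep"
proof -
  interpret hilbert_space koopman_space by (rule koopman_hilbert)
  interpret group_action G "carrier koopman_space" koopman_rep by (rule koopman_group_action)
  show ?thesis
  proof
    fix g x y a assume g: "g \<in> carrier G" and "x \<in> carrier koopman_space" "y \<in> carrier koopman_space"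
    then obtain f h where f: "sq_int M f" "x = set_coeff f" and h: "sq_int M h" "y = set_coeff h"
      by (blast elim: carrierE)
    have g': "inv\<^bsub>G\<^esub> g \<in> carrier G" using g by simp
    note c = sq_int_comp[OF _ act_measurable[OF g'] act_distr[OF g']]
    show "koopman_rep g (x \<oplus>\<^bsub>koopman_space\<^esub> y) = koopman_rep g x \<oplus>\<^bsub>koopman_space\<^esub> koopman_rep g y"
      using f h g by (simp add: add_coeff koopman_rep_coeff sq_int_add c)
    show "cinner koopman_space (koopman_rep g x) (koopman_rep g y) = cinner koopman_space x y"
    proof -
      have "(\<integral>x. f x * cnj (h x) \<partial>M) = (\<integral>x. f x * cnj (h x) \<partial>distr M M (act (inv\<^bsub>G\<^esub> g)))"
        by (simp add: act_distr[OF g'])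
      also have "\<dots> = (\<integral>x. f (act (inv\<^bsub>G\<^esub> g) x) * cnj (h (act (inv\<^bsub>G\<^esub> g) x)) \<partial>M)"
        by (rule integral_distr) (use g' sq_int_mult_integrable[OF f(1) h(1)] in \<open>auto intro: act_measurable\<close>)
      finally show ?thesis using f h g by (simp add: koopman_rep_coeff cinner_coeff c)
    qed
  next
    fix g x a assume g: "g \<in> carrier G" and "x \<in> carrier koopman_space"
    then obtain f where f: "sq_int M f" "x = set_coeff f" by (blast elim: carrierE)
    have g': "inv\<^bsub>G\<^esub> g \<in> carrier G" using g by simp
    note c = sq_int_comp[OF _ act_measurable[OF g'] act_distr[OF g']]
    show "koopman_rep g (a \<odot>\<^bsub>koopman_space\<^esub> x) = a \<odot>\<^bsub>koopman_space\<^esub> koopman_rep g x"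
      using f g by (simp add: smult_coeff koopman_rep_coeff sq_int_cmult c)
  qed
qed

text \<open>The bridge from representations to sets: almost invariant sets go in as normalised
  indicators, and an \<open>H\<close>-invariant set comes out as a superlevel set of an invariant
  vector. The squared distance between a normalised indicator and its translate is the relative
  measure of the symmetric difference.\<close>

lemma relative_property_T_invariant_set:
  assumes T: "relative_property_T G H" and H: "H \<subseteq> carrier G"
    and almost: "\<And>e K. e > 0 \<Longrightarrow> finite K \<Longrightarrow> K \<subseteq> carrier G \<Longrightarrow>
      \<exists>A\<in>sets M. 0 < measure M A \<and> emeasure M A < \<infinity> \<and>
        (\<forall>s\<in>K. measure M {x\<in>space M. (x \<in> A) \<noteq> (act (inv\<^bsub>G\<^esub> s) x \<in> A)} < e * measure M A)"
  shows "\<exists>B\<in>sets M. 0 < emeasure M B \<and> emeasure M B < \<infinity> \<and>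
           (\<forall>h\<in>H. AE x in M. act (inv\<^bsub>G\<^esub> h) x \<in> B \<longleftrightarrow> x \<in> B)"
proof -
  have "almost_has_invariant_vectors G koopman_space koopman_rep"
    unfolding almost_has_invariant_vectors_def has_almost_invariant_unit_vector_def
  proof (intro allI impI)
    fix e :: real and K assume e: "e > 0" and K: "finite K \<and> K \<subseteq> carrier G"
    \<comment> \<open>The tolerance is squared because the norm is the square root of a relative
      measure.\<close>
    obtain A where A[measurable]: "A \<in> sets M" and A0: "0 < measure M A" "emeasure M A < \<infinity>"
      and AK: "\<forall>s\<in>K. measure M {x\<in>space M. (x \<in> A) \<noteq> (act (inv\<^bsub>G\<^esub> s) x \<in> A)} < e\<^sup>2 * measure M A"
      using almost[of "e\<^sup>2" K] e K by auto
    define c where "c = 1 / sqrt (measure M A)"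
    have c: "c > 0" "c\<^sup>2 * measure M A = 1"
      using A0 by (auto simp: c_def power_divide)
    define f where "f x = (complex_of_real c) * indicator A x" for x
    have int: "integrable M (\<lambda>x. indicator A x :: real)" using A0 by simp
    have f2: "(cmod (f x))\<^sup>2 = c\<^sup>2 * indicator A x" for x
      by (auto simp: f_def norm_mult split: split_indicator)
    have "f \<in> borel_measurable M" unfolding f_def by measurable
    then have f: "sq_int M f" unfolding sq_int_def f2 using int by auto
    have n1: "hnorm koopman_space (set_coeff f) = 1"
      unfolding hnorm_coeff[OF f] f2 using c A by simp
    have "hnorm koopman_space (koopman_rep s (set_coeff f) \<ominus>\<^bsub>koopman_space\<^esub> set_coeff f) < e" if "s \<in> K" for s
    proof -
      have s: "s \<in> carrier G" "inv\<^bsub>G\<^esub> s \<in> carrier G" using that K by auto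
      note c' = sq_int_comp[OF f act_measurable[OF s(2)] act_distr[OF s(2)]]
      let ?D = "{x\<in>space M. (x \<in> A) \<noteq> (act (inv\<^bsub>G\<^esub> s) x \<in> A)}"
      have [measurable]: "act (inv\<^bsub>G\<^esub> s) \<in> measurable M M" by (rule act_measurable[OF s(2)])
      have "hnorm koopman_space (koopman_rep s (set_coeff f) \<ominus>\<^bsub>koopman_space\<^esub> set_coeff f)
          = sqrt (\<integral>x. (cmod (f (act (inv\<^bsub>G\<^esub> s) x) - f x))\<^sup>2 \<partial>M)"
        by (simp add: koopman_rep_coeff[OF s(1) f] minus_coeff[OF c' f] hnorm_coeff[OF sq_int_diff[OF c' f]])
      also have "(\<integral>x. (cmod (f (act (inv\<^bsub>G\<^esub> s) x) - f x))\<^sup>2 \<partial>M) = (\<integral>x. c\<^sup>2 * indicator ?D x \<partial>M)"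
        by (rule Bochner_Integration.integral_cong) (auto simp: f_def norm_mult split: split_indicator)
      also have "\<dots> = c\<^sup>2 * measure M ?D" by simp
      also have "c\<^sup>2 * measure M ?D < c\<^sup>2 * (e\<^sup>2 * measure M A)"
        using AK that c by (intro mult_strict_left_mono) auto
      also have "c\<^sup>2 * (e\<^sup>2 * measure M A) = e\<^sup>2" using c(2) by (simp add: algebra_simps)
      finally show ?thesis using e by (simp add: real_less_lsqrt)
    qed
    then show "\<exists>\<phi>\<in>carrier koopman_space. hnorm koopman_space \<phi> = 1 \<and>
         (\<forall>s\<in>K. hnorm koopman_space (koopman_rep s \<phi> \<ominus>\<^bsub>koopman_space\<^esub> \<phi>) < e)"
      using n1 f by (intro bexI[of _ "set_coeff f"]) auto
  qed
  then have "has_nonzero_invariant_vector koopman_space koopman_rep H"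
    using T koopman_unitary unfolding relative_property_T_def by blast
  then obtain u where u: "u \<in> carrier koopman_space" "u \<noteq> \<zero>\<^bsub>koopman_space\<^esub>"
    and inv: "\<And>h. h \<in> H \<Longrightarrow> koopman_rep h u = u"
    unfolding has_nonzero_invariant_vector_def by blast
  obtain f where f: "sq_int M f" "u = set_coeff f" using u(1) by (rule carrierE)
  note [measurable] = sq_intD(1)[OF f(1)]
  have nz: "\<not> (AE x in M. f x = 0)"
  proof
    assume "AE x in M. f x = 0"
    then have "set_coeff f = (set_coeff (\<lambda>x. 0) :: 'a \<times> nat \<Rightarrow> complex)" by (intro coeff_cong_AE f sq_int_zero)
    then show False using u(2) by (simp add: f koopman_space_simps coeff_zero)
  qed
  \<comment> \<open>The vector is nonzero, so one of these superlevel sets has positive measure;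
    each inherits invariance from the vector.\<close>
  define B where "B m = {x\<in>space M. 1 / Suc m \<le> (cmod (f x))\<^sup>2}" for m :: nat
  have [measurable]: "B m \<in> sets M" for m unfolding B_def by measurable
  have "\<exists>m. emeasure M (B m) \<noteq> 0"
  proof (rule ccontr)
    assume "\<nexists>m. emeasure M (B m) \<noteq> 0"
    then have "AE x in M. \<forall>m. x \<notin> B m"
      by (subst AE_all_countable) (auto intro!: AE_not_in)
    moreover have "f x = 0" if "\<forall>m. x \<notin> B m" "x \<in> space M" for x
    proof (rule ccontr)
      assume "f x \<noteq> 0"
      then have "(cmod (f x))\<^sup>2 > 0" by simp
      then obtain m where "1 / Suc m < (cmod (f x))\<^sup>2" by (rule nat_approx_posE)
      then show False using that by (auto simp: B_def dest: less_imp_le)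
    qed
    ultimately have "AE x in M. f x = 0" by auto
    with nz show False by simp
  qed
  then obtain m where m: "emeasure M (B m) \<noteq> 0" by blast
  \<comment> \<open>Finiteness is Markov's inequality for the squared modulus, for which the set is
    rewritten with threshold 1.\<close>
  have "emeasure M (B m) = emeasure M {x\<in>space M. 1 \<le> ennreal (real (Suc m)) * ennreal ((cmod (f x))\<^sup>2)}"
  proof (rule arg_cong[where f="emeasure M"], unfold B_def, rule Collect_cong, rule conj_cong[OF refl])
    fix x
    have "1 \<le> ennreal (real (Suc m)) * ennreal ((cmod (f x))\<^sup>2)
        \<longleftrightarrow> ennreal 1 \<le> ennreal (real (Suc m) * (cmod (f x))\<^sup>2)"
      by (simp only: ennreal_mult[symmetric] ennreal_1 of_nat_0_le_iff zero_le_power2)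
    also have "\<dots> \<longleftrightarrow> 1 \<le> real (Suc m) * (cmod (f x))\<^sup>2"
      by (rule ennreal_le_iff) auto
    finally show "1 / real (Suc m) \<le> (cmod (f x))\<^sup>2
        \<longleftrightarrow> 1 \<le> ennreal (real (Suc m)) * ennreal ((cmod (f x))\<^sup>2)"
      by (simp add: field_simps)
  qed
  also have "\<dots> \<le> ennreal (real (Suc m)) * (\<integral>\<^sup>+x. ennreal ((cmod (f x))\<^sup>2) \<partial>M)"
    using nn_integral_Markov_inequality[where u="\<lambda>x. ennreal ((cmod (f x))\<^sup>2)" and A="space M" and c="ennreal (real (Suc m))" and M=M]
    by (simp add: nn_integral_multc[symmetric] cong: nn_integral_cong)
  also have "\<dots> < \<infinity>"
    by (subst sq_int_integral_eq_nn[OF f(1), symmetric]) (simp add: ennreal_mult_less_top)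
  finally have fin: "emeasure M (B m) < \<infinity>" .
  have "AE x in M. act (inv\<^bsub>G\<^esub> h) x \<in> B m \<longleftrightarrow> x \<in> B m" if h: "h \<in> H" for h
  proof -
    have hG: "h \<in> carrier G" "inv\<^bsub>G\<^esub> h \<in> carrier G" using h H by auto
    have "(set_coeff (\<lambda>x. f (act (inv\<^bsub>G\<^esub> h) x)) :: 'a \<times> nat \<Rightarrow> complex) = set_coeff f"
      using inv[OF h] by (simp add: f koopman_rep_coeff[OF hG(1)])
    then have "AE x in M. f (act (inv\<^bsub>G\<^esub> h) x) = f x"
      by (rule coeff_eqD[OF sq_int_comp[OF f(1) act_measurable[OF hG(2)] act_distr[OF hG(2)]] f(1)])
    then show ?thesis
      using AE_space by eventually_elim
        (use measurable_space[OF act_measurable[OF hG(2)]] in \<open>auto simp: B_def\<close>)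
  qed
  then show ?thesis using m fin by (intro bexI[of _ "B m"]) (auto simp: zero_less_iff_neq_zero)
qed

end

section \<open>Product measures\<close>

locale mixing_sequence = prob_space M for M :: "'x measure" +
  fixes T :: "nat \<Rightarrow> 'x \<Rightarrow> 'x" and D :: "'x set set"
  assumes T_measurable[measurable]: "T n \<in> measurable M M"
    and T_distr: "distr M M (T n) = M"
    and D_stable: "Int_stable D"
    and D_gen: "sets M = sigma_sets (space M) D"
    and D_sub: "D \<subseteq> Pow (space M)"
    and D_mixing: "\<lbrakk>A \<in> D; B \<in> D\<rbrakk> \<Longrightarrow>
      (\<lambda>n. prob (A \<inter> (T n -` B \<inter> space M))) \<longlonglongrightarrow> prob A * prob B"
begin

definition mix :: "'x set \<Rightarrow> 'x set \<Rightarrow> bool" where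
  "mix A B \<longleftrightarrow> (\<lambda>n. prob (A \<inter> (T n -` B \<inter> space M))) \<longlonglongrightarrow> prob A * prob B"

lemma prob_vimage: "B \<in> events \<Longrightarrow> prob (T n -` B \<inter> space M) = prob B"
  using measure_distr[OF T_measurable, of B n] by (simp add: T_distr)

lemma vimage_events: "B \<in> events \<Longrightarrow> T n -` B \<inter> space M \<in> events"
  by measurable

lemma mix_compl_left:
  assumes "A \<in> events" "B \<in> events" "mix A B"
  shows "mix (space M - A) B"
proof -
  have "prob ((space M - A) \<inter> (T n -` B \<inter> space M)) = prob B - prob (A \<inter> (T n -` B \<inter> space M))" for n
  proof -
    have "(space M - A) \<inter> (T n -` B \<inter> space M) = (T n -` B \<inter> space M) - (A \<inter> (T n -` B \<inter> space M))" by auto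
    then show ?thesis
      using finite_measure_Diff[OF vimage_events[OF assms(2)] sets.Int[OF assms(1) vimage_events[OF assms(2)]] Int_lower2, of n]
      by (simp add: prob_vimage assms)
  qed
  moreover have "(\<lambda>n. prob B - prob (A \<inter> (T n -` B \<inter> space M))) \<longlonglongrightarrow> prob B - prob A * prob B"
    using assms(3) unfolding mix_def by (intro tendsto_intros)
  ultimately show ?thesis unfolding mix_def using assms by (simp add: prob_compl left_diff_distrib right_diff_distrib)
qed

lemma mix_compl_right:
  assumes "A \<in> events" "B \<in> events" "mix A B"
  shows "mix A (space M - B)"
proof -
  have "prob (A \<inter> (T n -` (space M - B) \<inter> space M)) = prob A - prob (A \<inter> (T n -` B \<inter> space M))" for n
  proof -
    have "A \<inter> (T n -` (space M - B) \<inter> space M) = A - (A \<inter> (T n -` B \<inter> space M))"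
      using measurable_space[OF T_measurable, of _ n] sets.sets_into_space[OF assms(1)] by auto
    then show ?thesis
      using finite_measure_Diff[OF assms(1) sets.Int[OF assms(1) vimage_events[OF assms(2)]], of n]
      by simp
  qed
  moreover have "(\<lambda>n. prob A - prob (A \<inter> (T n -` B \<inter> space M))) \<longlonglongrightarrow> prob A - prob A * prob B"
    using assms(3) unfolding mix_def by (intro tendsto_intros)
  ultimately show ?thesis unfolding mix_def using assms by (simp add: prob_compl left_diff_distrib right_diff_distrib)
qed

text \<open>Dominated convergence for series. It passes the limit through countable disjoint unions,
  dominated by the probabilities of the pieces.\<close>

lemma tendsto_suminf_dominated:
  fixes f :: "nat \<Rightarrow> nat \<Rightarrow> real"
  assumes "\<And>i. (\<lambda>n. f i n) \<longlonglongrightarrow> g i" "\<And>i n. \<bar>f i n\<bar> \<le> h i" "summable h"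
  shows "(\<lambda>n. suminf (\<lambda>i. f i n)) \<longlonglongrightarrow> suminf g"
proof -
  have "((\<lambda>n. suminf (\<lambda>i. f i n)) \<longlongrightarrow> suminf g) sequentially"
    by (rule conjunct2[OF conjunct2[OF tannerys_theorem[where M=h and b=g]]])
       (use assms in \<open>auto simp: case_prod_unfold\<close>)
  then show ?thesis .
qed

lemma mix_union_left:
  assumes "disjoint_family A" "\<And>i. A i \<in> events" "B \<in> events" "\<And>i::nat. mix (A i) B"
  shows "mix (\<Union>i. A i) B"
proof -
  have "prob ((\<Union>i. A i) \<inter> (T n -` B \<inter> space M)) = suminf (\<lambda>i. prob (A i \<inter> (T n -` B \<inter> space M)))" for n
  proof -
    have "(\<lambda>i. prob (A i \<inter> (T n -` B \<inter> space M))) sums prob (\<Union>i. A i \<inter> (T n -` B \<inter> space M))"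
      using assms vimage_events[of B n]
      by (intro finite_measure_UNION) (auto simp: disjoint_family_on_def)
    then show ?thesis by (simp add: sums_iff Int_UN_distrib2)
  qed
  moreover have S: "(\<lambda>i. prob (A i)) sums prob (\<Union>i. A i)"
    using assms by (intro finite_measure_UNION) auto
  have "(\<lambda>n. suminf (\<lambda>i. prob (A i \<inter> (T n -` B \<inter> space M)))) \<longlonglongrightarrow> suminf (\<lambda>i. prob (A i) * prob B)"
    by (rule tendsto_suminf_dominated[where h="\<lambda>i. prob (A i)"])
       (use assms(4) S in \<open>auto simp: mix_def sums_iff intro!: finite_measure_mono assms(2)\<close>)
  moreover have "suminf (\<lambda>i. prob (A i) * prob B) = prob (\<Union>i. A i) * prob B"
    using S by (simp add: sums_iff suminf_mult2[symmetric])
  ultimately show ?thesis by (simp add: mix_def)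
qed

lemma mix_union_right:
  assumes "disjoint_family B" "\<And>i. B i \<in> events" "A \<in> events" "\<And>i::nat. mix A (B i)"
  shows "mix A (\<Union>i. B i)"
proof -
  have "prob (A \<inter> (T n -` (\<Union>i. B i) \<inter> space M)) = suminf (\<lambda>i. prob (A \<inter> (T n -` B i \<inter> space M)))" for n
  proof -
    have "(\<lambda>i. prob (A \<inter> (T n -` B i \<inter> space M))) sums prob (\<Union>i. A \<inter> (T n -` B i \<inter> space M))"
      using assms vimage_events[OF assms(2), of n]
      by (intro finite_measure_UNION) (auto simp: disjoint_family_on_def)
    moreover have "(\<Union>i. A \<inter> (T n -` B i \<inter> space M)) = A \<inter> (T n -` (\<Union>i. B i) \<inter> space M)" by auto
    ultimately show ?thesis by (simp add: sums_iff)
  qed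
  moreover have S: "(\<lambda>i. prob (B i)) sums prob (\<Union>i. B i)"
    using assms by (intro finite_measure_UNION) auto
  have "(\<lambda>n. suminf (\<lambda>i. prob (A \<inter> (T n -` B i \<inter> space M)))) \<longlonglongrightarrow> suminf (\<lambda>i. prob A * prob (B i))"
  proof (rule tendsto_suminf_dominated[where h="\<lambda>i. prob (B i)"])
    fix i n
    have "prob (A \<inter> (T n -` B i \<inter> space M)) \<le> prob (T n -` B i \<inter> space M)"
      by (intro finite_measure_mono vimage_events assms) auto
    then show "\<bar>prob (A \<inter> (T n -` B i \<inter> space M))\<bar> \<le> prob (B i)" by (simp add: prob_vimage assms(2))
  qed (use assms(4) S in \<open>auto simp: mix_def sums_iff\<close>)
  moreover have "suminf (\<lambda>i. prob A * prob (B i)) = prob A * prob (\<Union>i. B i)"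
    using S by (simp add: sums_iff suminf_mult)
  ultimately show ?thesis by (simp add: mix_def)
qed

lemma mix_empty: "mix {} B" "mix A {}"
  by (auto simp: mix_def)

text \<open>Dynkin's argument in one factor at a time: against a fixed member of \<open>D\<close>
  mixing extends to all events on the left, and afterwards, against a fixed event on the left, to
  all events on the right.\<close>

lemma mix_all:
  assumes "A \<in> events" "B \<in> events"
  shows "mix A B"
proof -
  note D_events = sigma_sets.Basic[of _ D "space M", folded D_gen]
  have left: "mix A' B'" if "A' \<in> events" "B' \<in> D" for A' B'
  proof -
    have "A' \<in> sigma_sets (space M) D" using that D_gen by simp
    then show ?thesis
    proof (rule sigma_sets_induct_disjoint[OF D_stable D_sub], goal_cases)
      case (1 A) then show ?case using D_mixing that(2) by (simp add: mix_def)
    next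
      case 2 show ?case by (rule mix_empty)
    next
      case (3 A) then show ?case using D_events that(2) by (intro mix_compl_left) (auto simp: D_gen)
    next
      case (4 A) then show ?case using D_events that(2) by (intro mix_union_left) (auto simp: D_gen)
    qed
  qed
  have "B \<in> sigma_sets (space M) D" using assms D_gen by simp
  then show ?thesis
  proof (rule sigma_sets_induct_disjoint[OF D_stable D_sub], goal_cases)
    case (1 B) then show ?case using left assms by simp
  next
    case 2 show ?case by (rule mix_empty)
  next
    case (3 B) then show ?case using assms by (intro mix_compl_right) (auto simp: D_gen)
  next
    case (4 B) then show ?case using assms by (intro mix_union_right) (auto simp: D_gen)
  qed
qed

text \<open>Invariance makes the event coincide with its preimages up to null sets, while mixing
  makes them asymptotically independent; so \<open>prob A\<close> equals its own square.\<close>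

lemma invariant_event_trivial:
  assumes A: "A \<in> events" and inv: "\<And>n. AE x in M. T n x \<in> A \<longleftrightarrow> x \<in> A"
  shows "prob A = 0 \<or> prob A = 1"
proof -
  have "prob (A \<inter> (T n -` A \<inter> space M)) = prob A" for n
  proof (rule finite_measure_eq_AE)
    show "AE x in M. (x \<in> A \<inter> (T n -` A \<inter> space M)) = (x \<in> A)"
      using inv[of n] AE_space by eventually_elim auto
  qed (use A vimage_events[OF A, of n] in auto)
  then have "(\<lambda>n. prob A) \<longlonglongrightarrow> prob A * prob A"
    using mix_all[OF A A] by (simp add: mix_def)
  then have "prob A = prob A * prob A" by (simp add: LIMSEQ_const_iff)
  then show ?thesis by auto
qed

end

text \<open>Two cylinder events depend on finitely many coordinates. Once the index map has moved
  these off themselves, the events are exactly independent, so the sequence of probabilities is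
  eventually constant.\<close>

lemma iid_mixing_sequence:
  fixes t :: "nat \<Rightarrow> 'i \<Rightarrow> 'i" and m :: "'c measure"
  assumes m: "prob_space m" and inj: "\<And>n. inj_on (t n) I" and into: "\<And>n. t n \<in> I \<rightarrow> I"
    and far: "\<And>J. finite J \<Longrightarrow> J \<subseteq> I \<Longrightarrow> eventually (\<lambda>n. t n ` J \<inter> J = {}) sequentially"
  shows "mixing_sequence (PiM I (\<lambda>_. m)) (\<lambda>n \<omega>. \<lambda>i\<in>I. \<omega> (t n i)) (prod_algebra I (\<lambda>_. m))"
proof -
  interpret prob_space "PiM I (\<lambda>_. m)" by (rule prob_space_PiM) (rule m)
  interpret m: prob_space m by (rule m)
  let ?M = "PiM I (\<lambda>_. m)"
  show ?thesis
  proof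
    fix n
    show "(\<lambda>\<omega>. \<lambda>i\<in>I. \<omega> (t n i)) \<in> measurable ?M ?M"
      using into[of n] by (intro measurable_restrict measurable_component_singleton) auto
    show "distr ?M ?M (\<lambda>\<omega>. \<lambda>i\<in>I. \<omega> (t n i)) = ?M"
      using distr_PiM_reindex[of I "\<lambda>_. m" "t n" I] m inj into by simp
  next
    show "Int_stable (prod_algebra I (\<lambda>_. m))" by (rule Int_stable_prod_algebra)
    show "sets ?M = sigma_sets (space ?M) (prod_algebra I (\<lambda>_. m))"
      by (simp add: sets_PiM space_PiM)
    show "prod_algebra I (\<lambda>_. m) \<subseteq> Pow (space ?M)"
      unfolding space_PiM by (rule prod_algebra_sets_into_space)
  next
    fix A B assume A: "A \<in> prod_algebra I (\<lambda>_. m)" and B: "B \<in> prod_algebra I (\<lambda>_. m)"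
    obtain J U where J: "A = prod_emb I (\<lambda>_. m) J (Pi\<^sub>E J U)" "finite J" "J \<subseteq> I" "\<And>i. i \<in> J \<Longrightarrow> U i \<in> sets m"
      using prod_algebraE[OF A] by metis
    obtain K Y where K: "B = prod_emb I (\<lambda>_. m) K (Pi\<^sub>E K Y)" "finite K" "K \<subseteq> I" "\<And>i. i \<in> K \<Longrightarrow> Y i \<in> sets m"
      using prod_algebraE[OF B] by metis
    \<comment> \<open>Applying the hypothesis to the union of both index sets makes
      \<open>t n\<close> carry \<open>K\<close> away from \<open>J\<close>.\<close>
    have ev: "eventually (\<lambda>n. t n ` (J \<union> K) \<inter> (J \<union> K) = {}) sequentially"
      using J K by (intro far) auto
    have PA: "prob A = (\<Prod>i\<in>J. measure m (U i))"
      using emeasure_PiM_emb[of I "\<lambda>_. m" J U] J m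
      by (simp add: emeasure_eq_measure m.emeasure_eq_measure prod_ennreal measure_nonneg prod_nonneg)
    have PB: "prob B = (\<Prod>i\<in>K. measure m (Y i))"
      using emeasure_PiM_emb[of I "\<lambda>_. m" K Y] K m
      by (simp add: emeasure_eq_measure m.emeasure_eq_measure prod_ennreal measure_nonneg prod_nonneg)
    have "eventually (\<lambda>n. prob (A \<inter> ((\<lambda>\<omega>. \<lambda>i\<in>I. \<omega> (t n i)) -` B \<inter> space ?M)) = prob A * prob B) sequentially"
      using ev
    proof eventually_elim
      fix n assume n: "t n ` (J \<union> K) \<inter> (J \<union> K) = {}"
      have injK: "inj_on (t n) K" using inj[of n] K(3) inj_on_subset by blast
      \<comment> \<open>The intersection is again one cylinder: it has the constraints
        \<open>U\<close> on \<open>J\<close>, and those of \<open>Y\<close> transported to the image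
        of \<open>K\<close>.\<close>
      define Z where "Z i = (if i \<in> J then U i else Y (the_inv_into K (t n) i))" for i
      have Zt: "Z (t n k) = Y k" if "k \<in> K" for k
        using that n injK by (auto simp: Z_def the_inv_into_f_f)
      have dis: "J \<inter> t n ` K = {}" using n by auto
      have sub: "J \<union> t n ` K \<subseteq> I" using J K into[of n] by auto
      have Zs: "Z i \<in> sets m" if "i \<in> J \<union> t n ` K" for i
        using that J(4) K(4) Zt by (cases "i \<in> J") (auto simp: Z_def the_inv_into_f_f injK)
      have "A \<inter> ((\<lambda>\<omega>. \<lambda>i\<in>I. \<omega> (t n i)) -` B \<inter> space ?M)
          = prod_emb I (\<lambda>_. m) (J \<union> t n ` K) (Pi\<^sub>E (J \<union> t n ` K) Z)" (is "?L = ?R")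
      proof -
        have spc: "\<omega> i \<in> space m" if "\<omega> \<in> space ?M" "i \<in> I" for \<omega> i
          using that by (auto simp: space_PiM PiE_iff)
        have a: "\<omega> \<in> A \<longleftrightarrow> \<omega> \<in> space ?M \<and> (\<forall>i\<in>J. \<omega> i \<in> U i)" for \<omega>
          using J(3) by (auto simp: J(1) prod_emb_def space_PiM)
        have b: "\<omega> \<in> B \<longleftrightarrow> \<omega> \<in> space ?M \<and> (\<forall>i\<in>K. \<omega> i \<in> Y i)" for \<omega>
          using K(3) by (auto simp: K(1) prod_emb_def space_PiM)
        have r: "\<omega> \<in> ?R \<longleftrightarrow> \<omega> \<in> space ?M \<and> (\<forall>i\<in>J \<union> t n ` K. \<omega> i \<in> Z i)" for \<omega>
          using sub by (auto simp: prod_emb_def space_PiM)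
        have tI: "t n i \<in> I" if "i \<in> I" for i using that into by auto
        have sh: "(\<lambda>i\<in>I. \<omega> (t n i)) \<in> space ?M" if "\<omega> \<in> space ?M" for \<omega>
          using that tI by (auto simp: space_PiM PiE_iff)
        show ?thesis
        proof (rule Set.set_eqI)
          fix \<omega>
          have "\<omega> \<in> ?R \<longleftrightarrow> \<omega> \<in> space ?M \<and> (\<forall>i\<in>J. \<omega> i \<in> U i) \<and> (\<forall>k\<in>K. \<omega> (t n k) \<in> Y k)"
            unfolding r by (simp add: ball_Un Zt) (simp add: Z_def)
          also have "\<dots> \<longleftrightarrow> \<omega> \<in> ?L"
            using K(3) sh by (auto simp: a b subset_iff)
          finally show "\<omega> \<in> ?L \<longleftrightarrow> \<omega> \<in> ?R" by simp
        qed
      qed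
      then have "prob ?L = measure ?M ?R" by simp
      also have "\<dots> = (\<Prod>i\<in>J \<union> t n ` K. measure m (Z i))"
        using emeasure_PiM_emb[of I "\<lambda>_. m" "J \<union> t n ` K" Z] sub J(2) K(2) Zs m
        by (simp add: emeasure_eq_measure m.emeasure_eq_measure prod_ennreal measure_nonneg prod_nonneg)
      also have "\<dots> = (\<Prod>i\<in>J. measure m (Z i)) * (\<Prod>i\<in>t n ` K. measure m (Z i))"
        using J(2) K(2) dis by (intro prod.union_disjoint) auto
      also have "(\<Prod>i\<in>t n ` K. measure m (Z i)) = (\<Prod>i\<in>K. measure m (Y i))"
        using injK by (simp add: prod.reindex Zt)
      also have "(\<Prod>i\<in>J. measure m (Z i)) = (\<Prod>i\<in>J. measure m (U i))"
        by (simp add: Z_def)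
      finally show "prob ?L = prob A * prob B" unfolding PA PB .
    qed
    then show "(\<lambda>n. prob (A \<inter> ((\<lambda>\<omega>. \<lambda>i\<in>I. \<omega> (t n i)) -` B \<inter> space ?M))) \<longlonglongrightarrow> prob A * prob B"
      by (rule tendsto_eventually)
  qed
qed

text \<open>The two measures agree on finite cylinders. This is how the percolation laws of the
  levels are read off from the law of the labels.\<close>

lemma distr_PiM_pmf_map:
  "distr (PiM I (\<lambda>_. measure_pmf q)) (PiM I (\<lambda>_. measure_pmf (map_pmf f q))) (\<lambda>\<omega>. \<lambda>i\<in>I. f (\<omega> i))
     = PiM I (\<lambda>_. measure_pmf (map_pmf f q))"
proof (rule measure_eqI_PiM_infinite[symmetric, OF refl])
  interpret prob_space "PiM I (\<lambda>_. measure_pmf (map_pmf f q))"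
    by (rule prob_space_PiM) (rule prob_space_measure_pmf)
  show "finite_measure (PiM I (\<lambda>_. measure_pmf (map_pmf f q)))" by unfold_locales
  fix J A assume J: "finite J" "J \<subseteq> I"
  have [measurable]: "(\<lambda>\<omega>. \<lambda>i\<in>I. f (\<omega> i)) \<in> measurable (PiM I (\<lambda>_. measure_pmf q)) (PiM I (\<lambda>_. measure_pmf (map_pmf f q)))"
    by (intro measurable_restrict measurable_compose[OF measurable_component_singleton]) auto
  let ?E = "prod_emb I (\<lambda>_. measure_pmf (map_pmf f q)) J (Pi\<^sub>E J A)"
  have "emeasure (PiM I (\<lambda>_. measure_pmf (map_pmf f q))) ?E = (\<Prod>i\<in>J. emeasure (measure_pmf (map_pmf f q)) (A i))"
    using J by (intro emeasure_PiM_emb) (auto simp: prob_space_measure_pmf)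
  also have "\<dots> = (\<Prod>i\<in>J. emeasure (measure_pmf q) (f -` A i))" by simp
  also have "\<dots> = emeasure (PiM I (\<lambda>_. measure_pmf q)) (prod_emb I (\<lambda>_. measure_pmf q) J (Pi\<^sub>E J (\<lambda>i. f -` A i)))"
    using J by (intro emeasure_PiM_emb[symmetric]) (auto simp: prob_space_measure_pmf)
  also have "prod_emb I (\<lambda>_. measure_pmf q) J (Pi\<^sub>E J (\<lambda>i. f -` A i))
      = (\<lambda>\<omega>. \<lambda>i\<in>I. f (\<omega> i)) -` ?E \<inter> space (PiM I (\<lambda>_. measure_pmf q))"
    using J(2) by (auto simp: prod_emb_def space_PiM PiE_iff subset_iff)
  also have "emeasure (PiM I (\<lambda>_. measure_pmf q)) \<dots>
      = emeasure (distr (PiM I (\<lambda>_. measure_pmf q)) (PiM I (\<lambda>_. measure_pmf (map_pmf f q))) (\<lambda>\<omega>. \<lambda>i\<in>I. f (\<omega> i))) ?E"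
    using J by (intro emeasure_distr[symmetric]) (auto intro!: sets_PiM_I)
  finally show "emeasure (PiM I (\<lambda>_. measure_pmf (map_pmf f q))) ?E
      = emeasure (distr (PiM I (\<lambda>_. measure_pmf q)) (PiM I (\<lambda>_. measure_pmf (map_pmf f q))) (\<lambda>\<omega>. \<lambda>i\<in>I. f (\<omega> i))) ?E" .
qed simp

lemma indep_vars_PiM_coordinates:
  assumes "\<And>i. prob_space (M i)" "I \<noteq> {}"
  shows "prob_space.indep_vars (PiM I M) M (\<lambda>i \<omega>. \<omega> i) I"
proof -
  interpret prob_space "PiM I M" by (rule prob_space_PiM) (rule assms)
  show ?thesis
  proof (subst indep_vars_iff_distr_eq_PiM')
    show "distr (PiM I M) (PiM I M) (\<lambda>x. \<lambda>i\<in>I. x i) = (\<Pi>\<^sub>M i\<in>I. distr (PiM I M) (M i) (\<lambda>\<omega>. \<omega> i))"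
    proof -
      have "distr (PiM I M) (PiM I M) (\<lambda>x. \<lambda>i\<in>I. x i) = distr (PiM I M) (PiM I M) (\<lambda>x. x)"
        by (rule distr_cong) (auto simp: space_PiM PiE_iff extensional_restrict)
      moreover have "(\<Pi>\<^sub>M i\<in>I. distr (PiM I M) (M i) (\<lambda>\<omega>. \<omega> i)) = PiM I M"
        by (intro PiM_cong) (auto intro: distr_PiM_component assms)
      ultimately show ?thesis by simp
    qed
  qed (use assms in auto)
qed

text \<open>A coordinate of the disjunction is false exactly when it is false in both factors, which
  has probability \<open>(1 - p) * (1 - q)\<close>. For percolation, independent opening of further
  edges turns parameter \<open>p\<close> into \<open>p + q - p * q\<close>.\<close>

lemma distr_bernoulli_or:
  assumes p: "p \<in> {0..1}" and q: "q \<in> {0..1}" and I: "I \<noteq> {}"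
  defines "P \<equiv> \<lambda>p. PiM I (\<lambda>_. measure_pmf (bernoulli_pmf p))"
  shows "distr (P p \<Otimes>\<^sub>M P q) (P (p + q - p * q)) (\<lambda>(a, b). \<lambda>i\<in>I. a i \<or> b i) = P (p + q - p * q)"
proof -
  define r where "r = p + q - p * q"
  have r: "r \<in> {0..1}" "1 - r = (1 - p) * (1 - q)"
  proof -
    show *: "1 - r = (1 - p) * (1 - q)" by (simp add: r_def algebra_simps)
    have "0 \<le> (1 - p) * (1 - q)" "(1 - p) * (1 - q) \<le> 1" using p q by (auto intro: mult_le_one)
    then show "r \<in> {0..1}" using * by auto
  qed
  \<comment> \<open>Both factors are realised on one product indexed by \<open>I\<close> times bool.
    Its independent coordinates can be grouped by the second component, which gives the pair of
    configurations, or by the first, which gives independence of the disjunctions.\<close>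
  define m where "m k = measure_pmf (bernoulli_pmf (if snd k then q else p))" for k :: "'a \<times> bool"
  define K where "K = I \<times> (UNIV :: bool set)"
  have m: "prob_space (m k)" for k unfolding m_def by (rule prob_space_measure_pmf)
  define N where "N = PiM K m"
  have K: "K \<noteq> {}" using I by (auto simp: K_def)
  interpret N: prob_space N unfolding N_def by (rule prob_space_PiM) (rule m)
  have ind: "N.indep_vars m (\<lambda>k \<omega>. \<omega> k) K"
    unfolding N_def by (rule indep_vars_PiM_coordinates[OF m K])
  have sm: "sets (m k) = UNIV" "space (m k) = UNIV" for k by (auto simp: m_def)
  have law: "distr N (P (if b then q else p)) (\<lambda>\<omega>. \<lambda>i\<in>I. \<omega> (i, b)) = P (if b then q else p)" for b
    using distr_PiM_reindex[of K m "\<lambda>i. (i, b)" I] m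
    by (simp add: N_def P_def m_def K_def inj_on_def)
  have meas: "(\<lambda>\<omega>. \<lambda>i\<in>I. \<omega> (i, b)) \<in> measurable N (P s)" for b s
    unfolding N_def P_def
    by (intro measurable_restrict measurable_compose[OF measurable_component_singleton[of "(_, b)" K m]])
       (auto simp: K_def m_def)
  have iv: "N.indep_var (P p) (\<lambda>\<omega>. \<lambda>i\<in>I. \<omega> (i, False)) (P q) (\<lambda>\<omega>. \<lambda>i\<in>I. \<omega> (i, True))"
  proof -
    have "N.indep_var (PiM (I \<times> {False}) m) (\<lambda>\<omega>. restrict (\<lambda>k. \<omega> k) (I \<times> {False}))
        (PiM (I \<times> {True}) m) (\<lambda>\<omega>. restrict (\<lambda>k. \<omega> k) (I \<times> {True}))"
      by (rule N.indep_var_restrict[OF ind]) (auto simp: K_def)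
    then have "N.indep_var (P p) ((\<lambda>\<omega>. \<lambda>i\<in>I. \<omega> (i, False)) \<circ> (\<lambda>\<omega>. restrict (\<lambda>k. \<omega> k) (I \<times> {False})))
        (P q) ((\<lambda>\<omega>. \<lambda>i\<in>I. \<omega> (i, True)) \<circ> (\<lambda>\<omega>. restrict (\<lambda>k. \<omega> k) (I \<times> {True})))"
      unfolding P_def
      by (rule N.indep_var_compose; intro measurable_restrict measurable_compose[OF measurable_component_singleton[of _ _ m]])
         (auto simp: m_def)
    moreover have "((\<lambda>\<omega> :: 'a \<times> bool \<Rightarrow> bool. \<lambda>i\<in>I. \<omega> (i, b)) \<circ> (\<lambda>\<omega>. restrict (\<lambda>k. \<omega> k) (I \<times> {b}))) = (\<lambda>\<omega>. \<lambda>i\<in>I. \<omega> (i, b))" for b :: bool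
      by (auto simp: fun_eq_iff restrict_def)
    ultimately show ?thesis by (simp only:)
  qed
  have joint: "P p \<Otimes>\<^sub>M P q = distr N (P p \<Otimes>\<^sub>M P q) (\<lambda>\<omega>. (\<lambda>i\<in>I. \<omega> (i, False), \<lambda>i\<in>I. \<omega> (i, True)))"
    using iv law[of False] law[of True] unfolding N.indep_var_distribution_eq by simp
  let ?X = "\<lambda>i \<omega>. \<omega> (i, False) \<or> \<omega> (i, True)"
  let ?b = "\<lambda>i. measure_pmf (bernoulli_pmf r)"
  have "N.indep_vars (\<lambda>i. PiM ({i} \<times> UNIV) m) (\<lambda>i \<omega>. restrict (\<lambda>k. \<omega> k) ({i} \<times> UNIV)) I"
    by (rule N.indep_vars_restrict[OF ind]) (auto simp: K_def disjoint_family_on_def)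
  then have "N.indep_vars ?b (\<lambda>i \<omega>. ?X i (restrict (\<lambda>k. \<omega> k) ({i} \<times> UNIV))) I"
  proof (rule N.indep_vars_compose2)
    fix i
    have [measurable]: "(\<lambda>\<omega>. \<omega> (i, b)) \<in> measurable (PiM ({i} \<times> UNIV) m) (count_space UNIV)" for b
    proof -
      have "(\<lambda>\<omega>. \<omega> (i, b)) \<in> measurable (PiM ({i} \<times> UNIV) m) (m (i, b))"
        by (rule measurable_component_singleton) auto
      also have "measurable (PiM ({i} \<times> UNIV) m) (m (i, b)) = measurable (PiM ({i} \<times> UNIV) m) (count_space UNIV)"
        by (rule measurable_cong_sets) (auto simp: sm)
      finally show ?thesis .
    qed
    have "?X i \<in> measurable (PiM ({i} \<times> UNIV) m) (count_space UNIV)" by measurable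
    then show "?X i \<in> measurable (PiM ({i} \<times> UNIV) m) (?b i)" by (simp cong: measurable_cong_sets)
  qed
  then have ind2: "N.indep_vars ?b ?X I" by simp
  have Xm: "?X i \<in> measurable N (?b i)" if "i \<in> I" for i
    using ind2 that by (auto simp: N.indep_vars_def)
  have X: "distr N (?b i) (?X i) = ?b i" if i: "i \<in> I" for i
  proof -
    have "emeasure (distr N (?b i) (?X i)) {False} = emeasure N (?X i -` {False} \<inter> space N)"
      by (rule emeasure_distr[OF Xm[OF i]]) simp
    also have "?X i -` {False} \<inter> space N
        = prod_emb K m ({i} \<times> UNIV) (Pi\<^sub>E ({i} \<times> UNIV) (\<lambda>_. {False}))"
    proof (rule Set.set_eqI)
      fix \<omega>
      have J: "{i} \<times> UNIV = {(i, False), (i, True)}" by (auto simp: UNIV_bool)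
      have "\<omega> \<in> prod_emb K m ({i} \<times> UNIV) (Pi\<^sub>E ({i} \<times> UNIV) (\<lambda>_. {False}))
          \<longleftrightarrow> \<omega> \<in> space N \<and> (\<forall>k\<in>{i} \<times> UNIV. \<omega> k = False)"
        by (simp only: prod_emb_def restrict_PiE_iff Int_iff vimage_eq N_def space_PiM) auto
      then show "\<omega> \<in> ?X i -` {False} \<inter> space N \<longleftrightarrow>
          \<omega> \<in> prod_emb K m ({i} \<times> UNIV) (Pi\<^sub>E ({i} \<times> UNIV) (\<lambda>_. {False}))"
        unfolding J by auto
    qed
    also have "emeasure N \<dots> = (\<Prod>k\<in>{i} \<times> UNIV. emeasure (m k) {False})"
      unfolding N_def using i by (intro emeasure_PiM_emb) (auto simp: m K_def sm)
    also have "\<dots> = emeasure (m (i, False)) {False} * emeasure (m (i, True)) {False}"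
      by (simp add: UNIV_bool prod.insert insert_Times_insert)
    also have "\<dots> = ennreal ((1 - p) * (1 - q))"
      using p q by (simp add: m_def emeasure_pmf_single ennreal_mult)
    also have "\<dots> = emeasure (?b i) {False}"
      using r by (simp add: emeasure_pmf_single)
    finally have F: "emeasure (distr N (?b i) (?X i)) {False} = emeasure (?b i) {False}" .
    interpret d: prob_space "distr N (?b i) (?X i)" by (rule N.prob_space_distr[OF Xm[OF i]])
    have T: "emeasure (distr N (?b i) (?X i)) {True} = emeasure (?b i) {True}"
    proof -
      have "measure (distr N (?b i) (?X i)) {True} = 1 - measure (distr N (?b i) (?X i)) {False}"
        using d.prob_compl[of "{False}"] by (simp add: UNIV_bool insert_Diff_if)
      also have "\<dots> = 1 - measure (?b i) {False}" using F by (simp add: measure_def)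
      also have "\<dots> = measure (?b i) {True}"
        using measure_pmf.prob_compl[of "{False}" "bernoulli_pmf r"] by (simp add: UNIV_bool insert_Diff_if)
      finally show ?thesis by (simp add: d.emeasure_eq_measure measure_pmf.emeasure_eq_measure)
    qed
    show ?thesis
    proof (rule measure_eqI_countable[where A=UNIV])
      fix a :: bool show "emeasure (distr N (?b i) (?X i)) {a} = emeasure (?b i) {a}"
        using F T by (cases a) auto
    qed auto
  qed
  have "distr N (PiM I ?b) (\<lambda>\<omega>. \<lambda>i\<in>I. ?X i \<omega>) = PiM I (\<lambda>i. distr N (?b i) (?X i))"
    using N.indep_vars_iff_distr_eq_PiM'[where I=I and M'="?b" and X="?X"] I Xm ind2 by blast
  also have "\<dots> = PiM I ?b" by (intro PiM_cong X) auto
  finally have fin: "distr N (P r) (\<lambda>\<omega>. \<lambda>i\<in>I. ?X i \<omega>) = P r" by (simp add: P_def)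
  have or_meas: "(\<lambda>(a, b). \<lambda>i\<in>I. a i \<or> b i) \<in> measurable (P p \<Otimes>\<^sub>M P q) (P s)" for s
  proof -
    have c: "(\<lambda>a. a i) \<in> measurable (P s) (count_space UNIV)" if "i \<in> I" for i s
      unfolding P_def using measurable_component_singleton[OF that, of "\<lambda>_. measure_pmf (bernoulli_pmf s)"]
      by (simp cong: measurable_cong_sets)
    have "(\<lambda>x. fst x i \<or> snd x i) \<in> measurable (P p \<Otimes>\<^sub>M P q) (count_space UNIV)" if "i \<in> I" for i
      using measurable_compose[OF measurable_fst c[OF that]] measurable_compose[OF measurable_snd c[OF that]]
      by measurable
    then show ?thesis
      unfolding P_def case_prod_unfold by (intro measurable_restrict) (simp cong: measurable_cong_sets)
  qed
  have "distr (P p \<Otimes>\<^sub>M P q) (P r) (\<lambda>(a, b). \<lambda>i\<in>I. a i \<or> b i)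
      = distr N (P r) ((\<lambda>(a, b). \<lambda>i\<in>I. a i \<or> b i) \<circ> (\<lambda>\<omega>. (\<lambda>i\<in>I. \<omega> (i, False), \<lambda>i\<in>I. \<omega> (i, True))))"
    by (subst joint, rule distr_distr[OF or_meas]) (intro measurable_Pair meas)
  also have "\<dots> = distr N (P r) (\<lambda>\<omega>. \<lambda>i\<in>I. ?X i \<omega>)"
    by (rule distr_cong) (auto simp: fun_eq_iff restrict_def)
  finally show ?thesis using fin by (simp add: r_def)
qed

section \<open>Percolation on Cayley graphs\<close>

definition connected_in :: "'v set set \<Rightarrow> 'v \<Rightarrow> 'v \<Rightarrow> bool" where
  "connected_in F x y \<longleftrightarrow> (x, y) \<in> {(x, y). {x, y} \<in> F}\<^sup>*"

lemma connected_in_refl[simp, intro]: "connected_in F x x"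
  by (simp add: connected_in_def)

lemma connected_in_trans: "connected_in F x y \<Longrightarrow> connected_in F y z \<Longrightarrow> connected_in F x z"
  unfolding connected_in_def by (rule rtrancl_trans)

lemma connected_in_sym: "connected_in F x y \<Longrightarrow> connected_in F y x"
  using sym_rtrancl[of "{(x, y). {x, y} \<in> F}"]
  by (auto simp: connected_in_def sym_def insert_commute)

lemma connected_in_commute: "connected_in F x y \<longleftrightarrow> connected_in F y x"
  by (rule iffI; rule connected_in_sym)

lemma connected_in_edge: "{x, y} \<in> F \<Longrightarrow> connected_in F x y"
  unfolding connected_in_def by auto

lemma connected_in_mono: "F \<subseteq> F' \<Longrightarrow> connected_in F x y \<Longrightarrow> connected_in F' x y"
  unfolding connected_in_def by (rule subsetD[OF rtrancl_mono]) auto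

lemma connected_in_map:
  assumes "connected_in F x y" "\<And>u v. {u, v} \<in> F \<Longrightarrow> {f u, f v} \<in> F'"
  shows "connected_in F' (f x) (f y)"
  using assms(1) unfolding connected_in_def
proof (induction rule: rtrancl_induct)
  case (step y z)
  then have "(f y, f z) \<in> {(x, y). {x, y} \<in> F'}" using assms(2) by auto
  with step.IH show ?case by (rule rtrancl_into_rtrancl)
qed simp

lemma connected_in_closed:
  assumes "connected_in F x y" "x \<in> W" "\<And>u v. {u, v} \<in> F \<Longrightarrow> u \<in> W \<Longrightarrow> v \<in> W"
  shows "y \<in> W"
  using assms(1) unfolding connected_in_def
  by (induction rule: rtrancl_induct) (use assms in auto)

text \<open>Clusters are replaced by vertices lying in them. Over a countable vertex set this leaves
  only countable quantifiers, from which measurability will follow.\<close>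

lemma unique_infinite_cluster_iff:
  "unique_infinite_cluster V F \<longleftrightarrow> (\<exists>x\<in>V. infinite {y. connected_in F x y}) \<and>
     (\<forall>x\<in>V. \<forall>y\<in>V. infinite {z. connected_in F x z} \<longrightarrow> infinite {z. connected_in F y z} \<longrightarrow> connected_in F x y)"
proof -
  let ?c = "\<lambda>x. {y. connected_in F x y}"
  have c: "clusters V F = ?c ` V"
    by (auto simp: clusters_def quotient_def connected_in_def Image_def)
  have ex1: "(\<exists>!C. C \<in> f ` V \<and> Q C) \<longleftrightarrow>
      (\<exists>x\<in>V. Q (f x)) \<and> (\<forall>x\<in>V. \<forall>y\<in>V. Q (f x) \<longrightarrow> Q (f y) \<longrightarrow> f x = f y)" for f :: "'a \<Rightarrow> 'a set" and Q
    by (auto simp: Ex1_def)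
  have eq: "?c x = ?c y \<longleftrightarrow> connected_in F x y" for x y
    by (auto intro: connected_in_sym connected_in_trans)
  show ?thesis
    unfolding unique_infinite_cluster_def c by (simp only: ex1 eq)
qed

text \<open>Quantifiers range over countable sets rather than types, since the type of group
  elements may be uncountable while the carrier is countable.\<close>

lemma pred_countable_Bex:
  assumes "countable I" "\<And>i. i \<in> I \<Longrightarrow> Measurable.pred M (P i)"
  shows "Measurable.pred M (\<lambda>\<omega>. \<exists>i\<in>I. P i \<omega>)"
proof -
  have "{\<omega>\<in>space M. \<exists>i\<in>I. P i \<omega>} = (\<Union>i\<in>I. {\<omega>\<in>space M. P i \<omega>})" by auto
  also have "\<dots> \<in> sets M"
    by (rule sets.countable_UN'[OF assms(1)]) (use assms(2) in \<open>auto simp: pred_def\<close>)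
  finally show ?thesis by (simp add: pred_def)
qed

lemma pred_countable_Ball:
  assumes "countable I" "\<And>i. i \<in> I \<Longrightarrow> Measurable.pred M (P i)"
  shows "Measurable.pred M (\<lambda>\<omega>. \<forall>i\<in>I. P i \<omega>)"
proof -
  have "Measurable.pred M (\<lambda>\<omega>. \<not> (\<exists>i\<in>I. \<not> P i \<omega>))"
    by (intro pred_intros_logic(2) pred_countable_Bex assms)
  then show ?thesis by simp
qed

section \<open>Cayley graphs and their left translations\<close>

locale cayley_graph = group G for G :: "('a, 'b) monoid_scheme" (structure) +
  fixes S :: "'a set"
  assumes fsg: "finite_symmetric_generating_set G S"
    and infinite_carrier: "infinite (carrier G)"
begin

abbreviation "V \<equiv> carrier G"
abbreviation "E \<equiv> cayley_edges G S"

lemma S_props: "finite S" "S \<subseteq> V" "s \<in> S \<Longrightarrow> inv s \<in> S" "generate G S = V"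
  using fsg by (auto simp: finite_symmetric_generating_set_def)

lemma S_closed[simp]: "s \<in> S \<Longrightarrow> s \<in> V"
  using S_props(2) by auto

definition word :: "'a list \<Rightarrow> 'a" where
  "word w = foldr (\<otimes>) w \<one>"

lemma word_simps[simp]: "word [] = \<one>" "word (s # w) = s \<otimes> word w"
  by (simp_all add: word_def)

lemma word_closed[simp]: "w \<in> lists S \<Longrightarrow> word w \<in> V"
  by (induction w) auto

lemma word_append: "w \<in> lists S \<Longrightarrow> u \<in> lists S \<Longrightarrow> word (w @ u) = word w \<otimes> word u"
  by (induction w) (auto simp: m_assoc)

text \<open>Symmetry of \<open>S\<close> turns inverses of generators into generators, so products
  of generators suffice. Countability of the group and connectedness of the graph both follow from
  this.\<close>

lemma ex_word:
  assumes "x \<in> V"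
  shows "\<exists>w\<in>lists S. x = word w"
proof -
  have "x \<in> generate G S" using assms S_props(4) by simp
  then show ?thesis
  proof induction
    case one show ?case by (rule bexI[of _ "[]"]) auto
  next
    case (incl h) then show ?case by (intro bexI[of _ "[h]"]) auto
  next
    case (inv h) then show ?case using S_props(3) by (intro bexI[of _ "[inv h]"]) auto
  next
    case (eng h1 h2)
    then obtain w u where "w \<in> lists S" "h1 = word w" "u \<in> lists S" "h2 = word u" by blast
    then show ?case by (intro bexI[of _ "w @ u"]) (auto simp: word_append)
  qed
qed

lemma inv_cancel[simp]:
  "g \<in> V \<Longrightarrow> x \<in> V \<Longrightarrow> inv g \<otimes> (g \<otimes> x) = x"
  "g \<in> V \<Longrightarrow> x \<in> V \<Longrightarrow> g \<otimes> (inv g \<otimes> x) = x"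
  by (simp_all add: m_assoc[symmetric])

lemma countable_V: "countable V"
proof -
  have "V \<subseteq> word ` lists S" using ex_word by blast
  moreover have "countable (word ` lists S)" using S_props(1) by (intro countable_image countable_lists countable_finite)
  ultimately show ?thesis by (rule countable_subset)
qed

lemma edge_sub: "e \<in> E \<Longrightarrow> e \<subseteq> V"
  by (auto simp: cayley_edges_def)

lemma edge_fin: "e \<in> E \<Longrightarrow> finite e \<and> e \<noteq> {}"
  by (auto simp: cayley_edges_def)

lemma countable_E: "countable E"
proof -
  have "E = (\<lambda>(g, s). {g, g \<otimes> s}) ` (V \<times> S)" by (auto simp: cayley_edges_def)
  moreover have "countable (V \<times> S)" using S_props(1) by (intro countable_SIGMA countable_V countable_finite)
  ultimately show ?thesis by (simp only: countable_image)
qed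

lemma S_nonempty: "S \<noteq> {}"
proof
  assume "S = {}"
  then have "V \<subseteq> {\<one>}" using ex_word by fastforce
  then show False using infinite_carrier finite_subset by blast
qed

lemma E_nonempty: "E \<noteq> {}"
  using S_nonempty by (auto simp: cayley_edges_def)

definition transl :: "'a \<Rightarrow> 'a set \<Rightarrow> 'a set" where
  "transl g e = (\<lambda>x. g \<otimes> x) ` e"

lemma transl_E: "g \<in> V \<Longrightarrow> e \<in> E \<Longrightarrow> transl g e \<in> E"
proof -
  assume g: "g \<in> V" and "e \<in> E"
  then obtain a s where "a \<in> V" "s \<in> S" "e = {a, a \<otimes> s}" by (auto simp: cayley_edges_def)
  then have "transl g e = {g \<otimes> a, (g \<otimes> a) \<otimes> s}" "g \<otimes> a \<in> V" "s \<in> S"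
    using g by (auto simp: transl_def m_assoc)
  then show ?thesis unfolding cayley_edges_def by blast
qed

lemma transl_mult: "g \<in> V \<Longrightarrow> h \<in> V \<Longrightarrow> e \<subseteq> V \<Longrightarrow> transl (g \<otimes> h) e = transl g (transl h e)"
  unfolding transl_def image_image by (rule image_cong) (auto simp: m_assoc)

lemma transl_one: "e \<subseteq> V \<Longrightarrow> transl \<one> e = e"
  unfolding transl_def by force

lemma transl_inv: "g \<in> V \<Longrightarrow> e \<subseteq> V \<Longrightarrow> transl (inv g) (transl g e) = e"
  by (simp add: transl_mult[symmetric] transl_one)

lemma transl_pair[simp]: "transl g {x, y} = {g \<otimes> x, g \<otimes> y}"
  by (simp add: transl_def)

lemma transl_inj: "g \<in> V \<Longrightarrow> inj_on (transl g) E"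
  by (rule inj_onI) (metis edge_sub transl_inv)

text \<open>Fixes the sigma-algebra common to all percolation parameters, so that measurability is
  proved once for all of them.\<close>

definition config :: "('a set \<Rightarrow> bool) measure" where
  "config = PiM E (\<lambda>_. count_space UNIV)"

abbreviation "Perc \<equiv> bernoulli_percolation E"

lemma sets_Perc[measurable_cong, simp]: "sets (Perc p) = sets config"
  unfolding bernoulli_percolation_def config_def by (rule sets_PiM_cong) auto

lemma space_Perc[simp]: "space (Perc p) = space config"
  by (rule sets_eq_imp_space_eq) simp

lemma space_config: "space config = extensional E"
  by (auto simp: config_def space_PiM PiE_def)

lemma prob_space_Perc: "prob_space (Perc p)"
  unfolding bernoulli_percolation_def by (rule prob_space_PiM) (rule prob_space_measure_pmf)

lemma config_component[measurable (raw)]: "e \<in> E \<Longrightarrow> (\<lambda>\<omega>. \<omega> e) \<in> measurable config (count_space UNIV)"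
  unfolding config_def by (rule measurable_component_singleton)

lemma measurable_into_config:
  "(\<And>e. e \<in> E \<Longrightarrow> (\<lambda>x. f x e) \<in> measurable M (count_space UNIV)) \<Longrightarrow> (\<lambda>x. \<lambda>e\<in>E. f x e) \<in> measurable M config"
  unfolding config_def by (rule measurable_restrict)

text \<open>Edges are formed by multiplication on the right, so left multiplication is a graph
  automorphism. The inverse lets \<open>g\<close> carry the open edges of a configuration to those
  of its image, which makes this an action from the left.\<close>

definition shift :: "'a \<Rightarrow> ('a set \<Rightarrow> bool) \<Rightarrow> ('a set \<Rightarrow> bool)" where
  "shift g \<omega> = (\<lambda>e\<in>E. \<omega> (transl (inv g) e))"

lemma shift_measurable[measurable (raw)]:
  assumes "g \<in> V"
  shows "shift g \<in> measurable config config"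
  unfolding shift_def[abs_def]
  by (rule measurable_into_config, rule config_component) (simp add: transl_E assms)

lemma shift_measurable_Perc: "g \<in> V \<Longrightarrow> shift g \<in> measurable (Perc p) (Perc p)"
  using shift_measurable by (simp cong: measurable_cong_sets)

lemma shift_space: "g \<in> V \<Longrightarrow> \<omega> \<in> space config \<Longrightarrow> shift g \<omega> \<in> space config"
  by (simp add: space_config shift_def)

lemma distr_shift:
  assumes g: "g \<in> V"
  shows "distr (Perc p) (Perc p) (shift g) = Perc p"
  unfolding bernoulli_percolation_def shift_def[abs_def]
  by (rule distr_PiM_reindex[of E "\<lambda>_. measure_pmf (bernoulli_pmf p)" "transl (inv g)" E])
     (use transl_inj[of "inv g"] transl_E[of "inv g"] g in \<open>auto simp: prob_space_measure_pmf\<close>)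

lemma shift_mult: "g \<in> V \<Longrightarrow> h \<in> V \<Longrightarrow> shift (g \<otimes> h) \<omega> = shift g (shift h \<omega>)"
  by (auto simp: shift_def fun_eq_iff transl_E inv_mult_group transl_mult edge_sub)

lemma shift_one: "\<omega> \<in> space config \<Longrightarrow> shift \<one> \<omega> = \<omega>"
  by (auto simp: shift_def fun_eq_iff transl_one edge_sub space_config extensional_def)

lemma AE_shift:
  assumes "g \<in> V" "AE \<omega> in Perc p. Q \<omega>"
  shows "AE \<omega> in Perc p. Q (shift g \<omega>)"
proof -
  have "AE \<omega> in distr (Perc p) (Perc p) (shift g). Q \<omega>"
    by (subst distr_shift[OF assms(1)]) (rule assms(2))
  then show ?thesis by (rule AE_distrD[OF shift_measurable_Perc[OF assms(1)]])
qed

section \<open>Connection events and cluster sizes\<close>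

definition conn :: "('a set \<Rightarrow> bool) \<Rightarrow> 'a \<Rightarrow> 'a \<Rightarrow> bool" where
  "conn \<omega> = connected_in (open_edges E \<omega>)"

lemma conn_refl[simp, intro]: "conn \<omega> x x"
  by (simp add: conn_def)

lemma conn_trans: "conn \<omega> x y \<Longrightarrow> conn \<omega> y z \<Longrightarrow> conn \<omega> x z"
  unfolding conn_def by (rule connected_in_trans)

lemma conn_sym: "conn \<omega> x y \<Longrightarrow> conn \<omega> y x"
  unfolding conn_def by (rule connected_in_sym)

lemma conn_commute: "conn \<omega> x y \<longleftrightarrow> conn \<omega> y x"
  unfolding conn_def by (rule connected_in_commute)

lemma conn_V: "conn \<omega> x y \<Longrightarrow> x \<in> V \<Longrightarrow> y \<in> V"
  unfolding conn_def
  by (rule connected_in_closed) (auto simp: open_edges_def dest: edge_sub)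

lemma conn_cong: "conn \<omega> x y \<Longrightarrow> conn \<omega> x z \<longleftrightarrow> conn \<omega> y z"
  by (meson conn_trans conn_sym)

lemma conn_mono: "(\<And>e. e \<in> E \<Longrightarrow> \<omega> e \<Longrightarrow> \<omega>' e) \<Longrightarrow> conn \<omega> x y \<Longrightarrow> conn \<omega>' x y"
  unfolding conn_def by (rule connected_in_mono) (auto simp: open_edges_def)

lemma conn_shift:
  assumes g: "g \<in> V" and x: "x \<in> V" "y \<in> V"
  shows "conn (shift g \<omega>) (g \<otimes> x) (g \<otimes> y) \<longleftrightarrow> conn \<omega> x y"
proof
  assume "conn \<omega> x y"
  then show "conn (shift g \<omega>) (g \<otimes> x) (g \<otimes> y)"
    unfolding conn_def
  proof (rule connected_in_map)
    fix u v assume "{u, v} \<in> open_edges E \<omega>"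
    then have *: "{u, v} \<in> E" "\<omega> {u, v}" by (auto simp: open_edges_def)
    then have "{g \<otimes> u, g \<otimes> v} \<in> E" "transl (inv g) {g \<otimes> u, g \<otimes> v} = {u, v}"
      using transl_E[OF g *(1)] transl_inv[OF g edge_sub[OF *(1)]] by simp_all
    then show "{g \<otimes> u, g \<otimes> v} \<in> open_edges E (shift g \<omega>)"
      using * by (simp add: open_edges_def shift_def del: transl_pair)
  qed
next
  assume "conn (shift g \<omega>) (g \<otimes> x) (g \<otimes> y)"
  then have "conn \<omega> (inv g \<otimes> (g \<otimes> x)) (inv g \<otimes> (g \<otimes> y))"
    unfolding conn_def
  proof (rule connected_in_map)
    fix u v assume "{u, v} \<in> open_edges E (shift g \<omega>)"
    then have *: "{u, v} \<in> E" "\<omega> (transl (inv g) {u, v})"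
      by (auto simp: open_edges_def shift_def del: transl_pair split: if_splits)
    then show "{inv g \<otimes> u, inv g \<otimes> v} \<in> open_edges E \<omega>"
      using transl_E[of "inv g", OF _ *(1)] g by (simp add: open_edges_def)
  qed
  then show "conn \<omega> x y" using g x by simp
qed

lemma conn_shift':
  assumes g: "g \<in> V" and x: "x \<in> V" "y \<in> V"
  shows "conn (shift g \<omega>) x y \<longleftrightarrow> conn \<omega> (inv g \<otimes> x) (inv g \<otimes> y)"
  using conn_shift[of g "inv g \<otimes> x" "inv g \<otimes> y" \<omega>] assms by simp

text \<open>Induction on the length of an open path. The last but one vertex of a path ranges over
  the countable set \<open>V\<close>, because every edge consists of vertices.\<close>

lemma conn_measurable[measurable]:
  "Measurable.pred config (\<lambda>\<omega>. conn \<omega> x y)"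
proof -
  let ?R = "\<lambda>\<omega>. {(x, y). {x, y} \<in> open_edges E \<omega>}"
  have edge[measurable]: "Measurable.pred config (\<lambda>\<omega>. (u, v) \<in> ?R \<omega>)" for u v
  proof (cases "{u, v} \<in> E")
    case True
    then have "(\<lambda>\<omega>. (u, v) \<in> ?R \<omega>) = (\<lambda>\<omega>. \<omega> {u, v})" by (auto simp: open_edges_def)
    then show ?thesis using config_component[OF True] by simp
  next
    case False then show ?thesis by (simp add: open_edges_def)
  qed
  have *: "Measurable.pred config (\<lambda>\<omega>. (x, y) \<in> ?R \<omega> ^^ n)" for n
  proof (induction n arbitrary: y)
    case (Suc n)
    have "(\<lambda>\<omega>. (x, y) \<in> ?R \<omega> ^^ Suc n) = (\<lambda>\<omega>. \<exists>z\<in>V. (x, z) \<in> ?R \<omega> ^^ n \<and> (z, y) \<in> ?R \<omega>)"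
    proof (intro ext iffI)
      fix \<omega> assume "(x, y) \<in> ?R \<omega> ^^ Suc n"
      then obtain z where z: "(x, z) \<in> ?R \<omega> ^^ n" "(z, y) \<in> ?R \<omega>" by auto
      then have "z \<in> V" using edge_sub[of "{z, y}"] by (auto simp: open_edges_def)
      with z show "\<exists>z\<in>V. (x, z) \<in> ?R \<omega> ^^ n \<and> (z, y) \<in> ?R \<omega>" by blast
    qed auto
    moreover have "Measurable.pred config (\<lambda>\<omega>. \<exists>z\<in>V. (x, z) \<in> ?R \<omega> ^^ n \<and> (z, y) \<in> ?R \<omega>)"
      by (rule pred_countable_Bex[OF countable_V]) (rule pred_intros_logic(3)[OF Suc edge])
    ultimately show ?case by simp
  qed simp
  have "(\<lambda>\<omega>. conn \<omega> x y) = (\<lambda>\<omega>. \<exists>n. (x, y) \<in> ?R \<omega> ^^ n)"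
    by (auto simp: conn_def connected_in_def rtrancl_power)
  then show ?thesis using * by simp
qed

lemma conn_measurable'[measurable (raw)]:
  "f \<in> measurable M config \<Longrightarrow> Measurable.pred M (\<lambda>\<omega>. conn (f \<omega>) x y)"
  by (rule measurable_compose[OF _ conn_measurable])

text \<open>The finite sets of vertices form a countable family, so this way of saying that a
  cluster has at least \<open>k\<close> vertices is measurable; it covers infinite clusters as
  well.\<close>

definition big :: "nat \<Rightarrow> ('a set \<Rightarrow> bool) \<Rightarrow> 'a \<Rightarrow> bool" where
  "big k \<omega> x \<longleftrightarrow> (\<exists>A\<in>{A. finite A \<and> A \<subseteq> V \<and> card A = k}. \<forall>y\<in>A. conn \<omega> x y)"

lemma countable_finsets: "countable {A. finite A \<and> A \<subseteq> V}"
  by (rule countable_Collect_finite_subset[OF countable_V])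

lemma big_pred[measurable]: "Measurable.pred config (\<lambda>\<omega>. big k \<omega> x)"
  unfolding big_def
proof (rule pred_countable_Bex)
  show "countable {A. finite A \<and> A \<subseteq> V \<and> card A = k}"
    by (rule countable_subset[OF _ countable_finsets]) auto
  fix A assume "A \<in> {A. finite A \<and> A \<subseteq> V \<and> card A = k}"
  then show "Measurable.pred config (\<lambda>\<omega>. \<forall>y\<in>A. conn \<omega> x y)"
    by (intro pred_countable_Ball countable_finite conn_measurable) auto
qed

lemma big_cong: "conn \<omega> x y \<Longrightarrow> big k \<omega> x \<longleftrightarrow> big k \<omega> y"
  using conn_cong[of \<omega> x y] by (simp add: big_def)

lemma infinite_cluster_iff_big: "x \<in> V \<Longrightarrow> infinite {y. conn \<omega> x y} \<longleftrightarrow> (\<forall>k. big k \<omega> x)"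
proof
  assume x: "x \<in> V" and inf: "infinite {y. conn \<omega> x y}"
  show "\<forall>k. big k \<omega> x"
  proof
    fix k
    obtain A where "finite A" "card A = k" "A \<subseteq> {y. conn \<omega> x y}"
      using infinite_arbitrarily_large[OF inf] by blast
    then show "big k \<omega> x" using conn_V[OF _ x] unfolding big_def by blast
  qed
next
  assume x: "x \<in> V" and big: "\<forall>k. big k \<omega> x"
  show "infinite {y. conn \<omega> x y}"
  proof
    assume fin: "finite {y. conn \<omega> x y}"
    obtain A where "card A = Suc (card {y. conn \<omega> x y})" "A \<subseteq> {y. conn \<omega> x y}"
      using big[rule_format, of "Suc (card {y. conn \<omega> x y})"] unfolding big_def by blast
    then show False using card_mono[OF fin, of A] by simp
  qed
qed

lemma big_shift:
  assumes g: "g \<in> V" and x: "x \<in> V"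
  shows "big k (shift g \<omega>) (g \<otimes> x) \<longleftrightarrow> big k \<omega> x"
proof -
  have *: "big k (shift h \<eta>) (h \<otimes> y)" if hy: "h \<in> V" "y \<in> V" "big k \<eta> y" for h y \<eta>
  proof -
    obtain A where A: "finite A" "A \<subseteq> V" "card A = k" "\<forall>z\<in>A. conn \<eta> y z"
      using hy(3) by (auto simp: big_def)
    have "inj_on (\<lambda>z. h \<otimes> z) A" using A(2) that(1) by (auto intro!: inj_onI simp: subset_iff)
    then show ?thesis unfolding big_def
      using A that conn_shift[OF that(1) that(2)]
      by (intro bexI[of _ "(\<lambda>z. h \<otimes> z) ` A"]) (auto simp: card_image subset_iff)
  qed
  show ?thesis
  proof
    assume "big k (shift g \<omega>) (g \<otimes> x)"
    then have "big k (shift (inv g) (shift g \<omega>)) (inv g \<otimes> (g \<otimes> x))"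
      using g x by (intro *[of "inv g" "g \<otimes> x" "shift g \<omega>"]) auto
    moreover have "shift (inv g) (shift g \<omega>) = shift \<one> \<omega>" using g by (simp add: shift_mult[symmetric])
    moreover have "conn (shift \<one> \<omega>) = conn \<omega>"
    proof -
      have "open_edges E (shift \<one> \<omega>) = open_edges E \<omega>"
        by (auto simp: open_edges_def shift_def transl_one edge_sub)
      then show ?thesis by (simp add: conn_def)
    qed
    ultimately show "big k \<omega> x" using g x by (simp add: big_def)
  qed (use g x * in blast)
qed

lemma infinite_cluster_shift:
  assumes "g \<in> V" "x \<in> V"
  shows "infinite {y. conn (shift g \<omega>) (g \<otimes> x) y} \<longleftrightarrow> infinite {y. conn \<omega> x y}"
  using assms by (simp add: infinite_cluster_iff_big big_shift)

lemma infinite_cluster_measurable: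
  "x \<in> V \<Longrightarrow> Measurable.pred config (\<lambda>\<omega>. infinite {y. conn \<omega> x y})"
  by (simp only: infinite_cluster_iff_big) measurable

lemma unique_iff: "unique_infinite_cluster V (open_edges E \<omega>) \<longleftrightarrow>
   (\<exists>x\<in>V. infinite {y. conn \<omega> x y}) \<and>
   (\<forall>x\<in>V. \<forall>y\<in>V. infinite {z. conn \<omega> x z} \<longrightarrow> infinite {z. conn \<omega> y z} \<longrightarrow> conn \<omega> x y)"
  unfolding unique_infinite_cluster_iff conn_def ..

lemma unique_measurable[measurable]:
  "Measurable.pred config (\<lambda>\<omega>. unique_infinite_cluster V (open_edges E \<omega>))"
  unfolding unique_iff
  by (intro pred_intros_logic(3,4) pred_countable_Bex pred_countable_Ball countable_V
      infinite_cluster_measurable conn_measurable)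

lemma bex_V_transl: "g \<in> V \<Longrightarrow> (\<exists>x\<in>V. Q x) \<longleftrightarrow> (\<exists>x\<in>V. Q (g \<otimes> x))"
proof -
  assume g: "g \<in> V"
  have "x = g \<otimes> (inv g \<otimes> x)" if "x \<in> V" for x using g that by (simp add: m_assoc[symmetric])
  then show ?thesis using g by (metis inv_closed m_closed)
qed

lemma ball_V_transl: "g \<in> V \<Longrightarrow> (\<forall>x\<in>V. Q x) \<longleftrightarrow> (\<forall>x\<in>V. Q (g \<otimes> x))"
  using bex_V_transl[of g "\<lambda>x. \<not> Q x"] by blast

lemma unique_shift:
  assumes g: "g \<in> V"
  shows "unique_infinite_cluster V (open_edges E (shift g \<omega>)) \<longleftrightarrow> unique_infinite_cluster V (open_edges E \<omega>)"
proof -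
  let ?I = "\<lambda>\<omega> x. infinite {y. conn \<omega> x y}"
  have 1: "(\<exists>x\<in>V. ?I (shift g \<omega>) x) \<longleftrightarrow> (\<exists>x\<in>V. ?I \<omega> x)"
    by (subst bex_V_transl[OF g]) (simp add: infinite_cluster_shift g cong: bex_cong)
  have 2: "(\<forall>x\<in>V. \<forall>y\<in>V. ?I (shift g \<omega>) x \<longrightarrow> ?I (shift g \<omega>) y \<longrightarrow> conn (shift g \<omega>) x y)
     \<longleftrightarrow> (\<forall>x\<in>V. \<forall>y\<in>V. ?I \<omega> x \<longrightarrow> ?I \<omega> y \<longrightarrow> conn \<omega> x y)"
  proof (subst ball_V_transl[OF g], rule ball_cong[OF refl])
    fix x assume x: "x \<in> V"
    show "(\<forall>y\<in>V. ?I (shift g \<omega>) (g \<otimes> x) \<longrightarrow> ?I (shift g \<omega>) y \<longrightarrow> conn (shift g \<omega>) (g \<otimes> x) y)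
       \<longleftrightarrow> (\<forall>y\<in>V. ?I \<omega> x \<longrightarrow> ?I \<omega> y \<longrightarrow> conn \<omega> x y)"
      by (subst ball_V_transl[OF g], rule ball_cong[OF refl])
         (simp add: infinite_cluster_shift conn_shift g x)
  qed
  show ?thesis unfolding unique_iff 1 2 ..
qed

section \<open>Enumeration of the vertices and ergodicity of the shift\<close>

definition vert :: "nat \<Rightarrow> 'a" where "vert = from_nat_into V"

lemma vert_bij: "bij_betw vert UNIV V"
  unfolding vert_def using countable_V infinite_carrier by (rule bij_betw_from_nat_into)

lemma vert_V[simp]: "vert n \<in> V"
  using vert_bij by (auto simp: bij_betw_def)

lemma vert_inj: "inj vert"
  using vert_bij by (auto simp: bij_betw_def)

lemma vert_surj: "x \<in> V \<Longrightarrow> \<exists>n. x = vert n"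
  using vert_bij by (auto simp: bij_betw_def)

text \<open>The elements \<open>vert n\<close> are distinct and so leave every finite set; hence the
  shifts by them eventually move any finite set of edges off itself, and the zero-one law for mixing
  sequences applies.\<close>

lemma shift_invariant_trivial:
  assumes A: "A \<in> sets config" and inv: "\<And>g. g \<in> V \<Longrightarrow> AE \<omega> in Perc p. shift g \<omega> \<in> A \<longleftrightarrow> \<omega> \<in> A"
  shows "measure (Perc p) A = 0 \<or> measure (Perc p) A = 1"
proof -
  let ?t = "\<lambda>n. transl (inv (vert n))"
  interpret mixing_sequence "PiM E (\<lambda>_. measure_pmf (bernoulli_pmf p))" "\<lambda>n \<omega>. \<lambda>i\<in>E. \<omega> (?t n i)"
    "prod_algebra E (\<lambda>_. measure_pmf (bernoulli_pmf p))"
  proof (rule iid_mixing_sequence[OF prob_space_measure_pmf])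
    fix n show "inj_on (?t n) E" "?t n \<in> E \<rightarrow> E" using transl_inj transl_E by auto
  next
    fix J assume J: "finite J" "J \<subseteq> E"
    let ?W = "\<Union>J"
    \<comment> \<open>If an edge and its translate by \<open>inv g\<close> both lie in
      \<open>J\<close>, a vertex \<open>v\<close> of the edge and its image
      \<open>w = inv g \<otimes> v\<close> give \<open>g = v \<otimes> inv w\<close>. Only finitely
      many \<open>g\<close> arise in this way.\<close>
    let ?bad = "(\<lambda>(v, w). v \<otimes> inv w) ` (?W \<times> ?W)"
    have W: "?W \<subseteq> V" using J edge_sub by auto
    have W': "finite ?W" using J edge_fin by (intro finite_Union) blast+
    have "vert n \<in> ?bad" if bad: "?t n ` J \<inter> J \<noteq> {}" for n
    proof -
      obtain e where e: "e \<in> J" "?t n e \<in> J" using bad by auto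
      obtain v where v: "v \<in> e" using e(1) J(2) edge_fin by blast
      have v': "v \<in> V" "v \<in> ?W" using v e(1) W by auto
      have w: "inv (vert n) \<otimes> v \<in> ?W" using v e(2) by (auto simp: transl_def)
      have "vert n = v \<otimes> inv (inv (vert n) \<otimes> v)"
        using v'(1) by (simp add: inv_mult_group)
      then show ?thesis using w v' by (intro image_eqI[of _ _ "(v, inv (vert n) \<otimes> v)"]) auto
    qed
    then have "{n. ?t n ` J \<inter> J \<noteq> {}} \<subseteq> vert -` ?bad" by auto
    moreover have "finite (vert -` ?bad)" using W' by (intro finite_vimageI vert_inj) auto
    ultimately have "finite {n. ?t n ` J \<inter> J \<noteq> {}}" by (rule finite_subset)
    then show "\<forall>\<^sub>F n in sequentially. ?t n ` J \<inter> J = {}"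
      by (simp add: cofinite_eq_sequentially[symmetric] eventually_cofinite)
  qed
  show ?thesis
    using invariant_event_trivial[of A] A inv[OF vert_V] sets_Perc[of p]
    unfolding bernoulli_percolation_def shift_def by blast
qed

end

section \<open>Sprinkling\<close>

text \<open>The first \<open>n\<close> coordinates of a sequence drawn from \<open>Q\<close> are all
  false with probability \<open>(1 - q) ^ n\<close>, which tends to zero.\<close>

lemma AE_infinite_open:
  assumes q: "0 < q" "q \<le> 1" and Q: "infinite Q" "Q \<subseteq> I"
  shows "AE \<omega> in PiM I (\<lambda>_. measure_pmf (bernoulli_pmf q)). \<exists>e\<in>Q. \<omega> e"
proof -
  let ?P = "PiM I (\<lambda>_. measure_pmf (bernoulli_pmf q))"
  interpret prob_space ?P by (rule prob_space_PiM) (rule prob_space_measure_pmf)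
  obtain f :: "nat \<Rightarrow> _" where f: "inj f" "range f \<subseteq> Q"
    using infinite_countable_subset[OF Q(1)] by blast
  let ?C = "\<lambda>n. prod_emb I (\<lambda>_. measure_pmf (bernoulli_pmf q)) (f ` {..<n}) (Pi\<^sub>E (f ` {..<n}) (\<lambda>_. {False}))"
  have C: "measure ?P (?C n) = (1 - q) ^ n" for n
  proof -
    have "emeasure ?P (?C n) = (\<Prod>i\<in>f ` {..<n}. emeasure (measure_pmf (bernoulli_pmf q)) {False})"
      using f Q by (intro emeasure_PiM_emb) (auto simp: prob_space_measure_pmf)
    also have "\<dots> = ennreal (1 - q) ^ card (f ` {..<n})"
      using q by (simp add: emeasure_pmf_single)
    also have "card (f ` {..<n}) = n"
      using f(1) by (subst card_image) (auto intro: inj_on_subset)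
    also have "ennreal (1 - q) ^ n = ennreal ((1 - q) ^ n)" using q by (simp add: ennreal_power)
    finally show ?thesis using q by (simp add: measure_def)
  qed
  have Cs: "?C n \<in> sets ?P" for n using f Q by (intro sets_PiM_I) auto
  have sub: "{\<omega>\<in>space ?P. \<not> (\<exists>e\<in>Q. \<omega> e)} \<subseteq> (\<Inter>n. ?C n)"
  proof
    fix \<omega> assume \<omega>: "\<omega> \<in> {\<omega>\<in>space ?P. \<not> (\<exists>e\<in>Q. \<omega> e)}"
    have "\<omega> \<in> ?C n \<longleftrightarrow> \<omega> \<in> space ?P \<and> (\<forall>i\<in>f ` {..<n}. \<omega> i = False)" for n
      by (simp only: prod_emb_def restrict_PiE_iff Int_iff vimage_eq space_PiM) auto
    then show "\<omega> \<in> (\<Inter>n. ?C n)" using \<omega> f(2) by blast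
  qed
  have "(\<Inter>n. ?C n) \<in> null_sets ?P"
  proof -
    have I: "(\<Inter>n. ?C n) \<in> sets ?P" using Cs by blast
    have "measure ?P (\<Inter>n. ?C n) \<le> (1 - q) ^ n" for n
      unfolding C[symmetric] using Cs by (intro finite_measure_mono) auto
    moreover have "(\<lambda>n. (1 - q) ^ n) \<longlonglongrightarrow> 0" using q by (intro LIMSEQ_realpow_zero) auto
    ultimately have "measure ?P (\<Inter>n. ?C n) \<le> 0"
      by (intro LIMSEQ_le_const[of "\<lambda>n. (1 - q) ^ n"]) auto
    then show ?thesis using I by (intro null_setsI) (auto simp: emeasure_eq_measure measure_le_0_iff)
  qed
  then show ?thesis using sub by (rule AE_I')
qed

text \<open>Fubini for independent blocks of coordinates: when the block outside \<open>W\<close> is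
  frozen, the block in \<open>W\<close> still has its product law.\<close>

lemma AE_PiM_split:
  assumes M: "\<And>i. prob_space (M i)" and I: "I \<noteq> {}" and W: "W \<subseteq> I"
    and meas: "Measurable.pred (PiM (I - W) M \<Otimes>\<^sub>M PiM W M) (\<lambda>x. R (fst x) (snd x))"
    and ae: "\<And>a. a \<in> space (PiM (I - W) M) \<Longrightarrow> AE b in PiM W M. R a b"
  shows "AE \<omega> in PiM I M. R (restrict \<omega> (I - W)) (restrict \<omega> W)"
proof -
  interpret prob_space "PiM I M" by (rule prob_space_PiM) (rule M)
  interpret A: prob_space "PiM (I - W) M" by (rule prob_space_PiM) (rule M)
  interpret B: prob_space "PiM W M" by (rule prob_space_PiM) (rule M)
  interpret AB: pair_prob_space "PiM (I - W) M" "PiM W M" ..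
  have "indep_var (PiM (I - W) M) (\<lambda>\<omega>. restrict (\<lambda>i. \<omega> i) (I - W)) (PiM W M) (\<lambda>\<omega>. restrict (\<lambda>i. \<omega> i) W)"
    using W by (intro indep_var_restrict[OF indep_vars_PiM_coordinates[OF M I]]) auto
  then have iv: "(\<lambda>\<omega>. restrict \<omega> (I - W)) \<in> measurable (PiM I M) (PiM (I - W) M)"
    "(\<lambda>\<omega>. restrict \<omega> W) \<in> measurable (PiM I M) (PiM W M)"
    "distr (PiM I M) (PiM (I - W) M) (\<lambda>\<omega>. restrict \<omega> (I - W)) \<Otimes>\<^sub>M distr (PiM I M) (PiM W M) (\<lambda>\<omega>. restrict \<omega> W)
      = distr (PiM I M) (PiM (I - W) M \<Otimes>\<^sub>M PiM W M) (\<lambda>\<omega>. (restrict \<omega> (I - W), restrict \<omega> W))"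
    unfolding indep_var_distribution_eq by auto
  have law: "distr (PiM I M) (PiM J M) (\<lambda>\<omega>. restrict \<omega> J) = PiM J M" if "J \<subseteq> I" for J
    using distr_PiM_reindex[of I M "\<lambda>i. i" J] M that by auto
  have joint: "distr (PiM I M) (PiM (I - W) M \<Otimes>\<^sub>M PiM W M) (\<lambda>\<omega>. (restrict \<omega> (I - W), restrict \<omega> W))
      = PiM (I - W) M \<Otimes>\<^sub>M PiM W M"
    using iv(3) law[of "I - W"] law[of W] W by simp
  have "AE x in PiM (I - W) M \<Otimes>\<^sub>M PiM W M. R (fst x) (snd x)"
    by (rule AB.AE_pair_measure) (use meas ae in \<open>auto simp: pred_def\<close>)
  then have "AE x in distr (PiM I M) (PiM (I - W) M \<Otimes>\<^sub>M PiM W M) (\<lambda>\<omega>. (restrict \<omega> (I - W), restrict \<omega> W)). R (fst x) (snd x)"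
    unfolding joint .
  from AE_distrD[OF measurable_Pair[OF iv(1,2)] this] show ?thesis by simp
qed

context cayley_graph
begin

definition join :: "('a set \<Rightarrow> bool) \<Rightarrow> ('a set \<Rightarrow> bool) \<Rightarrow> ('a set \<Rightarrow> bool)" where
  "join \<eta> \<zeta> = (\<lambda>e\<in>E. \<eta> e \<or> \<zeta> e)"

lemma join_measurable[measurable (raw)]:
  assumes [measurable]: "f \<in> measurable M config" "g \<in> measurable M config"
  shows "(\<lambda>x. join (f x) (g x)) \<in> measurable M config"
  unfolding join_def
proof (rule measurable_into_config)
  fix e assume [measurable]: "e \<in> E"
  have [measurable]: "(\<lambda>x. f x e) \<in> measurable M (count_space UNIV)" "(\<lambda>x. g x e) \<in> measurable M (count_space UNIV)"
    using measurable_compose[OF assms(1) config_component] measurable_compose[OF assms(2) config_component]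
      \<open>e \<in> E\<close> by auto
  show "(\<lambda>x. f x e \<or> g x e) \<in> measurable M (count_space UNIV)" by measurable
qed

lemma join_shift: "g \<in> V \<Longrightarrow> join (shift g \<eta>) (shift g \<zeta>) = shift g (join \<eta> \<zeta>)"
  by (auto simp: join_def shift_def fun_eq_iff transl_E)

lemma conn_joinI: "conn \<eta> x y \<Longrightarrow> conn (join \<eta> \<zeta>) x y"
  by (rule conn_mono[of \<eta> "join \<eta> \<zeta>"]) (auto simp: join_def)

lemma conn_step:
  assumes "conn \<omega> x v" "{v, w} \<in> E" "\<omega> {v, w}"
  shows "conn \<omega> x w"
proof (rule conn_trans[OF assms(1)])
  show "conn \<omega> v w" unfolding conn_def by (rule connected_in_edge) (use assms in \<open>simp add: open_edges_def\<close>)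
qed

lemma countable_subsets_V: "A \<subseteq> V \<Longrightarrow> countable A"
  by (rule countable_subset[OF _ countable_V])

text \<open>
  The exploration of the cluster of \<open>x\<close> off \<open>T\<close> does not look at edges touching
  \<open>T\<close>. Given its outcome, the infinitely many edges from the explored set to \<open>T\<close>
  are therefore still independent, and one of them is open.
\<close>

lemma infinite_boundary_open:
  assumes q: "0 < q" "q \<le> 1" and T: "T \<subseteq> V" and x: "x \<in> V"
  shows "AE \<zeta> in Perc q. \<not> ({y. conn (join \<eta> \<zeta>) x y} \<inter> T = {} \<and>
      infinite {v. conn (join \<eta> \<zeta>) x v \<and> (\<exists>s\<in>S. v \<otimes> s \<in> T)})"
proof -
  define W where "W = {e \<in> E. e \<inter> T \<noteq> {}}"
  have W: "W \<subseteq> E" by (auto simp: W_def)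
  let ?m = "\<lambda>_. measure_pmf (bernoulli_pmf q)"
  \<comment> \<open>With the edges at \<open>T\<close> deleted, the configuration depends on
    \<open>\<zeta>\<close> only through the edges outside \<open>W\<close>. Hence the candidate set
    \<open>Q\<close> is fixed before the edges in \<open>W\<close> are examined.\<close>
  define clip where "clip \<zeta> = (\<lambda>e\<in>E. e \<notin> W \<and> (\<eta> e \<or> \<zeta> e))" for \<zeta> :: "'a set \<Rightarrow> bool"
  define Q where "Q \<zeta> = {e \<in> W. \<exists>v\<in>V. \<exists>w\<in>T. e = {v, w} \<and> conn (clip \<zeta>) x v}" for \<zeta>
  define R where "R a b \<longleftrightarrow> infinite (Q a) \<longrightarrow> (\<exists>e\<in>Q a. b e)" for a b
  have clip_meas[measurable]: "clip \<in> measurable (PiM (E - W) ?m) config"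
    unfolding clip_def[abs_def]
  proof (rule measurable_into_config)
    fix e assume e: "e \<in> E"
    show "(\<lambda>\<zeta>. e \<notin> W \<and> (\<eta> e \<or> \<zeta> e)) \<in> measurable (PiM (E - W) ?m) (count_space UNIV)"
    proof (cases "e \<in> W")
      case False
      then have "(\<lambda>\<zeta>. \<zeta> e) \<in> measurable (PiM (E - W) ?m) (measure_pmf (bernoulli_pmf q))"
        using e by (intro measurable_component_singleton) auto
      then have [measurable]: "(\<lambda>\<zeta>. \<zeta> e) \<in> measurable (PiM (E - W) ?m) (count_space UNIV)"
        by (simp cong: measurable_cong_sets)
      show ?thesis by measurable
    qed simp
  qed
  have Q_meas: "Measurable.pred (PiM (E - W) ?m) (\<lambda>a. e \<in> Q a)" for e
  proof (cases "e \<in> W")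
    case True
    have "Measurable.pred (PiM (E - W) ?m) (\<lambda>a. \<exists>v\<in>V. \<exists>w\<in>T. e = {v, w} \<and> conn (clip a) x v)"
      by (intro pred_countable_Bex countable_V countable_subsets_V T) measurable
    then show ?thesis using True by (simp add: Q_def)
  qed (simp add: Q_def)
  have W_count: "countable W" by (rule countable_subset[OF W countable_E])
  have Q_W: "Q a \<subseteq> W" for a by (auto simp: Q_def)
  have "AE \<omega> in PiM E ?m. R (restrict \<omega> (E - W)) (restrict \<omega> W)"
  proof (rule AE_PiM_split[OF prob_space_measure_pmf E_nonempty W])
    let ?N = "PiM (E - W) ?m \<Otimes>\<^sub>M PiM W ?m"
    have Q_meas2: "Measurable.pred ?N (\<lambda>x. e \<in> Q (fst x))" for e
      by (rule measurable_compose[OF measurable_fst Q_meas])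
    have comp: "Measurable.pred ?N (\<lambda>x. snd x e)" if "e \<in> W" for e
    proof -
      have "(\<lambda>x. snd x e) \<in> measurable ?N (measure_pmf (bernoulli_pmf q))"
        by (rule measurable_compose[OF measurable_snd measurable_component_singleton[OF that]])
      then show ?thesis by (simp cong: measurable_cong_sets)
    qed
    \<comment> \<open>Infiniteness is expressed through the countably many finite subsets of
      \<open>W\<close> to obtain measurability.\<close>
    have inf: "infinite A \<longleftrightarrow> (\<forall>F\<in>{F. finite F \<and> F \<subseteq> W}. \<exists>e\<in>W - F. e \<in> A)" if "A \<subseteq> W" for A
    proof
      assume "infinite A"
      then have "A - F \<noteq> {}" if "finite F" for F using that by (metis finite.emptyI finite_Diff2)
      then show "\<forall>F\<in>{F. finite F \<and> F \<subseteq> W}. \<exists>e\<in>W - F. e \<in> A" using \<open>A \<subseteq> W\<close> by blast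
    next
      assume "\<forall>F\<in>{F. finite F \<and> F \<subseteq> W}. \<exists>e\<in>W - F. e \<in> A"
      then show "infinite A" using \<open>A \<subseteq> W\<close> by blast
    qed
    have "Measurable.pred ?N (\<lambda>x. \<forall>F\<in>{F. finite F \<and> F \<subseteq> W}. \<exists>e\<in>W - F. e \<in> Q (fst x))"
      by (intro pred_countable_Ball pred_countable_Bex countable_Collect_finite_subset[OF W_count] Q_meas2
          countable_subset[OF Diff_subset W_count])
    moreover have "Measurable.pred ?N (\<lambda>x. \<exists>e\<in>W. e \<in> Q (fst x) \<and> snd x e)"
      by (intro pred_countable_Bex W_count pred_intros_logic(3) Q_meas2 comp)
    ultimately have "Measurable.pred ?N (\<lambda>x. (\<forall>F\<in>{F. finite F \<and> F \<subseteq> W}. \<exists>e\<in>W - F. e \<in> Q (fst x))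
        \<longrightarrow> (\<exists>e\<in>W. e \<in> Q (fst x) \<and> snd x e))"
      by (rule pred_intros_logic(4))
    moreover have "R a b \<longleftrightarrow> ((\<forall>F\<in>{F. finite F \<and> F \<subseteq> W}. \<exists>e\<in>W - F. e \<in> Q a)
        \<longrightarrow> (\<exists>e\<in>W. e \<in> Q a \<and> b e))" for a b
      unfolding R_def inf[OF Q_W] using Q_W by blast
    ultimately show "Measurable.pred ?N (\<lambda>x. R (fst x) (snd x))" by simp
  next
    fix a
    show "AE b in PiM W ?m. R a b"
    proof (cases "infinite (Q a)")
      case True
      from AE_infinite_open[OF q True Q_W] show ?thesis by (simp add: R_def)
    qed (simp add: R_def)
  qed
  then have "AE \<zeta> in Perc q. R (restrict \<zeta> (E - W)) (restrict \<zeta> W)"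
    unfolding bernoulli_percolation_def .
  then show ?thesis
  proof eventually_elim
    fix \<zeta> assume R: "R (restrict \<zeta> (E - W)) (restrict \<zeta> W)"
    have Qr: "Q (restrict \<zeta> (E - W)) = Q \<zeta>"
    proof -
      have "clip (restrict \<zeta> (E - W)) = clip \<zeta>" by (auto simp: clip_def fun_eq_iff)
      then show ?thesis by (simp add: Q_def)
    qed
    show "\<not> ({y. conn (join \<eta> \<zeta>) x y} \<inter> T = {} \<and>
      infinite {v. conn (join \<eta> \<zeta>) x v \<and> (\<exists>s\<in>S. v \<otimes> s \<in> T)})"
    proof
      assume *: "{y. conn (join \<eta> \<zeta>) x y} \<inter> T = {} \<and>
        infinite {v. conn (join \<eta> \<zeta>) x v \<and> (\<exists>s\<in>S. v \<otimes> s \<in> T)}" (is "_ \<and> infinite ?J")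
      \<comment> \<open>A cluster that avoids \<open>T\<close> uses no edge touching
        \<open>T\<close>, so the clipped exploration finds all of it.\<close>
      have same: "conn (clip \<zeta>) x v" if "conn (join \<eta> \<zeta>) x v" for v
      proof -
        have "v \<in> {v. conn (clip \<zeta>) x v \<and> v \<notin> T}"
          using that unfolding conn_def[of "join \<eta> \<zeta>"]
        proof (rule connected_in_closed)
          show "x \<in> {v. conn (clip \<zeta>) x v \<and> v \<notin> T}" using * by auto
          fix u v assume uv: "{u, v} \<in> open_edges E (join \<eta> \<zeta>)" and u: "u \<in> {v. conn (clip \<zeta>) x v \<and> v \<notin> T}"
          have e: "{u, v} \<in> E" "\<eta> {u, v} \<or> \<zeta> {u, v}" using uv by (auto simp: open_edges_def join_def)
          have "conn (join \<eta> \<zeta>) x u" using u by (auto intro: conn_mono[of "clip \<zeta>"] simp: clip_def join_def)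
          then have "conn (join \<eta> \<zeta>) x v" by (rule conn_step) (use e in \<open>auto simp: join_def\<close>)
          then have vT: "v \<notin> T" using * by auto
          then have "clip \<zeta> {u, v}" using e u by (auto simp: clip_def W_def)
          then have "conn (clip \<zeta>) x v" using u e(1) by (auto intro: conn_step)
          then show "v \<in> {v. conn (clip \<zeta>) x v \<and> v \<notin> T}" using vT by simp
        qed
        then show ?thesis by simp
      qed
      \<comment> \<open>Every edge is finite, so infinitely many boundary vertices require
        infinitely many candidate edges.\<close>
      have "?J \<subseteq> \<Union>(Q \<zeta>)"
      proof
        fix v assume "v \<in> ?J"
        then obtain s where v: "conn (join \<eta> \<zeta>) x v" "s \<in> S" "v \<otimes> s \<in> T" by auto
        have "v \<in> V" using conn_V[OF v(1) x] .
        then have "{v, v \<otimes> s} \<in> E" using v(2) by (auto simp: cayley_edges_def)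
        then have "{v, v \<otimes> s} \<in> Q \<zeta>" using v same[OF v(1)] \<open>v \<in> V\<close> by (auto simp: Q_def W_def)
        then show "v \<in> \<Union>(Q \<zeta>)" by blast
      qed
      then have "infinite (\<Union>(Q \<zeta>))" using * finite_subset by blast
      moreover have "finite e" if "e \<in> Q \<zeta>" for e using that W edge_fin by (auto simp: Q_def)
      ultimately have "infinite (Q \<zeta>)" by blast
      then obtain e where e': "e \<in> Q \<zeta>" "restrict \<zeta> W e"
        using R unfolding R_def Qr by blast
      then have e: "e \<in> Q \<zeta>" "\<zeta> e" using Q_W by (auto split: if_splits)
      from e(1) obtain v w where vw: "e = {v, w}" "e \<in> W" "w \<in> T" "conn (clip \<zeta>) x v" by (auto simp: Q_def)
      have "conn (join \<eta> \<zeta>) x v" using vw(4) by (rule conn_mono[rotated]) (auto simp: clip_def join_def)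
      then have "conn (join \<eta> \<zeta>) x w"
        by (rule conn_step) (use vw e W in \<open>auto simp: join_def\<close>)
      then show False using * vw(3) by auto
    qed
  qed
qed

text \<open>The closed ball of radius \<open>n\<close> around \<open>T\<close> in the graph
  metric.\<close>

primrec layer :: "'a set \<Rightarrow> nat \<Rightarrow> 'a set" where
  "layer T 0 = T"
| "layer T (Suc n) = layer T n \<union> {v \<in> V. \<exists>s\<in>S. v \<otimes> s \<in> layer T n}"

lemma layer_sub: "T \<subseteq> V \<Longrightarrow> layer T n \<subseteq> V"
  by (induction n) auto

text \<open>The graph is connected: a word for \<open>inv v \<otimes> t\<close> describes a path
  from \<open>v\<close> to \<open>t\<close>, and its length is a suitable \<open>n\<close>.\<close>

lemma layer_exhausts:
  assumes T: "t \<in> T" "T \<subseteq> V" and v: "v \<in> V"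
  shows "\<exists>n. v \<in> layer T n"
proof -
  have *: "v \<in> layer T (length w)" if "w \<in> lists S" "v \<in> V" "v \<otimes> word w \<in> T" for w v
    using that
  proof (induction w arbitrary: v)
    case (Cons s w)
    then have "v \<otimes> s \<in> layer T (length w)" by (intro Cons.IH) (auto simp: m_assoc)
    moreover have "s \<in> S" using Cons by simp
    ultimately show ?case using Cons.prems by auto
  qed simp
  have t: "t \<in> V" using T by auto
  obtain w where "w \<in> lists S" "inv v \<otimes> t = word w" using ex_word[of "inv v \<otimes> t"] v t by auto
  moreover from this have "v \<otimes> word w = t" using v t by (metis inv_cancel(2))
  ultimately show ?thesis using * T v by metis
qed

lemma layer_transl:
  assumes "g \<in> V" "\<And>y. y \<in> V \<Longrightarrow> g \<otimes> y \<in> T' \<longleftrightarrow> y \<in> T" "v \<in> V"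
  shows "g \<otimes> v \<in> layer T' n \<longleftrightarrow> v \<in> layer T n"
  using assms(3)
proof (induction n arbitrary: v)
  case (Suc n)
  have "(\<exists>s\<in>S. (g \<otimes> v) \<otimes> s \<in> layer T' n) \<longleftrightarrow> (\<exists>s\<in>S. v \<otimes> s \<in> layer T n)"
    using Suc.IH Suc.prems assms(1) by (auto simp: m_assoc)
  then show ?case using Suc assms(1) by auto
qed (use assms in auto)

lemma cluster_layer_transl:
  assumes g: "g \<in> V" and x: "x \<in> V" and T: "\<And>y. y \<in> V \<Longrightarrow> g \<otimes> y \<in> T' \<longleftrightarrow> y \<in> T"
  shows "{y. conn (shift g \<omega>) (g \<otimes> x) y} \<inter> layer T' n = (\<lambda>z. g \<otimes> z) ` ({y. conn \<omega> x y} \<inter> layer T n)"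
proof (intro equalityI subsetI)
  fix z assume z: "z \<in> {y. conn (shift g \<omega>) (g \<otimes> x) y} \<inter> layer T' n"
  have zV: "z \<in> V" using z conn_V[of "shift g \<omega>" "g \<otimes> x" z] x g by simp
  have w: "inv g \<otimes> z \<in> V" "g \<otimes> (inv g \<otimes> z) = z" using g zV by simp_all
  have "inv g \<otimes> z \<in> {y. conn \<omega> x y} \<inter> layer T n"
    using z conn_shift[OF g x w(1), of \<omega>] layer_transl[OF g T w(1), of n] by (simp add: w(2))
  then show "z \<in> (\<lambda>z. g \<otimes> z) ` ({y. conn \<omega> x y} \<inter> layer T n)"
    using w(2) by (intro image_eqI[of _ _ "inv g \<otimes> z"]) auto
next
  fix z assume "z \<in> (\<lambda>z. g \<otimes> z) ` ({y. conn \<omega> x y} \<inter> layer T n)"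
  then obtain w where w: "z = g \<otimes> w" "conn \<omega> x w" "w \<in> layer T n" by auto
  have wV: "w \<in> V" using conn_V[OF w(2) x] .
  show "z \<in> {y. conn (shift g \<omega>) (g \<otimes> x) y} \<inter> layer T' n"
    using w conn_shift[OF g x wV] layer_transl[OF g T wV] by simp
qed

lemma layer_measurable:
  assumes "\<And>v. v \<in> V \<Longrightarrow> Measurable.pred M (\<lambda>\<omega>. v \<in> T \<omega>)" "v \<in> V"
  shows "Measurable.pred M (\<lambda>\<omega>. v \<in> layer (T \<omega>) n)"
  using assms(2)
proof (induction n arbitrary: v)
  case (Suc n)
  have "Measurable.pred M (\<lambda>\<omega>. v \<in> layer (T \<omega>) n \<or> (\<exists>s\<in>S. v \<otimes> s \<in> layer (T \<omega>) n))"
    using Suc S_props(1) by (intro pred_intros_logic(5) pred_countable_Bex countable_finite) auto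
  then show ?case using Suc.prems by simp
qed (use assms in auto)

lemma pred_finite_subset_V:
  assumes "\<And>v. v \<in> V \<Longrightarrow> Measurable.pred M (\<lambda>\<omega>. v \<in> B \<omega>)" "\<And>\<omega>. B \<omega> \<subseteq> V"
  shows "Measurable.pred M (\<lambda>\<omega>. finite (B \<omega>))"
proof -
  have "finite (B \<omega>) \<longleftrightarrow> (\<exists>A\<in>{A. finite A \<and> A \<subseteq> V}. \<forall>v\<in>V. v \<in> B \<omega> \<longrightarrow> v \<in> A)" for \<omega>
    using assms(2)[of \<omega>] by (auto intro: finite_subset)
  moreover have "Measurable.pred M (\<lambda>\<omega>. \<exists>A\<in>{A. finite A \<and> A \<subseteq> V}. \<forall>v\<in>V. v \<in> B \<omega> \<longrightarrow> v \<in> A)"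
    by (intro pred_countable_Bex pred_countable_Ball countable_finsets countable_V pred_intros_logic(4) assms) auto
  ultimately show ?thesis by simp
qed

text \<open>The second component holds the edges opened later. The first stays visible because
  selections and targets are functions of it alone.\<close>

definition Perc2 :: "real \<Rightarrow> real \<Rightarrow> (('a set \<Rightarrow> bool) \<times> ('a set \<Rightarrow> bool)) measure" where
  "Perc2 p q = Perc p \<Otimes>\<^sub>M Perc q"

lemma sets_Perc2[measurable_cong, simp]: "sets (Perc2 p q) = sets (config \<Otimes>\<^sub>M config)"
  unfolding Perc2_def by (intro sets_pair_measure_cong) auto

lemma space_Perc2[simp]: "space (Perc2 p q) = space config \<times> space config"
  unfolding Perc2_def by (simp add: space_pair_measure)

lemma pair_prob_space_Perc: "pair_prob_space (Perc p) (Perc q)"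
proof -
  interpret p: prob_space "Perc p" by (rule prob_space_Perc)
  interpret q: prob_space "Perc q" by (rule prob_space_Perc)
  show ?thesis ..
qed

lemma prob_space_Perc2: "prob_space (Perc2 p q)"
proof -
  interpret pair_prob_space "Perc p" "Perc q" by (rule pair_prob_space_Perc)
  show ?thesis unfolding Perc2_def by (rule prob_space_axioms)
qed

definition shift2 where "shift2 g = (\<lambda>(\<eta>, \<zeta>). (shift g \<eta>, shift g \<zeta>))"

lemma shift2_measurable: "g \<in> V \<Longrightarrow> shift2 g \<in> measurable (Perc2 p q) (Perc2 p q)"
  unfolding shift2_def case_prod_unfold
  by (simp cong: measurable_cong_sets, intro measurable_Pair measurable_compose[OF measurable_fst shift_measurable]
      measurable_compose[OF measurable_snd shift_measurable])

lemma distr_shift2: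
  assumes g: "g \<in> V"
  shows "distr (Perc2 p q) (Perc2 p q) (shift2 g) = Perc2 p q"
proof -
  interpret pair_prob_space "Perc p" "Perc q" by (rule pair_prob_space_Perc)
  have "distr (Perc p) (Perc p) (shift g) \<Otimes>\<^sub>M distr (Perc q) (Perc q) (shift g)
      = distr (Perc p \<Otimes>\<^sub>M Perc q) (Perc p \<Otimes>\<^sub>M Perc q) (\<lambda>(x, y). (shift g x, shift g y))"
    by (rule pair_measure_distr[OF shift_measurable_Perc[OF g] shift_measurable_Perc[OF g]])
       (simp add: distr_shift[OF g] M2.sigma_finite_measure_axioms)
  then show ?thesis by (simp add: distr_shift[OF g] Perc2_def shift2_def)
qed

abbreviation "joined \<omega> \<equiv> join (fst \<omega>) (snd \<omega>)"

lemma conn_J_measurable[measurable]: "Measurable.pred (config \<Otimes>\<^sub>M config) (\<lambda>\<omega>. conn (joined \<omega>) x y)"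
  by measurable

lemma AE_Perc2_fst:
  assumes "AE \<eta> in Perc p. Q \<eta>"
  shows "AE \<omega> in Perc2 p q. Q (fst \<omega>)"
proof -
  interpret pair_prob_space "Perc p" "Perc q" by (rule pair_prob_space_Perc)
  have law: "distr (Perc p \<Otimes>\<^sub>M Perc q) (Perc p) fst = Perc p"
  proof (rule measure_eqI)
    fix A assume "A \<in> sets (distr (Perc p \<Otimes>\<^sub>M Perc q) (Perc p) fst)"
    then have A: "A \<in> sets (Perc p)" by simp
    have "fst -` A \<inter> space (Perc p \<Otimes>\<^sub>M Perc q) = A \<times> space (Perc q)"
      using sets.sets_into_space[OF A] by (auto simp: space_pair_measure)
    then show "emeasure (distr (Perc p \<Otimes>\<^sub>M Perc q) (Perc p) fst) A = emeasure (Perc p) A"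
      using emeasure_distr[OF measurable_fst A, of "Perc q"] A
        M2.emeasure_pair_measure_Times[OF A sets.top] M2.emeasure_space_1 by (simp del: space_Perc)
  qed simp
  have "AE \<eta> in distr (Perc2 p q) (Perc p) fst. Q \<eta>"
    unfolding Perc2_def law by (rule assms)
  then show ?thesis by (rule AE_distrD[rotated]) (simp add: Perc2_def)
qed

text \<open>This is \<open>infinite_boundary_open\<close> with the ball of radius \<open>n\<close>
  as target: a cluster outside this ball with infinitely many vertices at distance
  \<open>n + 1\<close> would almost surely have an open edge into it.\<close>

lemma cluster_layer_infinite:
  assumes q: "0 < q" "q \<le> 1" and T_sub: "\<And>\<eta>. T \<eta> \<subseteq> V"
    and T_meas: "\<And>v. v \<in> V \<Longrightarrow> Measurable.pred config (\<lambda>\<eta>. v \<in> T \<eta>)" and x: "x \<in> V"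
  shows "AE \<omega> in Perc2 p q. \<forall>n. \<not> ({y. conn (joined \<omega>) x y} \<inter> layer (T (fst \<omega>)) n = {} \<and>
            infinite ({y. conn (joined \<omega>) x y} \<inter> layer (T (fst \<omega>)) (Suc n)))"
  unfolding AE_all_countable
proof
  fix n
  let ?D = "\<lambda>\<omega>. {y. conn (joined \<omega>) x y}"
  let ?R = "\<lambda>\<omega>. \<not> (?D \<omega> \<inter> layer (T (fst \<omega>)) n = {} \<and> infinite (?D \<omega> \<inter> layer (T (fst \<omega>)) (Suc n)))"
  interpret pair_prob_space "Perc p" "Perc q" by (rule pair_prob_space_Perc)
  note L_sub = layer_sub[OF T_sub]
  have L: "Measurable.pred (config \<Otimes>\<^sub>M config) (\<lambda>\<omega>. v \<in> layer (T (fst \<omega>)) k)" if "v \<in> V" for v k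
    by (rule measurable_compose[OF measurable_fst layer_measurable[OF T_meas that]])
  have "Measurable.pred (config \<Otimes>\<^sub>M config) (\<lambda>\<omega>. \<not> (\<not> (\<exists>y\<in>V. conn (joined \<omega>) x y \<and> y \<in> layer (T (fst \<omega>)) n) \<and>
     \<not> finite (?D \<omega> \<inter> layer (T (fst \<omega>)) (Suc n))))"
    by (intro pred_intros_logic(2,3) pred_countable_Bex countable_V pred_finite_subset_V L)
       (use L_sub conn_J_measurable L in \<open>auto simp del: layer.simps intro!: pred_intros_logic(3)\<close>)
  moreover have "?D \<omega> \<inter> layer (T (fst \<omega>)) n = {} \<longleftrightarrow> \<not> (\<exists>y\<in>V. conn (joined \<omega>) x y \<and> y \<in> layer (T (fst \<omega>)) n)" for \<omega>
    using L_sub by blast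
  ultimately have meas: "Measurable.pred (config \<Otimes>\<^sub>M config) ?R" by simp
  have "AE \<omega> in Perc p \<Otimes>\<^sub>M Perc q. ?R \<omega>"
  proof (rule AE_pair_measure)
    show "{\<omega> \<in> space (Perc p \<Otimes>\<^sub>M Perc q). ?R \<omega>} \<in> sets (Perc p \<Otimes>\<^sub>M Perc q)"
      using meas sets_Perc2[of p q] space_Perc2[of p q]
      by (simp only: pred_def Perc2_def space_pair_measure)
    \<comment> \<open>For a frozen \<open>\<eta>\<close> the layer is a deterministic set and can
      serve as the target.\<close>
    show "AE \<eta> in Perc p. AE \<zeta> in Perc q. ?R (\<eta>, \<zeta>)"
    proof (rule AE_I2)
      fix \<eta>
      show "AE \<zeta> in Perc q. ?R (\<eta>, \<zeta>)"
        using infinite_boundary_open[OF q L_sub x, of \<eta> \<eta> n]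
      proof eventually_elim
        case (elim \<zeta>)
        let ?A = "{y. conn (join \<eta> \<zeta>) x y}"
        show ?case
        proof
          assume *: "{y. conn (joined (\<eta>, \<zeta>)) x y} \<inter> layer (T (fst (\<eta>, \<zeta>))) n = {} \<and>
            infinite ({y. conn (joined (\<eta>, \<zeta>)) x y} \<inter> layer (T (fst (\<eta>, \<zeta>))) (Suc n))"
          then have "?A \<inter> layer (T \<eta>) (Suc n) \<subseteq> {v. conn (join \<eta> \<zeta>) x v \<and> (\<exists>s\<in>S. v \<otimes> s \<in> layer (T \<eta>) n)}"
            by auto
          from infinite_super[OF this] * elim show False by simp
        qed
      qed
    qed
  qed
  then show "AE \<omega> in Perc2 p q. ?R \<omega>" by (simp only: Perc2_def)
qed

text \<open>The least \<open>n\<close> for which the cluster meets the layer is its distance from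
  \<open>T\<close>. It exists by connectedness of the graph, and the hypothesis forbids it to be a
  successor.\<close>

lemma cluster_hits:
  assumes T: "T \<subseteq> V" "t \<in> T" and x: "x \<in> V"
    and A: "\<forall>n. \<not> ({y. conn \<omega> x y} \<inter> layer T n = {} \<and> {y. conn \<omega> x y} \<inter> layer T (Suc n) \<noteq> {})"
  shows "\<exists>y\<in>T. conn \<omega> x y"
proof -
  let ?Q = "\<lambda>n. {y. conn \<omega> x y} \<inter> layer T n \<noteq> {}"
  obtain n where n: "x \<in> layer T n" using layer_exhausts[OF T(2,1) x] by blast
  then have "?Q n" by auto
  then have "?Q (LEAST n. ?Q n)" by (rule LeastI)
  moreover have "(LEAST n. ?Q n) = 0"
  proof (cases "LEAST n. ?Q n")
    case (Suc m)
    then have "\<not> ?Q m" using not_less_Least[of m ?Q] by simp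
    then show ?thesis using calculation Suc A by auto
  qed
  ultimately show ?thesis by auto
qed

end

section \<open>Invariant selections of finitely many clusters\<close>

text \<open>By linearity the sum is the expected number of events that occur.\<close>

lemma (in prob_space) sum_prob_le_card:
  fixes n c :: nat
  assumes A: "\<And>i. i < n \<Longrightarrow> A i \<in> events"
    and c: "\<And>\<omega>. \<omega> \<in> space M \<Longrightarrow> card {i. i < n \<and> \<omega> \<in> A i} \<le> c"
  shows "(\<Sum>i<n. prob (A i)) \<le> real c"
proof -
  have "(\<Sum>i<n. prob (A i)) = (\<Sum>i<n. expectation (indicator (A i)))"
    using A by simp
  also have "\<dots> = expectation (\<lambda>\<omega>. \<Sum>i<n. indicator (A i) \<omega>)"
    using A by (subst Bochner_Integration.integral_sum) (auto simp: less_top[symmetric])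
  also have "\<dots> \<le> expectation (\<lambda>\<omega>. real c)"
  proof (rule integral_mono)
    show "integrable M (\<lambda>\<omega>. \<Sum>i<n. indicator (A i) \<omega> :: real)"
      using A by (intro Bochner_Integration.integrable_sum) (auto simp: less_top[symmetric])
    fix \<omega> assume "\<omega> \<in> space M"
    have "(\<Sum>i<n. indicator (A i) \<omega> :: real) = real (card {i. i < n \<and> \<omega> \<in> A i})"
    proof -
      have "(\<Sum>i<n. indicator (A i) \<omega> :: real) = (\<Sum>i\<in>{i. i < n \<and> \<omega> \<in> A i}. 1)"
        by (rule sum.mono_neutral_cong_right) auto
      then show ?thesis by simp
    qed
    then show "(\<Sum>i<n. indicator (A i) \<omega> :: real) \<le> real c" using c[OF \<open>\<omega> \<in> space M\<close>] by simp
  qed simp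
  finally show ?thesis by (simp add: prob_space)
qed

lemma (in prob_space) prob_eq_of_preserving:
  assumes t: "t \<in> measurable M M" "distr M M t = M" and A: "A \<in> events" "B \<in> events"
    and ae: "AE \<omega> in M. t \<omega> \<in> B \<longleftrightarrow> \<omega> \<in> A"
  shows "prob B = prob A"
proof -
  have "prob B = prob (t -` B \<inter> space M)"
    using measure_distr[OF t(1) A(2)] t(2) by simp
  also have "\<dots> = prob A"
  proof (rule finite_measure_eq_AE)
    show "AE \<omega> in M. \<omega> \<in> t -` B \<inter> space M \<longleftrightarrow> \<omega> \<in> A"
      using ae AE_space by eventually_elim auto
  qed (use A t(1) in \<open>auto intro!: measurable_sets\<close>)
  finally show ?thesis .
qed

context cayley_graph
begin

text \<open>
  If \<open>x\<close> sends mass \<open>P (K x v)\<close> to \<open>v\<close>, then by invariance the mass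
  that \<open>v\<close> receives is the mass that the identity sends, hence at most \<open>c\<close>.
\<close>

lemma mass_transport_finite:
  assumes N: "prob_space N"
    and \<tau>: "\<And>g. g \<in> V \<Longrightarrow> \<tau> g \<in> measurable N N" "\<And>g. g \<in> V \<Longrightarrow> distr N N (\<tau> g) = N"
    and meas: "\<And>x v. x \<in> V \<Longrightarrow> v \<in> V \<Longrightarrow> Measurable.pred N (\<lambda>\<omega>. K \<omega> x v)"
    and inv: "\<And>g x v. g \<in> V \<Longrightarrow> x \<in> V \<Longrightarrow> v \<in> V \<Longrightarrow> AE \<omega> in N. K (\<tau> g \<omega>) (g \<otimes> x) (g \<otimes> v) \<longleftrightarrow> K \<omega> x v"
    and card: "\<And>\<omega> x. x \<in> V \<Longrightarrow> finite {v \<in> V. K \<omega> x v} \<and> card {v \<in> V. K \<omega> x v} \<le> c"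
    and v: "v \<in> V"
  shows "AE \<omega> in N. finite {x \<in> V. K \<omega> x v}"
proof -
  interpret prob_space N by (rule N)
  define A where "A x y = {\<omega> \<in> space N. K \<omega> x y}" for x y
  have A: "A x y \<in> events" if "x \<in> V" "y \<in> V" for x y
    using meas[OF that] by (simp add: A_def pred_def)
  have eq: "prob (A (g \<otimes> x) (g \<otimes> y)) = prob (A x y)" if "g \<in> V" "x \<in> V" "y \<in> V" for g x y
  proof (rule prob_eq_of_preserving[OF \<tau>[OF that(1)]])
    show "AE \<omega> in N. \<tau> g \<omega> \<in> A (g \<otimes> x) (g \<otimes> y) \<longleftrightarrow> \<omega> \<in> A x y"
      using inv[OF that] AE_space
      by eventually_elim (use measurable_space[OF \<tau>(1)[OF that(1)]] in \<open>auto simp: A_def\<close>)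
  qed (use that A in auto)
  have sum: "(\<Sum>i<n. prob (A (vert i) v)) \<le> real c" for n
  proof -
    let ?y = "\<lambda>i. inv (vert i) \<otimes> v"
    \<comment> \<open>Translation by \<open>inv (vert i)\<close> turns what \<open>v\<close>
      receives from \<open>vert i\<close> into what the identity sends.\<close>
    have "prob (A (vert i) v) = prob (A \<one> (?y i))" for i
      using eq[of "inv (vert i)" "vert i" v] v by simp
    then have "(\<Sum>i<n. prob (A (vert i) v)) = (\<Sum>i<n. prob (A \<one> (?y i)))" by simp
    also have "\<dots> \<le> real c"
    proof (rule sum_prob_le_card)
      fix \<omega> assume "\<omega> \<in> space N"
      have inj: "inj ?y"
      proof (rule injI)
        fix i j assume "?y i = ?y j"
        then have "inv (vert i) = inv (vert j)" using v by simp
        then show "i = j" using vert_inj by (metis inv_inv vert_V injD)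
      qed
      have "card {i. i < n \<and> \<omega> \<in> A \<one> (?y i)} = card (?y ` {i. i < n \<and> \<omega> \<in> A \<one> (?y i)})"
        by (rule card_image[symmetric]) (rule inj_on_subset[OF inj], simp)
      also have "\<dots> \<le> card {w \<in> V. K \<omega> \<one> w}"
        using card[of \<one> \<omega>] v by (intro card_mono) (auto simp: A_def)
      finally show "card {i. i < n \<and> \<omega> \<in> A \<one> (?y i)} \<le> c" using card[of \<one> \<omega>] by simp
    qed (use A v in auto)
    finally show ?thesis .
  qed
  \<comment> \<open>Borel-Cantelli: the probabilities are summable, so almost surely only finitely
    many vertices send mass to \<open>v\<close>.\<close>
  have "AE \<omega> in N. eventually (\<lambda>i. \<omega> \<in> space N - A (vert i) v) sequentially"
  proof (rule borel_cantelli_AE1)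
    show "summable (\<lambda>i. prob (A (vert i) v))"
      by (rule summableI_nonneg_bounded[OF measure_nonneg sum])
  qed (use A v in \<open>auto simp: less_top[symmetric]\<close>)
  then show ?thesis
    using AE_space
  proof eventually_elim
    fix \<omega> assume ev: "eventually (\<lambda>i. \<omega> \<in> space N - A (vert i) v) sequentially" and \<omega>: "\<omega> \<in> space N"
    obtain n where n: "\<And>i. i \<ge> n \<Longrightarrow> \<omega> \<notin> A (vert i) v" using ev by (auto simp: eventually_sequentially)
    have "{x \<in> V. K \<omega> x v} \<subseteq> vert ` {..<n}"
    proof
      fix x assume x: "x \<in> {x \<in> V. K \<omega> x v}"
      then obtain i where i: "x = vert i" using vert_surj by blast
      then have "\<omega> \<in> A (vert i) v" using x \<omega> by (simp add: A_def)
      then have "i < n" using n not_le by blast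
      then show "x \<in> vert ` {..<n}" using i by blast
    qed
    then show "finite {x \<in> V. K \<omega> x v}" by (rule finite_subset) simp
  qed
qed

lemma pred_card_le:
  assumes "\<And>v. v \<in> V \<Longrightarrow> Measurable.pred N (\<lambda>\<omega>. v \<in> B \<omega>)" "\<And>\<omega>. B \<omega> \<subseteq> V"
  shows "Measurable.pred N (\<lambda>\<omega>. finite (B \<omega>) \<and> card (B \<omega>) \<le> c)"
proof -
  have "finite (B \<omega>) \<and> card (B \<omega>) \<le> c \<longleftrightarrow>
      (\<exists>A\<in>{A. finite A \<and> A \<subseteq> V \<and> card A \<le> c}. \<forall>v\<in>V. v \<in> B \<omega> \<longrightarrow> v \<in> A)" for \<omega>
  proof
    assume "finite (B \<omega>) \<and> card (B \<omega>) \<le> c"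
    then show "\<exists>A\<in>{A. finite A \<and> A \<subseteq> V \<and> card A \<le> c}. \<forall>v\<in>V. v \<in> B \<omega> \<longrightarrow> v \<in> A"
      using assms(2)[of \<omega>] by (intro bexI[of _ "B \<omega>"]) auto
  next
    assume "\<exists>A\<in>{A. finite A \<and> A \<subseteq> V \<and> card A \<le> c}. \<forall>v\<in>V. v \<in> B \<omega> \<longrightarrow> v \<in> A"
    then obtain A where A: "finite A" "card A \<le> c" "B \<omega> \<subseteq> A" using assms(2)[of \<omega>] by blast
    then show "finite (B \<omega>) \<and> card (B \<omega>) \<le> c"
      using card_mono[OF A(1,3)] finite_subset[OF A(3,1)] by simp
  qed
  moreover have "Measurable.pred N (\<lambda>\<omega>. \<exists>A\<in>{A. finite A \<and> A \<subseteq> V \<and> card A \<le> c}. \<forall>v\<in>V. v \<in> B \<omega> \<longrightarrow> v \<in> A)"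
    by (intro pred_countable_Bex pred_countable_Ball countable_V pred_intros_logic(4) assms
        countable_subset[OF _ countable_finsets]) auto
  ultimately show ?thesis by (simp only:)
qed

text \<open>Restrict to the event that \<open>B\<close> has at most \<open>c\<close> elements. All
  vertices of the infinite \<open>H\<close>-orbit of \<open>v\<close> belong to \<open>B\<close>
  with the same probability there, and any finite sum of these probabilities is at most
  \<open>c\<close>; so the common value is zero.\<close>

lemma invariant_set_empty_or_infinite:
  assumes N: "prob_space N" and H: "H \<subseteq> V" "infinite H"
    and \<tau>: "\<And>g. g \<in> H \<Longrightarrow> \<tau> g \<in> measurable N N" "\<And>g. g \<in> H \<Longrightarrow> distr N N (\<tau> g) = N"
    and meas: "\<And>v. v \<in> V \<Longrightarrow> Measurable.pred N (\<lambda>\<omega>. v \<in> B \<omega>)" and sub: "\<And>\<omega>. B \<omega> \<subseteq> V"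
    and inv: "\<And>h. h \<in> H \<Longrightarrow> AE \<omega> in N. \<forall>v\<in>V. h \<otimes> v \<in> B (\<tau> h \<omega>) \<longleftrightarrow> v \<in> B \<omega>"
  shows "AE \<omega> in N. B \<omega> = {} \<or> infinite (B \<omega>)"
proof -
  interpret prob_space N by (rule N)
  define f where "f c \<omega> \<longleftrightarrow> finite (B \<omega>) \<and> card (B \<omega>) \<le> c" for c \<omega>
  have fm: "Measurable.pred N (f c)" for c
    unfolding f_def by (rule pred_card_le[OF meas sub])
  obtain h :: "nat \<Rightarrow> 'a" where h: "inj h" "range h \<subseteq> H"
    using infinite_countable_subset[OF H(2)] by blast
  have h': "h i \<in> H" "h i \<in> V" for i using h(2) H(1) by auto
  have null: "AE \<omega> in N. \<not> (v \<in> B \<omega> \<and> f c \<omega>)" if v: "v \<in> V" for v c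
  proof -
    define A where "A x = {\<omega> \<in> space N. x \<in> B \<omega> \<and> f c \<omega>}" for x
    have A: "A x \<in> events" if "x \<in> V" for x
      unfolding A_def using pred_intros_logic(3)[OF meas[OF that] fm[of c]] by (simp add: pred_def)
    have eq: "prob (A (g \<otimes> v)) = prob (A v)" if g: "g \<in> H" for g
    proof -
      have gV: "g \<in> V" using g H by auto
      show ?thesis
      proof (rule prob_eq_of_preserving[OF \<tau>[OF g]])
        show "AE \<omega> in N. \<tau> g \<omega> \<in> A (g \<otimes> v) \<longleftrightarrow> \<omega> \<in> A v"
          using inv[OF g] AE_space
        proof eventually_elim
          fix \<omega> assume i: "\<forall>v\<in>V. g \<otimes> v \<in> B (\<tau> g \<omega>) \<longleftrightarrow> v \<in> B \<omega>" and \<omega>: "\<omega> \<in> space N"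
          have im: "B (\<tau> g \<omega>) = (\<lambda>x. g \<otimes> x) ` B \<omega>"
          proof (intro equalityI subsetI)
            fix x assume x: "x \<in> B (\<tau> g \<omega>)"
            then have xV: "x \<in> V" using sub by blast
            then have "g \<otimes> (inv g \<otimes> x) \<in> B (\<tau> g \<omega>)" using x gV by simp
            then have "inv g \<otimes> x \<in> B \<omega>" using i gV xV by blast
            then show "x \<in> (\<lambda>x. g \<otimes> x) ` B \<omega>" using gV xV by (intro image_eqI[of _ _ "inv g \<otimes> x"]) auto
          qed (use i sub in blast)
          have inj: "inj_on (\<lambda>x. g \<otimes> x) (B \<omega>)" using sub[of \<omega>] gV by (auto intro!: inj_onI simp: subset_iff)
          have "f c (\<tau> g \<omega>) \<longleftrightarrow> f c \<omega>" unfolding f_def im by (simp add: card_image[OF inj] finite_image_iff[OF inj])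
          then show "\<tau> g \<omega> \<in> A (g \<otimes> v) \<longleftrightarrow> \<omega> \<in> A v"
            using i v \<omega> measurable_space[OF \<tau>(1)[OF g]] by (auto simp: A_def)
        qed
      qed (use gV v A in auto)
    qed
    have "real n * prob (A v) \<le> real c" for n
    proof -
      have "real n * prob (A v) = (\<Sum>i<n. prob (A (h i \<otimes> v)))" using eq h' by simp
      also have "\<dots> \<le> real c"
      proof (rule sum_prob_le_card)
        fix \<omega>
        have inj: "inj (\<lambda>i. h i \<otimes> v)"
        proof (rule injI)
          fix i j assume "h i \<otimes> v = h j \<otimes> v"
          then have "h i = h j" using v h' by simp
          then show "i = j" using h(1) by (simp add: injD)
        qed
        show "card {i. i < n \<and> \<omega> \<in> A (h i \<otimes> v)} \<le> c"
        proof (cases "{i. i < n \<and> \<omega> \<in> A (h i \<otimes> v)} = {}")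
          case False
          then have f: "f c \<omega>" by (auto simp: A_def)
          have "card {i. i < n \<and> \<omega> \<in> A (h i \<otimes> v)} = card ((\<lambda>i. h i \<otimes> v) ` {i. i < n \<and> \<omega> \<in> A (h i \<otimes> v)})"
            by (rule card_image[symmetric]) (rule inj_on_subset[OF inj], simp)
          also have "\<dots> \<le> card (B \<omega>)"
            using f by (intro card_mono) (auto simp: A_def f_def)
          finally show ?thesis using f by (simp add: f_def)
        next
          case True then show ?thesis by (simp only: card.empty)
        qed
      qed (use A v h' in auto)
      finally show ?thesis .
    qed
    then have "prob (A v) = 0"
      by (metis measure_nonneg less_eq_real_def reals_Archimedean3 not_le)
    then have "emeasure N (A v) = 0" by (simp add: emeasure_eq_measure)
    then have "AE \<omega> in N. \<omega> \<notin> A v" using A[OF v] by (intro AE_not_in null_setsI)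
    then show ?thesis using AE_space by eventually_elim (auto simp: A_def)
  qed
  have "AE \<omega> in N. \<forall>v\<in>V. \<forall>c. \<not> (v \<in> B \<omega> \<and> f c \<omega>)"
    by (subst AE_ball_countable[OF countable_V], intro ballI, subst AE_all_countable, intro allI null)
  then show ?thesis
  proof eventually_elim
    fix \<omega> assume a: "\<forall>v\<in>V. \<forall>c. \<not> (v \<in> B \<omega> \<and> f c \<omega>)"
    show "B \<omega> = {} \<or> infinite (B \<omega>)"
    proof (rule ccontr)
      assume "\<not> (B \<omega> = {} \<or> infinite (B \<omega>))"
      then obtain v where "v \<in> B \<omega>" "f (card (B \<omega>)) \<omega>" by (auto simp: f_def)
      then show False using a sub by blast
    qed
  qed
qed

text \<open>
  An \<open>H\<close>-equivariant choice of finitely many clusters. It need not be equivariant under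
  \<open>G\<close>, but by normality of \<open>H\<close> its translates are again such choices.
\<close>

definition selection :: "real \<Rightarrow> 'a set \<Rightarrow> (('a set \<Rightarrow> bool) \<Rightarrow> 'a set) \<Rightarrow> bool" where
  "selection p H M \<longleftrightarrow> (\<forall>x\<in>V. Measurable.pred config (\<lambda>\<eta>. x \<in> M \<eta>)) \<and> (\<forall>\<eta>. M \<eta> \<subseteq> V) \<and>
     (AE \<eta> in Perc p. \<exists>A. finite A \<and> A \<subseteq> V \<and> (\<forall>x\<in>M \<eta>. \<exists>a\<in>A. conn \<eta> a x)) \<and>
     (\<forall>h\<in>H. AE \<eta> in Perc p. \<forall>x\<in>V. h \<otimes> x \<in> M (shift h \<eta>) \<longleftrightarrow> x \<in> M \<eta>)"

definition translate :: "'a \<Rightarrow> (('a set \<Rightarrow> bool) \<Rightarrow> 'a set) \<Rightarrow> ('a set \<Rightarrow> bool) \<Rightarrow> 'a set" where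
  "translate g M \<eta> = {x \<in> V. inv g \<otimes> x \<in> M (shift (inv g) \<eta>)}"

text \<open>Equivariance of the translate under \<open>h\<close> amounts to equivariance of
  \<open>M\<close> under the conjugate \<open>inv g \<otimes> h \<otimes> g\<close>, and normality
  keeps this conjugate in \<open>H\<close>.\<close>

lemma selection_translate:
  assumes M: "selection p H M" and H: "H \<lhd> G" and g: "g \<in> V"
  shows "selection p H (translate g M)"
  unfolding selection_def
proof (intro conjI ballI allI)
  have g': "inv g \<in> V" using g by simp
  have HV: "H \<subseteq> V" using normal_imp_subgroup[OF H] subgroup.subset by blast
  show "translate g M \<eta> \<subseteq> V" for \<eta> by (auto simp: translate_def)
  {
    fix x assume x: "x \<in> V"
    have "Measurable.pred config (\<lambda>\<eta>. inv g \<otimes> x \<in> M (shift (inv g) \<eta>))"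
      by (rule measurable_compose[OF shift_measurable[OF g']]) (use M x g in \<open>auto simp: selection_def\<close>)
    then show "Measurable.pred config (\<lambda>\<eta>. x \<in> translate g M \<eta>)" using x by (simp add: translate_def)
  }
  have "AE \<eta> in Perc p. \<exists>A. finite A \<and> A \<subseteq> V \<and> (\<forall>x\<in>M \<eta>. \<exists>a\<in>A. conn \<eta> a x)"
    using M by (simp add: selection_def)
  from AE_shift[OF g' this]
  show "AE \<eta> in Perc p. \<exists>A. finite A \<and> A \<subseteq> V \<and> (\<forall>x\<in>translate g M \<eta>. \<exists>a\<in>A. conn \<eta> a x)"
  proof eventually_elim
    fix \<eta> assume "\<exists>A. finite A \<and> A \<subseteq> V \<and> (\<forall>x\<in>M (shift (inv g) \<eta>). \<exists>a\<in>A. conn (shift (inv g) \<eta>) a x)"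
    then obtain A where A: "finite A" "A \<subseteq> V" "\<And>x. x \<in> M (shift (inv g) \<eta>) \<Longrightarrow> \<exists>a\<in>A. conn (shift (inv g) \<eta>) a x" by blast
    have "\<exists>a\<in>(\<lambda>x. g \<otimes> x) ` A. conn \<eta> a x" if x: "x \<in> translate g M \<eta>" for x
    proof -
      have "x \<in> V" using x by (simp add: translate_def)
      obtain a where a: "a \<in> A" "conn (shift (inv g) \<eta>) a (inv g \<otimes> x)" using x A(3) by (auto simp: translate_def)
      then have "a \<in> V" using A by auto
      then have "conn \<eta> (g \<otimes> a) x"
        using a(2) conn_shift'[OF g', of a "inv g \<otimes> x" \<eta>] g \<open>x \<in> V\<close> by simp
      then show ?thesis using a(1) by blast
    qed
    then show "\<exists>A. finite A \<and> A \<subseteq> V \<and> (\<forall>x\<in>translate g M \<eta>. \<exists>a\<in>A. conn \<eta> a x)"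
      using A g by (intro exI[of _ "(\<lambda>x. g \<otimes> x) ` A"]) auto
  qed
  fix h assume h: "h \<in> H"
  then have hV: "h \<in> V" using HV by auto
  define k where "k = inv g \<otimes> h \<otimes> g"
  have k: "k \<in> H" "k \<in> V" "k \<otimes> inv g = inv g \<otimes> h"
    using normal.inv_op_closed1[OF H g h] HV g hV by (auto simp: k_def m_assoc)
  have "AE \<eta> in Perc p. \<forall>x\<in>V. k \<otimes> x \<in> M (shift k \<eta>) \<longleftrightarrow> x \<in> M \<eta>"
    using M k(1) by (simp add: selection_def)
  from AE_shift[OF g' this]
  show "AE \<eta> in Perc p. \<forall>x\<in>V. h \<otimes> x \<in> translate g M (shift h \<eta>) \<longleftrightarrow> x \<in> translate g M \<eta>"
  proof eventually_elim
    fix \<eta> assume *: "\<forall>x\<in>V. k \<otimes> x \<in> M (shift k (shift (inv g) \<eta>)) \<longleftrightarrow> x \<in> M (shift (inv g) \<eta>)"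
    show "\<forall>x\<in>V. h \<otimes> x \<in> translate g M (shift h \<eta>) \<longleftrightarrow> x \<in> translate g M \<eta>"
    proof
      fix x assume x: "x \<in> V"
      have "shift (inv g) (shift h \<eta>) = shift k (shift (inv g) \<eta>)"
        using shift_mult[OF g' hV, of \<eta>] shift_mult[OF k(2) g', of \<eta>] k(3) by simp
      moreover have "inv g \<otimes> (h \<otimes> x) = k \<otimes> (inv g \<otimes> x)"
        using m_assoc[OF g' hV x] m_assoc[OF k(2) g' x] k(3) by simp
      ultimately show "h \<otimes> x \<in> translate g M (shift h \<eta>) \<longleftrightarrow> x \<in> translate g M \<eta>"
        using * x g hV by (simp add: translate_def)
    qed
  qed
qed

text \<open>The selected vertices in finite clusters form an equivariant set. It is finite, being
  covered by finitely many finite clusters, and therefore almost surely empty.\<close>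

lemma selection_clusters_infinite:
  assumes M: "selection p H M" and H: "H \<subseteq> V" "infinite H"
  shows "AE \<eta> in Perc p. \<forall>x\<in>M \<eta>. infinite {y. conn \<eta> x y}"
proof -
  define B where "B \<eta> = {x \<in> M \<eta>. finite {y. conn \<eta> x y}}" for \<eta>
  have MV: "M \<eta> \<subseteq> V" for \<eta> using M by (simp add: selection_def)
  have "AE \<eta> in Perc p. B \<eta> = {} \<or> infinite (B \<eta>)"
  proof (rule invariant_set_empty_or_infinite[OF prob_space_Perc H, where \<tau>=shift])
    fix g assume g: "g \<in> H"
    then have gV: "g \<in> V" using H by auto
    show "shift g \<in> measurable (Perc p) (Perc p)" "distr (Perc p) (Perc p) (shift g) = Perc p"
      using gV shift_measurable_Perc distr_shift by auto
    have "AE \<eta> in Perc p. \<forall>x\<in>V. g \<otimes> x \<in> M (shift g \<eta>) \<longleftrightarrow> x \<in> M \<eta>"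
      using M g by (simp add: selection_def)
    then show "AE \<eta> in Perc p. \<forall>v\<in>V. g \<otimes> v \<in> B (shift g \<eta>) \<longleftrightarrow> v \<in> B \<eta>"
      by eventually_elim (use infinite_cluster_shift[OF gV] in \<open>auto simp: B_def\<close>)
  next
    fix v assume v: "v \<in> V"
    have "Measurable.pred config (\<lambda>\<eta>. v \<in> M \<eta> \<and> \<not> infinite {y. conn \<eta> v y})"
      using M v by (intro pred_intros_logic(2,3) infinite_cluster_measurable) (auto simp: selection_def)
    then show "Measurable.pred (Perc p) (\<lambda>\<eta>. v \<in> B \<eta>)" by (simp add: B_def cong: measurable_cong_sets)
  qed (use MV in \<open>auto simp: B_def\<close>)
  moreover have "AE \<eta> in Perc p. \<exists>A. finite A \<and> A \<subseteq> V \<and> (\<forall>x\<in>M \<eta>. \<exists>a\<in>A. conn \<eta> a x)"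
    using M by (simp add: selection_def)
  ultimately show ?thesis
  proof eventually_elim
    fix \<eta> assume B: "B \<eta> = {} \<or> infinite (B \<eta>)"
      and "\<exists>A. finite A \<and> A \<subseteq> V \<and> (\<forall>x\<in>M \<eta>. \<exists>a\<in>A. conn \<eta> a x)"
    then obtain A where A: "finite A" "\<And>x. x \<in> M \<eta> \<Longrightarrow> \<exists>a\<in>A. conn \<eta> a x" by blast
    have "B \<eta> \<subseteq> (\<Union>a\<in>{a\<in>A. finite {y. conn \<eta> a y}}. {y. conn \<eta> a y})"
    proof
      fix x assume x: "x \<in> B \<eta>"
      then obtain a where a: "a \<in> A" "conn \<eta> a x" using A(2) by (auto simp: B_def)
      moreover have "finite {y. conn \<eta> a y}" using x conn_cong[OF a(2)] by (simp add: B_def)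
      ultimately show "x \<in> (\<Union>a\<in>{a\<in>A. finite {y. conn \<eta> a y}}. {y. conn \<eta> a y})" by blast
    qed
    then have "finite (B \<eta>)" by (rule finite_subset) (use A(1) in auto)
    then have "B \<eta> = {}" using B by simp
    then show "\<forall>x\<in>M \<eta>. infinite {y. conn \<eta> x y}" by (auto simp: B_def)
  qed
qed

lemma bex2_V_transl:
  assumes g: "g \<in> V"
  shows "(\<exists>x\<in>V. \<exists>y\<in>V. Q x y) \<longleftrightarrow> (\<exists>x\<in>V. \<exists>y\<in>V. Q (g \<otimes> x) (g \<otimes> y))"
proof
  assume "\<exists>x\<in>V. \<exists>y\<in>V. Q x y"
  then obtain x y where "x \<in> V" "y \<in> V" "Q x y" by blast
  then show "\<exists>x\<in>V. \<exists>y\<in>V. Q (g \<otimes> x) (g \<otimes> y)"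
    using g by (intro bexI[of _ "inv g \<otimes> x"] bexI[of _ "inv g \<otimes> y"]) auto
qed (use g in blast)

text \<open>Take the grown cluster of a vertex of \<open>M1\<close> and, as target, the original
  cluster of a vertex of \<open>M2\<close>. At positive distance the contact vertices cannot be
  infinite in number by \<open>cluster_layer_infinite\<close>. If they are finite in number,
  collecting them over all pairs of selected clusters gives a finite \<open>H\<close>-equivariant
  set, which must be empty.\<close>

lemma selections_merge:
  assumes M1: "selection p H M1" and M2: "selection p H M2" and H: "H \<subseteq> V" "infinite H"
    and q: "0 < q" "q \<le> 1"
  shows "AE \<omega> in Perc2 p q. \<forall>x\<in>M1 (fst \<omega>). \<forall>y\<in>M2 (fst \<omega>). conn (joined \<omega>) x y"
proof -
  let ?D = "\<lambda>\<omega> x. {y. conn (joined \<omega>) x y}"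
  let ?T = "\<lambda>(\<omega> :: ('a set \<Rightarrow> bool) \<times> ('a set \<Rightarrow> bool)) y. {z. conn (fst \<omega>) y z}"
  have MV: "M1 \<eta> \<subseteq> V" "M2 \<eta> \<subseteq> V" for \<eta> using M1 M2 by (auto simp: selection_def)
  have TV: "{z. conn \<eta> y z} \<subseteq> V" if "y \<in> V" for \<eta> y using conn_V[OF _ that] by blast
  have inf: "AE \<omega> in Perc2 p q. \<forall>x\<in>V. \<forall>y\<in>V. \<forall>n. \<not> (?D \<omega> x \<inter> layer (?T \<omega> y) n = {} \<and>
            infinite (?D \<omega> x \<inter> layer (?T \<omega> y) (Suc n)))"
  proof (subst AE_ball_countable[OF countable_V], intro ballI, subst AE_ball_countable[OF countable_V], intro ballI)
    fix x y assume x: "x \<in> V" and y: "y \<in> V"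
    show "AE \<omega> in Perc2 p q. \<forall>n. \<not> (?D \<omega> x \<inter> layer (?T \<omega> y) n = {} \<and>
            infinite (?D \<omega> x \<inter> layer (?T \<omega> y) (Suc n)))"
    proof (rule cluster_layer_infinite[OF q _ _ x, where T="\<lambda>\<eta>. {z. conn \<eta> y z} \<inter> V" and p=p, THEN AE_mp, OF _ _ AE_I2])
      fix v assume "v \<in> V" then show "Measurable.pred config (\<lambda>\<eta>. v \<in> {z. conn \<eta> y z} \<inter> V)" by simp
    next
      fix \<omega>
      have "{z. conn (fst \<omega>) y z} \<inter> V = ?T \<omega> y" using TV[OF y] by blast
      then show "(\<forall>n. \<not> (?D \<omega> x \<inter> layer ({z. conn (fst \<omega>) y z} \<inter> V) n = {} \<and>
            infinite (?D \<omega> x \<inter> layer ({z. conn (fst \<omega>) y z} \<inter> V) (Suc n)))) \<longrightarrow>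
         (\<forall>n. \<not> (?D \<omega> x \<inter> layer (?T \<omega> y) n = {} \<and> infinite (?D \<omega> x \<inter> layer (?T \<omega> y) (Suc n))))"
        by simp
    qed auto
  qed
  \<comment> \<open>The grown cluster of \<open>x\<close> has distance greater than \<open>n\<close>
    from the original cluster of \<open>y\<close>, and finitely many vertices at distance
    \<open>n + 1\<close>.\<close>
  define good where "good n \<omega> x y \<longleftrightarrow> ?D \<omega> x \<inter> layer (?T \<omega> y) n = {} \<and>
      finite (?D \<omega> x \<inter> layer (?T \<omega> y) (Suc n))" for n \<omega> x y
  \<comment> \<open>The contact vertices of all such pairs at once. Taking the union removes the
    dependence on \<open>x\<close> and \<open>y\<close>, which makes the set equivariant.\<close>
  define B where "B n \<omega> = {v \<in> V. \<exists>x\<in>M1 (fst \<omega>). \<exists>y\<in>M2 (fst \<omega>). conn (joined \<omega>) x v \<and>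
      v \<in> layer (?T \<omega> y) (Suc n) \<and> good n \<omega> x y}" for n \<omega>
  have layer_meas: "Measurable.pred (config \<Otimes>\<^sub>M config) (\<lambda>\<omega>. v \<in> layer (?T \<omega> y) n)" if "y \<in> V" "v \<in> V" for y v n
    by (rule measurable_compose[OF measurable_fst, OF layer_measurable[OF _ that(2)]]) simp
  have good_meas: "Measurable.pred (config \<Otimes>\<^sub>M config) (\<lambda>\<omega>. good n \<omega> x y)" if x: "x \<in> V" and y: "y \<in> V" for n x y
  proof -
    have e: "?D \<omega> x \<inter> layer (?T \<omega> y) n = {} \<longleftrightarrow> \<not> (\<exists>v\<in>V. conn (joined \<omega>) x v \<and> v \<in> layer (?T \<omega> y) n)" for \<omega>
      using conn_V[OF _ x] by blast
    show ?thesis unfolding good_def e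
      by (intro pred_intros_logic(2,3) pred_countable_Bex countable_V pred_finite_subset_V layer_meas y)
         (use layer_sub[OF TV[OF y]] layer_meas[OF y] in \<open>auto simp del: layer.simps intro!: pred_intros_logic(3)\<close>)
  qed
  have M_meas: "Measurable.pred (config \<Otimes>\<^sub>M config) (\<lambda>\<omega>. x \<in> M1 (fst \<omega>))"
     "Measurable.pred (config \<Otimes>\<^sub>M config) (\<lambda>\<omega>. x \<in> M2 (fst \<omega>))" if "x \<in> V" for x
    by (rule measurable_compose[OF measurable_fst], use M1 M2 that in \<open>simp add: selection_def\<close>)+
  have B_meas: "Measurable.pred (config \<Otimes>\<^sub>M config) (\<lambda>\<omega>. v \<in> B n \<omega>)" if v: "v \<in> V" for n v
  proof -
    have "v \<in> B n \<omega> \<longleftrightarrow> (\<exists>x\<in>V. \<exists>y\<in>V. x \<in> M1 (fst \<omega>) \<and> y \<in> M2 (fst \<omega>) \<and> conn (joined \<omega>) x v \<and>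
      v \<in> layer (?T \<omega> y) (Suc n) \<and> good n \<omega> x y)" for \<omega>
      using MV v unfolding B_def by blast
    moreover have "Measurable.pred (config \<Otimes>\<^sub>M config) (\<lambda>\<omega>. \<exists>x\<in>V. \<exists>y\<in>V. x \<in> M1 (fst \<omega>) \<and> y \<in> M2 (fst \<omega>) \<and> conn (joined \<omega>) x v \<and>
      v \<in> layer (?T \<omega> y) (Suc n) \<and> good n \<omega> x y)"
      by (intro pred_countable_Bex countable_V pred_intros_logic(3) M_meas good_meas layer_meas v conn_J_measurable)
    ultimately show ?thesis by simp
  qed
  have "AE \<omega> in Perc2 p q. B n \<omega> = {} \<or> infinite (B n \<omega>)" for n
  proof (rule invariant_set_empty_or_infinite[OF prob_space_Perc2 H, where \<tau>=shift2])
    fix h assume h: "h \<in> H"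
    then have hV: "h \<in> V" using H by auto
    show "shift2 h \<in> measurable (Perc2 p q) (Perc2 p q)" "distr (Perc2 p q) (Perc2 p q) (shift2 h) = Perc2 p q"
      using hV shift2_measurable distr_shift2 by auto
    have "AE \<eta> in Perc p. \<forall>x\<in>V. h \<otimes> x \<in> M1 (shift h \<eta>) \<longleftrightarrow> x \<in> M1 \<eta>"
       "AE \<eta> in Perc p. \<forall>x\<in>V. h \<otimes> x \<in> M2 (shift h \<eta>) \<longleftrightarrow> x \<in> M2 \<eta>"
      using M1 M2 h by (auto simp: selection_def)
    then have "AE \<eta> in Perc p. \<forall>x\<in>V. (h \<otimes> x \<in> M1 (shift h \<eta>) \<longleftrightarrow> x \<in> M1 \<eta>) \<and> (h \<otimes> x \<in> M2 (shift h \<eta>) \<longleftrightarrow> x \<in> M2 \<eta>)"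
      by eventually_elim blast
    from AE_Perc2_fst[OF this, of q]
    show "AE \<omega> in Perc2 p q. \<forall>v\<in>V. h \<otimes> v \<in> B n (shift2 h \<omega>) \<longleftrightarrow> v \<in> B n \<omega>"
    proof eventually_elim
      fix \<omega> :: "('a set \<Rightarrow> bool) \<times> ('a set \<Rightarrow> bool)"
      assume M: "\<forall>x\<in>V. (h \<otimes> x \<in> M1 (shift h (fst \<omega>)) \<longleftrightarrow> x \<in> M1 (fst \<omega>)) \<and> (h \<otimes> x \<in> M2 (shift h (fst \<omega>)) \<longleftrightarrow> x \<in> M2 (fst \<omega>))"
      have fst2: "fst (shift2 h \<omega>) = shift h (fst \<omega>)" by (simp add: shift2_def case_prod_unfold)
      have J2: "joined (shift2 h \<omega>) = shift h (joined \<omega>)" by (simp add: shift2_def case_prod_unfold join_shift hV)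
      have cJ: "conn (joined (shift2 h \<omega>)) (h \<otimes> x) (h \<otimes> y) \<longleftrightarrow> conn (joined \<omega>) x y" if "x \<in> V" "y \<in> V" for x y
        unfolding J2 by (rule conn_shift[OF hV that])
      have ly: "h \<otimes> v \<in> layer (?T (shift2 h \<omega>) (h \<otimes> y)) k \<longleftrightarrow> v \<in> layer (?T \<omega> y) k" if "y \<in> V" "v \<in> V" for v y k
        by (rule layer_transl[OF hV _ that(2)]) (use that(1) conn_shift[OF hV] in \<open>simp add: fst2\<close>)
      have im: "?D (shift2 h \<omega>) (h \<otimes> x) \<inter> layer (?T (shift2 h \<omega>) (h \<otimes> y)) k = (\<lambda>z. h \<otimes> z) ` (?D \<omega> x \<inter> layer (?T \<omega> y) k)"
        if x: "x \<in> V" and y: "y \<in> V" for x y k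
        unfolding J2 by (rule cluster_layer_transl[OF hV x]) (use y conn_shift[OF hV] in \<open>simp add: fst2\<close>)
      have inj: "inj_on (\<lambda>z. h \<otimes> z) (?D \<omega> x \<inter> A)" if x: "x \<in> V" for x A
        using conn_V[OF _ x] hV by (auto intro!: inj_onI)
      have gd: "good n (shift2 h \<omega>) (h \<otimes> x) (h \<otimes> y) \<longleftrightarrow> good n \<omega> x y" if x: "x \<in> V" and y: "y \<in> V" for x y
        unfolding good_def im[OF x y] by (simp add: finite_image_iff[OF inj[OF x]] del: layer.simps)
      show "\<forall>v\<in>V. h \<otimes> v \<in> B n (shift2 h \<omega>) \<longleftrightarrow> v \<in> B n \<omega>"
      proof
        fix v assume v: "v \<in> V"
        have B_iff: "u \<in> B n \<omega>' \<longleftrightarrow> (\<exists>x\<in>V. \<exists>y\<in>V. x \<in> M1 (fst \<omega>') \<and> y \<in> M2 (fst \<omega>') \<and> conn (joined \<omega>') x u \<and>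
            u \<in> layer (?T \<omega>' y) (Suc n) \<and> good n \<omega>' x y)" if "u \<in> V" for \<omega>' u
          using MV that unfolding B_def by blast
        have "h \<otimes> v \<in> B n (shift2 h \<omega>) \<longleftrightarrow> (\<exists>x\<in>V. \<exists>y\<in>V. h \<otimes> x \<in> M1 (fst (shift2 h \<omega>)) \<and> h \<otimes> y \<in> M2 (fst (shift2 h \<omega>))
            \<and> conn (joined (shift2 h \<omega>)) (h \<otimes> x) (h \<otimes> v) \<and>
            h \<otimes> v \<in> layer (?T (shift2 h \<omega>) (h \<otimes> y)) (Suc n) \<and> good n (shift2 h \<omega>) (h \<otimes> x) (h \<otimes> y))"
          unfolding B_iff[OF m_closed[OF hV v]]
          by (rule bex2_V_transl[OF hV])
        also have "\<dots> \<longleftrightarrow> v \<in> B n \<omega>"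
          unfolding B_iff[OF v]
          by (intro bex_cong refl, simp only: cJ[OF _ v] ly[OF _ v] gd) (use M in \<open>simp add: fst2\<close>)
        finally show "h \<otimes> v \<in> B n (shift2 h \<omega>) \<longleftrightarrow> v \<in> B n \<omega>" .
      qed
    qed
  next
    fix v assume "v \<in> V"
    from B_meas[OF this, of n] show "Measurable.pred (Perc2 p q) (\<lambda>\<omega>. v \<in> B n \<omega>)"
      by (simp cong: measurable_cong_sets)
  qed (auto simp: B_def)
  then have "AE \<omega> in Perc2 p q. \<forall>n. B n \<omega> = {} \<or> infinite (B n \<omega>)" by (simp add: AE_all_countable)
  moreover have "AE \<omega> in Perc2 p q. \<exists>A. finite A \<and> A \<subseteq> V \<and> (\<forall>x\<in>M1 (fst \<omega>). \<exists>a\<in>A. conn (fst \<omega>) a x)"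
    "AE \<omega> in Perc2 p q. \<exists>A. finite A \<and> A \<subseteq> V \<and> (\<forall>x\<in>M2 (fst \<omega>). \<exists>a\<in>A. conn (fst \<omega>) a x)"
    using M1 M2 by (auto intro!: AE_Perc2_fst simp: selection_def)
  ultimately show ?thesis
    using inf
  proof eventually_elim
    fix \<omega> :: "('a set \<Rightarrow> bool) \<times> ('a set \<Rightarrow> bool)"
    assume B: "\<forall>n. B n \<omega> = {} \<or> infinite (B n \<omega>)"
      and a1: "\<exists>A. finite A \<and> A \<subseteq> V \<and> (\<forall>x\<in>M1 (fst \<omega>). \<exists>a\<in>A. conn (fst \<omega>) a x)"
      and a2: "\<exists>A. finite A \<and> A \<subseteq> V \<and> (\<forall>x\<in>M2 (fst \<omega>). \<exists>a\<in>A. conn (fst \<omega>) a x)"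
      and inf: "\<forall>x\<in>V. \<forall>y\<in>V. \<forall>n. \<not> (?D \<omega> x \<inter> layer (?T \<omega> y) n = {} \<and> infinite (?D \<omega> x \<inter> layer (?T \<omega> y) (Suc n)))"
    obtain A1 where A1: "finite A1" "\<And>x. x \<in> M1 (fst \<omega>) \<Longrightarrow> \<exists>a\<in>A1. conn (fst \<omega>) a x"
      using a1 by blast
    obtain A2 where A2: "finite A2" "\<And>x. x \<in> M2 (fst \<omega>) \<Longrightarrow> \<exists>a\<in>A2. conn (fst \<omega>) a x"
      using a2 by blast
    note A = A1 A2
    have Bn: "B n \<omega> = {}" for n
    proof -
      let ?L = "\<lambda>a b. ?D \<omega> a \<inter> layer (?T \<omega> b) (Suc n)"
      \<comment> \<open>Contact sets depend on \<open>x\<close> and \<open>y\<close> only through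
        their original clusters, so finitely many pairs of representatives account for all of
        them.\<close>
      have "B n \<omega> \<subseteq> (\<Union>(a, b)\<in>{(a, b) \<in> A1 \<times> A2. finite (?L a b)}. ?L a b)"
      proof
        fix v assume "v \<in> B n \<omega>"
        then obtain x y where xy: "x \<in> M1 (fst \<omega>)" "y \<in> M2 (fst \<omega>)" "v \<in> ?L x y" "finite (?L x y)"
          unfolding B_def good_def by blast
        obtain a b where ab: "a \<in> A1" "conn (fst \<omega>) a x" "b \<in> A2" "conn (fst \<omega>) b y"
          using A1(2)[OF xy(1)] A2(2)[OF xy(2)] by blast
        have "?D \<omega> a = ?D \<omega> x" using conn_cong[OF conn_joinI[OF ab(2)]] by simp
        moreover have "?T \<omega> b = ?T \<omega> y" using conn_cong[OF ab(4)] by simp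
        ultimately have eq: "?L a b = ?L x y" by simp
        have "(a, b) \<in> {(a, b) \<in> A1 \<times> A2. finite (?L a b)}" using ab eq xy(4) by simp
        moreover have "v \<in> ?L a b" unfolding eq by (rule xy(3))
        ultimately show "v \<in> (\<Union>(a, b)\<in>{(a, b) \<in> A1 \<times> A2. finite (?L a b)}. ?L a b)" by blast
      qed
      moreover have "finite (\<Union>(a, b)\<in>{(a, b) \<in> A1 \<times> A2. finite (?L a b)}. ?L a b)"
      proof (rule finite_UN_I)
        show "finite {(a, b) \<in> A1 \<times> A2. finite (?L a b)}"
          by (rule finite_subset[of _ "A1 \<times> A2"]) (use A in auto)
      qed auto
      ultimately have "finite (B n \<omega>)" by (rule finite_subset)
      then show ?thesis using B by blast
    qed
    show "\<forall>x\<in>M1 (fst \<omega>). \<forall>y\<in>M2 (fst \<omega>). conn (joined \<omega>) x y"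
    proof (intro ballI)
      fix x y assume x: "x \<in> M1 (fst \<omega>)" and y: "y \<in> M2 (fst \<omega>)"
      have V: "x \<in> V" "y \<in> V" using x y MV by auto
      have "\<exists>z\<in>?T \<omega> y. conn (joined \<omega>) x z"
      proof (rule cluster_hits[OF TV[OF V(2)] _ V(1), where t=y])
        show "\<forall>n. \<not> (?D \<omega> x \<inter> layer (?T \<omega> y) n = {} \<and> ?D \<omega> x \<inter> layer (?T \<omega> y) (Suc n) \<noteq> {})"
        proof (intro allI notI)
          fix n assume *: "?D \<omega> x \<inter> layer (?T \<omega> y) n = {} \<and> ?D \<omega> x \<inter> layer (?T \<omega> y) (Suc n) \<noteq> {}"
          then have "good n \<omega> x y" using inf[rule_format, OF V, of n] unfolding good_def by blast
          moreover obtain v where v: "conn (joined \<omega>) x v" "v \<in> layer (?T \<omega> y) (Suc n)" using * by blast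
          moreover have "v \<in> V" using conn_V[OF v(1) V(1)] .
          ultimately have "v \<in> B n \<omega>" using x y unfolding B_def by blast
          then show False using Bn by simp
        qed
      qed auto
      then obtain z where z: "conn (fst \<omega>) y z" "conn (joined \<omega>) x z" by auto
      show "conn (joined \<omega>) x y" by (rule conn_trans[OF z(2) conn_sym[OF conn_joinI[OF z(1)]]])
    qed
  qed
qed

text \<open>The union \<open>U\<close> of all translates of \<open>M\<close> is equivariant under
  the whole group. After opening more edges it lies in one infinite cluster, since any two
  translates merge, and no infinite cluster can avoid it.\<close>

lemma selection_imp_unique:
  assumes M: "selection p H M" and H: "H \<lhd> G" "infinite H" and ne: "\<not> (AE \<eta> in Perc p. M \<eta> = {})"
    and p: "0 \<le> p" "p \<le> 1" and q: "0 < q" "q \<le> 1"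
  shows "AE \<eta> in Perc (p + q - p * q). unique_infinite_cluster V (open_edges E \<eta>)"
proof -
  have HV: "H \<subseteq> V" using normal_imp_subgroup[OF H(1)] subgroup.subset by blast
  define U where "U \<eta> = (\<Union>g\<in>V. translate g M \<eta>)" for \<eta>
  have sel: "selection p H (translate g M)" if "g \<in> V" for g
    by (rule selection_translate[OF M H(1) that])
  have UV: "U \<eta> \<subseteq> V" for \<eta> by (auto simp: U_def translate_def)
  have U_meas: "Measurable.pred config (\<lambda>\<eta>. x \<in> U \<eta>)" if x: "x \<in> V" for x
  proof -
    have "Measurable.pred config (\<lambda>\<eta>. \<exists>g\<in>V. x \<in> translate g M \<eta>)"
      by (intro pred_countable_Bex countable_V) (use sel x in \<open>simp add: selection_def\<close>)
    then show ?thesis by (simp add: U_def)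
  qed
  have U_shift: "g \<otimes> x \<in> U (shift g \<eta>) \<longleftrightarrow> x \<in> U \<eta>" if g: "g \<in> V" and x: "x \<in> V" for g x \<eta>
  proof -
    have *: "g \<otimes> x \<in> translate (g \<otimes> k) M (shift g \<eta>) \<longleftrightarrow> x \<in> translate k M \<eta>" if k: "k \<in> V" for k
    proof -
      have "shift (inv (g \<otimes> k)) (shift g \<eta>) = shift (inv k) \<eta>"
        using shift_mult[of "inv (g \<otimes> k)" g \<eta>] g k by (simp add: inv_mult_group m_assoc)
      moreover have "inv (g \<otimes> k) \<otimes> (g \<otimes> x) = inv k \<otimes> x" using g k x by (simp add: inv_mult_group m_assoc)
      ultimately show ?thesis using g k x by (simp add: translate_def)
    qed
    have "g \<otimes> x \<in> U (shift g \<eta>) \<longleftrightarrow> (\<exists>k\<in>V. g \<otimes> x \<in> translate k M (shift g \<eta>))" by (simp add: U_def)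
    also have "\<dots> \<longleftrightarrow> (\<exists>k\<in>V. g \<otimes> x \<in> translate (g \<otimes> k) M (shift g \<eta>))" by (rule bex_V_transl[OF g])
    also have "\<dots> \<longleftrightarrow> (\<exists>k\<in>V. x \<in> translate k M \<eta>)" by (rule bex_cong[OF refl]) (rule *)
    finally show ?thesis by (simp add: U_def)
  qed
  have MU: "M \<eta> \<subseteq> U \<eta>" if "\<eta> \<in> space config" for \<eta>
  proof
    fix x assume x: "x \<in> M \<eta>"
    have "x \<in> V" using x M by (auto simp: selection_def)
    then have "x \<in> translate \<one> M \<eta>" using x shift_one[OF that] by (simp add: translate_def)
    then show "x \<in> U \<eta>" by (auto simp: U_def)
  qed
  \<comment> \<open>\<open>M\<close> is nonempty with positive probability only. Ergodicity under
    the whole group makes \<open>U\<close> nonempty almost surely.\<close>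
  have U_ne: "AE \<eta> in Perc p. U \<eta> \<noteq> {}"
  proof -
    interpret prob_space "Perc p" by (rule prob_space_Perc)
    define A where "A = {\<eta>\<in>space config. \<exists>x\<in>V. x \<in> U \<eta>}"
    have A: "A \<in> sets config"
      using pred_countable_Bex[OF countable_V U_meas] by (simp add: A_def pred_def)
    have "measure (Perc p) A = 0 \<or> measure (Perc p) A = 1"
    proof (rule shift_invariant_trivial[OF A])
      fix g assume g: "g \<in> V"
      show "AE \<omega> in Perc p. shift g \<omega> \<in> A \<longleftrightarrow> \<omega> \<in> A"
      proof (rule AE_I2)
        fix \<omega> assume "\<omega> \<in> space (Perc p)"
        then have "shift g \<omega> \<in> A \<longleftrightarrow> (\<exists>x\<in>V. g \<otimes> x \<in> U (shift g \<omega>))" "\<omega> \<in> A \<longleftrightarrow> (\<exists>x\<in>V. x \<in> U \<omega>)"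
          using shift_space[OF g] bex_V_transl[OF g, of "\<lambda>x. x \<in> U (shift g \<omega>)"] by (auto simp: A_def)
        then show "shift g \<omega> \<in> A \<longleftrightarrow> \<omega> \<in> A" using U_shift[OF g] by simp
      qed
    qed
    moreover have "measure (Perc p) A \<noteq> 0"
    proof
      assume "measure (Perc p) A = 0"
      then have "AE \<eta> in Perc p. \<eta> \<notin> A"
        using A by (intro AE_not_in null_setsI) (auto simp: emeasure_eq_measure)
      then have "AE \<eta> in Perc p. M \<eta> = {}"
        using AE_space by eventually_elim (use MU UV in \<open>fastforce simp: A_def\<close>)
      then show False using ne by simp
    qed
    ultimately have "AE \<eta> in Perc p. \<eta> \<in> A" using A by (simp add: prob_eq_1)
    then show ?thesis by eventually_elim (auto simp: A_def)
  qed
  \<comment> \<open>Each translate is a selection, and there are countably many pairs of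
    translates.\<close>
  have merge: "AE \<omega> in Perc2 p q. \<forall>x\<in>U (fst \<omega>). \<forall>y\<in>U (fst \<omega>). conn (joined \<omega>) x y"
  proof -
    have "AE \<omega> in Perc2 p q. \<forall>g\<in>V. \<forall>h\<in>V. \<forall>x\<in>translate g M (fst \<omega>). \<forall>y\<in>translate h M (fst \<omega>). conn (joined \<omega>) x y"
      by (subst AE_ball_countable[OF countable_V], intro ballI, subst AE_ball_countable[OF countable_V], intro ballI,
          rule selections_merge[OF sel sel HV H(2) q])
    then show ?thesis by eventually_elim (auto simp: U_def)
  qed
  have U_inf: "AE \<omega> in Perc2 p q. \<forall>x\<in>U (fst \<omega>). infinite {y. conn (fst \<omega>) x y}"
  proof -
    have "AE \<eta> in Perc p. \<forall>g\<in>V. \<forall>x\<in>translate g M \<eta>. infinite {y. conn \<eta> x y}"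
      by (subst AE_ball_countable[OF countable_V], intro ballI, rule selection_clusters_infinite[OF sel HV H(2)])
    from AE_Perc2_fst[OF this, of q] show ?thesis by eventually_elim (auto simp: U_def)
  qed
  let ?D = "\<lambda>\<omega> x. {y. conn (joined \<omega>) x y}"
  let ?L = "\<lambda>(\<omega> :: ('a set \<Rightarrow> bool) \<times> ('a set \<Rightarrow> bool)) n. layer (U (fst \<omega>)) n"
  have L_meas: "Measurable.pred (config \<Otimes>\<^sub>M config) (\<lambda>\<omega>. v \<in> ?L \<omega> n)" if "v \<in> V" for v n
    by (rule measurable_compose[OF measurable_fst, OF layer_measurable[OF U_meas that]])
  have LV: "?L \<omega> n \<subseteq> V" for \<omega> n by (rule layer_sub[OF UV])
  have hits_inf: "AE \<omega> in Perc2 p q. \<forall>x\<in>V. \<forall>n. \<not> (?D \<omega> x \<inter> ?L \<omega> n = {} \<and> infinite (?D \<omega> x \<inter> ?L \<omega> (Suc n)))"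
    by (subst AE_ball_countable[OF countable_V], intro ballI, rule cluster_layer_infinite[OF q UV U_meas])
  \<comment> \<open>Infinitely many clusters may stay away from \<open>U\<close>, so their contact
    vertices need not form a finite set even if each cluster has finitely many. Mass transport
    therefore replaces the counting that served for two selections.\<close>
  have transport: "AE \<omega> in Perc2 p q. \<forall>v\<in>V. \<forall>n c. ?D \<omega> v \<inter> ?L \<omega> n = {} \<and> v \<in> ?L \<omega> (Suc n) \<and>
      (finite (?D \<omega> v \<inter> ?L \<omega> (Suc n)) \<and> card (?D \<omega> v \<inter> ?L \<omega> (Suc n)) \<le> c) \<longrightarrow> finite (?D \<omega> v)"
  proof (subst AE_ball_countable[OF countable_V], intro ballI, subst AE_all_countable, intro allI, subst AE_all_countable, intro allI)
    fix v n and c :: nat assume v: "v \<in> V"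
    define good where "good \<omega> v \<longleftrightarrow> ?D \<omega> v \<inter> ?L \<omega> n = {} \<and> v \<in> ?L \<omega> (Suc n) \<and>
      (finite (?D \<omega> v \<inter> ?L \<omega> (Suc n)) \<and> card (?D \<omega> v \<inter> ?L \<omega> (Suc n)) \<le> c)" for \<omega> v
    have good_meas: "Measurable.pred (config \<Otimes>\<^sub>M config) (\<lambda>\<omega>. good \<omega> v)" if v: "v \<in> V" for v
    proof -
      have e: "?D \<omega> v \<inter> ?L \<omega> n = {} \<longleftrightarrow> \<not> (\<exists>w\<in>V. conn (joined \<omega>) v w \<and> w \<in> ?L \<omega> n)" for \<omega>
        using LV[of \<omega> n] by blast
      have m: "Measurable.pred (config \<Otimes>\<^sub>M config) (\<lambda>\<omega>. finite (?D \<omega> v \<inter> ?L \<omega> (Suc n)) \<and> card (?D \<omega> v \<inter> ?L \<omega> (Suc n)) \<le> c)"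
        by (rule pred_card_le)
          (use LV L_meas in \<open>auto simp del: layer.simps intro!: pred_intros_logic(3)\<close>)
      have "Measurable.pred (config \<Otimes>\<^sub>M config) (\<lambda>\<omega>. \<not> (\<exists>w\<in>V. conn (joined \<omega>) v w \<and> w \<in> ?L \<omega> n))"
        by (intro pred_intros_logic(2,3) pred_countable_Bex countable_V L_meas conn_J_measurable)
      then show ?thesis unfolding good_def e
        by (rule pred_intros_logic(3)[OF _ pred_intros_logic(3)[OF L_meas[OF v] m]])
    qed
    \<comment> \<open>Every vertex sends unit mass to each contact vertex of its cluster, provided
      that there are at most \<open>c\<close> of them. A contact vertex then receives mass from its
      entire cluster, which is therefore finite.\<close>
    have "AE \<omega> in Perc2 p q. finite {x \<in> V. conn (joined \<omega>) x v \<and> good \<omega> v}"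
    proof (rule mass_transport_finite[OF prob_space_Perc2 shift2_measurable distr_shift2, where K="\<lambda>\<omega> x v. conn (joined \<omega>) x v \<and> good \<omega> v"])
      fix x v assume x: "x \<in> V" and v: "v \<in> V"
      have "Measurable.pred (config \<Otimes>\<^sub>M config) (\<lambda>\<omega>. conn (joined \<omega>) x v \<and> good \<omega> v)"
        by (intro pred_intros_logic(3) good_meas v conn_J_measurable)
      then show "Measurable.pred (Perc2 p q) (\<lambda>\<omega>. conn (joined \<omega>) x v \<and> good \<omega> v)"
        by (simp cong: measurable_cong_sets)
    next
      fix g x v assume g: "g \<in> V" and x: "x \<in> V" and v: "v \<in> V"
      show "AE \<omega> in Perc2 p q. (conn (joined (shift2 g \<omega>)) (g \<otimes> x) (g \<otimes> v) \<and> good (shift2 g \<omega>) (g \<otimes> v))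
          \<longleftrightarrow> (conn (joined \<omega>) x v \<and> good \<omega> v)"
      proof (rule AE_I2)
        fix \<omega>
        have fst2: "fst (shift2 g \<omega>) = shift g (fst \<omega>)" by (simp add: shift2_def case_prod_unfold)
        have J2: "joined (shift2 g \<omega>) = shift g (joined \<omega>)" by (simp add: shift2_def case_prod_unfold join_shift g)
        have cJ: "conn (joined (shift2 g \<omega>)) (g \<otimes> x) (g \<otimes> y) \<longleftrightarrow> conn (joined \<omega>) x y" if "x \<in> V" "y \<in> V" for x y
          unfolding J2 by (rule conn_shift[OF g that])
        have ly: "g \<otimes> w \<in> ?L (shift2 g \<omega>) k \<longleftrightarrow> w \<in> ?L \<omega> k" if "w \<in> V" for w k
          by (rule layer_transl[OF g _ that]) (use U_shift[OF g] in \<open>simp add: fst2\<close>)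
        have im: "?D (shift2 g \<omega>) (g \<otimes> v) \<inter> ?L (shift2 g \<omega>) k = (\<lambda>z. g \<otimes> z) ` (?D \<omega> v \<inter> ?L \<omega> k)" for k
          unfolding J2 by (rule cluster_layer_transl[OF g v]) (use U_shift[OF g] in \<open>simp add: fst2\<close>)
        have inj: "inj_on (\<lambda>z. g \<otimes> z) (?D \<omega> v \<inter> A)" for A
          using conn_V[OF _ v] g by (auto intro!: inj_onI)
        have "good (shift2 g \<omega>) (g \<otimes> v) \<longleftrightarrow> good \<omega> v"
          unfolding good_def im by (simp add: finite_image_iff[OF inj] card_image[OF inj] ly v del: layer.simps)
        then show "(conn (joined (shift2 g \<omega>)) (g \<otimes> x) (g \<otimes> v) \<and> good (shift2 g \<omega>) (g \<otimes> v))
          \<longleftrightarrow> (conn (joined \<omega>) x v \<and> good \<omega> v)" using cJ[OF x v] by simp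
      qed
    next
      fix \<omega> x assume x: "x \<in> V"
      show "finite {v \<in> V. conn (joined \<omega>) x v \<and> good \<omega> v} \<and> card {v \<in> V. conn (joined \<omega>) x v \<and> good \<omega> v} \<le> c"
      proof (cases "\<exists>v\<in>V. conn (joined \<omega>) x v \<and> good \<omega> v")
        case True
        then obtain v0 where v0: "conn (joined \<omega>) x v0" "good \<omega> v0" by blast
        have sub: "{v \<in> V. conn (joined \<omega>) x v \<and> good \<omega> v} \<subseteq> ?D \<omega> v0 \<inter> ?L \<omega> (Suc n)"
          using conn_cong[OF v0(1)] by (auto simp: good_def simp del: layer.simps)
        have fin: "finite (?D \<omega> v0 \<inter> ?L \<omega> (Suc n))" "card (?D \<omega> v0 \<inter> ?L \<omega> (Suc n)) \<le> c"
          using v0(2) by (simp_all only: good_def)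
        show ?thesis using finite_subset[OF sub fin(1)] card_mono[OF fin(1) sub] fin(2) by (simp del: layer.simps)
      next
        case False
        then have "{v \<in> V. conn (joined \<omega>) x v \<and> good \<omega> v} = {}" by blast
        then show ?thesis by (simp only: card.empty finite.emptyI le0 simp_thms)
      qed
    qed (use v in auto)
    then show "AE \<omega> in Perc2 p q. ?D \<omega> v \<inter> ?L \<omega> n = {} \<and> v \<in> ?L \<omega> (Suc n) \<and>
      (finite (?D \<omega> v \<inter> ?L \<omega> (Suc n)) \<and> card (?D \<omega> v \<inter> ?L \<omega> (Suc n)) \<le> c) \<longrightarrow> finite (?D \<omega> v)"
    proof eventually_elim
      fix \<omega> assume fin: "finite {x \<in> V. conn (joined \<omega>) x v \<and> good \<omega> v}"
      show "?D \<omega> v \<inter> ?L \<omega> n = {} \<and> v \<in> ?L \<omega> (Suc n) \<and>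
        (finite (?D \<omega> v \<inter> ?L \<omega> (Suc n)) \<and> card (?D \<omega> v \<inter> ?L \<omega> (Suc n)) \<le> c) \<longrightarrow> finite (?D \<omega> v)"
      proof
        assume "?D \<omega> v \<inter> ?L \<omega> n = {} \<and> v \<in> ?L \<omega> (Suc n) \<and>
          (finite (?D \<omega> v \<inter> ?L \<omega> (Suc n)) \<and> card (?D \<omega> v \<inter> ?L \<omega> (Suc n)) \<le> c)"
        then have "good \<omega> v" unfolding good_def .
        then have "{x \<in> V. conn (joined \<omega>) x v \<and> good \<omega> v} = ?D \<omega> v"
          using conn_V[OF _ v] conn_commute by blast
        then show "finite (?D \<omega> v)" using fin by simp
      qed
    qed
  qed
  have main: "AE \<omega> in Perc2 p q. unique_infinite_cluster V (open_edges E (joined \<omega>))"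
    using merge U_inf hits_inf transport AE_Perc2_fst[OF U_ne, of q]
  proof eventually_elim
    fix \<omega> :: "('a set \<Rightarrow> bool) \<times> ('a set \<Rightarrow> bool)"
    assume merge: "\<forall>x\<in>U (fst \<omega>). \<forall>y\<in>U (fst \<omega>). conn (joined \<omega>) x y"
      and U_inf: "\<forall>x\<in>U (fst \<omega>). infinite {y. conn (fst \<omega>) x y}"
      and hits: "\<forall>x\<in>V. \<forall>n. \<not> (?D \<omega> x \<inter> ?L \<omega> n = {} \<and> infinite (?D \<omega> x \<inter> ?L \<omega> (Suc n)))"
      and tr: "\<forall>v\<in>V. \<forall>n c. ?D \<omega> v \<inter> ?L \<omega> n = {} \<and> v \<in> ?L \<omega> (Suc n) \<and>
      (finite (?D \<omega> v \<inter> ?L \<omega> (Suc n)) \<and> card (?D \<omega> v \<inter> ?L \<omega> (Suc n)) \<le> c) \<longrightarrow> finite (?D \<omega> v)"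
      and ne: "U (fst \<omega>) \<noteq> {}"
    obtain u where u: "u \<in> U (fst \<omega>)" using ne by blast
    have "{y. conn (fst \<omega>) u y} \<subseteq> ?D \<omega> u" using conn_joinI by blast
    moreover have "infinite {y. conn (fst \<omega>) u y}" using U_inf u by blast
    ultimately have u_inf: "infinite (?D \<omega> u)" by (rule infinite_super)
    have hit: "\<exists>y\<in>U (fst \<omega>). conn (joined \<omega>) x y" if x: "x \<in> V" and inf: "infinite (?D \<omega> x)" for x
    proof (rule cluster_hits[OF UV u x], intro allI notI)
      fix n assume *: "?D \<omega> x \<inter> ?L \<omega> n = {} \<and> ?D \<omega> x \<inter> ?L \<omega> (Suc n) \<noteq> {}"
      then obtain v where v: "conn (joined \<omega>) x v" "v \<in> ?L \<omega> (Suc n)" by blast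
      have vV: "v \<in> V" using conn_V[OF v(1) x] .
      have eq: "?D \<omega> v = ?D \<omega> x" using conn_cong[OF v(1)] by simp
      have "finite (?D \<omega> x \<inter> ?L \<omega> (Suc n))" using hits[rule_format, OF x, of n] * by blast
      \<comment> \<open>The bound \<open>c\<close> is taken to be the actual number of contact
        vertices.\<close>
      then have "finite (?D \<omega> v)"
        using tr[rule_format, OF vV, of n "card (?D \<omega> x \<inter> ?L \<omega> (Suc n))"] v(2) * unfolding eq by blast
      then show False using inf eq by simp
    qed
    show "unique_infinite_cluster V (open_edges E (joined \<omega>))"
      unfolding unique_iff
    proof (intro conjI ballI impI)
      show "\<exists>x\<in>V. infinite {y. conn (joined \<omega>) x y}" using u u_inf UV by blast
      fix x y assume x: "x \<in> V" and y: "y \<in> V" and inf: "infinite (?D \<omega> x)" "infinite (?D \<omega> y)"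
      obtain a b where ab: "a \<in> U (fst \<omega>)" "conn (joined \<omega>) x a" "b \<in> U (fst \<omega>)" "conn (joined \<omega>) y b"
        using hit[OF x inf(1)] hit[OF y inf(2)] by blast
      have "conn (joined \<omega>) a b" using merge ab by blast
      then show "conn (joined \<omega>) x y" using ab(2,4) conn_trans conn_sym by meson
    qed
  qed
  have law: "distr (Perc2 p q) (Perc (p + q - p * q)) joined = Perc (p + q - p * q)"
    using distr_bernoulli_or[of p q E] p q E_nonempty
    by (simp add: Perc2_def bernoulli_percolation_def join_def[abs_def] case_prod_unfold)
  have "joined \<in> measurable (Perc2 p q) (Perc (p + q - p * q))"
    by (simp cong: measurable_cong_sets)
  then have "(AE \<eta> in distr (Perc2 p q) (Perc (p + q - p * q)) joined. unique_infinite_cluster V (open_edges E \<eta>))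
      \<longleftrightarrow> (AE \<omega> in Perc2 p q. unique_infinite_cluster V (open_edges E (joined \<omega>)))"
    by (rule AE_distr_iff) (use unique_measurable in \<open>simp add: pred_def\<close>)
  then show ?thesis using main unfolding law by blast
qed

end

section \<open>Approximating the critical configuration\<close>

text \<open>Continuity of the measure from below, along the events that the property holds from
  index \<open>N\<close> on.\<close>

lemma (in prob_space) ex_prob_gt_of_eventually:
  assumes Q: "\<And>k. Measurable.pred M (Q k)" and ae: "AE \<omega> in M. eventually (\<lambda>k. Q k \<omega>) sequentially" and e: "e < 1"
  shows "\<exists>k. e < prob {\<omega>\<in>space M. Q k \<omega>}"
proof -
  define A where "A N = {\<omega>\<in>space M. \<forall>k\<ge>N. Q k \<omega>}" for N
  have A: "A N \<in> events" for N unfolding A_def using Q by (auto simp: pred_def)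
  have "(\<lambda>N. prob (A N)) \<longlonglongrightarrow> prob (\<Union>N. A N)"
  proof (rule finite_Lim_measure_incseq)
    show "range A \<subseteq> events" using A by auto
    show "incseq A" by (auto simp: incseq_def A_def)
  qed
  moreover have "prob (\<Union>N. A N) = 1"
  proof (subst prob_eq_1)
    show "(\<Union>N. A N) \<in> events" using A by auto
    show "AE x in M. x \<in> (\<Union>N. A N)"
      using ae AE_space by eventually_elim (auto simp: A_def eventually_sequentially)
  qed
  ultimately have "eventually (\<lambda>N. e < prob (A N)) sequentially"
    using e by (intro order_tendstoD(1)[of _ 1]) auto
  then obtain N where N: "e < prob (A N)" using eventually_happens by force
  also have "prob (A N) \<le> prob {\<omega>\<in>space M. Q N \<omega>}"
    using Q[of N] by (intro finite_measure_mono) (auto simp: A_def pred_def)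
  finally show ?thesis by blast
qed

locale coupled_percolation = cayley_graph +
  fixes pu :: real
  assumes pu: "0 < pu" "pu \<le> 1"
begin

text \<open>
  The geometric component of the labels couples the increasing levels, all of parameter below
  \<open>pu\<close>, so that their union is percolation of parameter \<open>pu\<close>.
\<close>

definition label_pmf :: "(bool \<times> nat) pmf" where
  "label_pmf = pair_pmf (bernoulli_pmf pu) (geometric_pmf (1/2))"

definition labels :: "('a set \<Rightarrow> bool \<times> nat) measure" where
  "labels = PiM E (\<lambda>_. measure_pmf label_pmf)"

definition level :: "nat \<Rightarrow> ('a set \<Rightarrow> bool \<times> nat) \<Rightarrow> ('a set \<Rightarrow> bool)" where
  "level n \<omega> = (\<lambda>e\<in>E. fst (\<omega> e) \<and> snd (\<omega> e) \<le> n)"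

definition limit_level :: "('a set \<Rightarrow> bool \<times> nat) \<Rightarrow> ('a set \<Rightarrow> bool)" where
  "limit_level \<omega> = (\<lambda>e\<in>E. fst (\<omega> e))"

definition level_prob :: "nat \<Rightarrow> real" where
  "level_prob n = measure_pmf.prob label_pmf ({True} \<times> {..n})"

lemma bool_pmf_eq: "bernoulli_pmf (pmf M True) = (M :: bool pmf)"
proof (rule pmf_eqI)
  fix b
  have "pmf M False = 1 - pmf M True"
    using measure_pmf.prob_compl[of "{True}" M] by (simp add: measure_pmf_single UNIV_bool insert_Diff_if)
  then show "pmf (bernoulli_pmf (pmf M True)) b = pmf M b"
    using pmf_nonneg[of M True] pmf_le_1[of M True] by (cases b) simp_all
qed

lemma map_label_pmf: "map_pmf (\<lambda>l. fst l \<and> snd l \<le> n) label_pmf = bernoulli_pmf (level_prob n)"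
proof -
  let ?f = "\<lambda>l :: bool \<times> nat. fst l \<and> snd l \<le> n"
  have "?f -` {True} = {True} \<times> {..n}"
    by (rule Set.set_eqI) (simp add: mem_Times_iff)
  then have pmf: "pmf (map_pmf ?f label_pmf) True = level_prob n"
    by (simp only: level_prob_def pmf_map)
  show ?thesis
    by (rule bool_pmf_eq[of "map_pmf ?f label_pmf", unfolded pmf, symmetric])
qed

lemma level_prob_bounds: "0 \<le> level_prob n" "level_prob n < pu"
proof -
  show "0 \<le> level_prob n" by (simp add: level_prob_def)
  have "level_prob n = measure_pmf.prob (bernoulli_pmf pu) {True} * measure_pmf.prob (geometric_pmf (1/2)) {..n}"
    unfolding level_prob_def label_pmf_def by (rule measure_pmf_prob_product) auto
  also have "measure_pmf.prob (bernoulli_pmf pu) {True} = pu"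
    using pu by (simp add: measure_pmf_single)
  finally have eq: "level_prob n = pu * measure_pmf.prob (geometric_pmf (1/2)) {..n}" .
  \<comment> \<open>The geometric law charges \<open>Suc n\<close>, so it gives \<open>{..n}\<close>
    probability less than 1; this is what makes the level parameter strictly smaller than
    \<open>pu\<close>.\<close>
  have "measure_pmf.prob (geometric_pmf (1/2)) {Suc n} \<le> measure_pmf.prob (geometric_pmf (1/2)) (UNIV - {..n})"
    by (intro measure_pmf.finite_measure_mono) auto
  also have "\<dots> = 1 - measure_pmf.prob (geometric_pmf (1/2)) {..n}"
    using measure_pmf.prob_compl[of "{..n}" "geometric_pmf (1/2)"] by simp
  finally have "measure_pmf.prob (geometric_pmf (1/2)) {Suc n} \<le> 1 - measure_pmf.prob (geometric_pmf (1/2)) {..n}" .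
  moreover have "0 < measure_pmf.prob (geometric_pmf (1/2)) {Suc n}" by (simp add: measure_pmf_single)
  ultimately have "measure_pmf.prob (geometric_pmf (1/2)) {..n} < 1" by linarith
  then show "level_prob n < pu" using pu by (simp add: eq)
qed

lemma prob_space_labels: "prob_space labels"
  unfolding labels_def by (rule prob_space_PiM) (rule prob_space_measure_pmf)

lemma labels_component: "e \<in> E \<Longrightarrow> (\<lambda>\<omega>. \<omega> e) \<in> measurable labels (count_space UNIV)"
  unfolding labels_def
  using measurable_component_singleton[of e E "\<lambda>_. measure_pmf label_pmf"] by (simp cong: measurable_cong_sets)

lemma level_measurable[measurable]: "level n \<in> measurable labels config"
  unfolding level_def[abs_def]
proof (rule measurable_into_config)
  fix e assume "e \<in> E"
  from measurable_compose[OF labels_component[OF this], of "\<lambda>l. fst l \<and> snd l \<le> n" "count_space UNIV"]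
  show "(\<lambda>\<omega>. fst (\<omega> e) \<and> snd (\<omega> e) \<le> n) \<in> measurable labels (count_space UNIV)" by simp
qed

lemma limit_level_measurable[measurable]: "limit_level \<in> measurable labels config"
  unfolding limit_level_def[abs_def]
proof (rule measurable_into_config)
  fix e assume "e \<in> E"
  from measurable_compose[OF labels_component[OF this], of "\<lambda>l. fst l" "count_space UNIV"]
  show "(\<lambda>\<omega>. fst (\<omega> e)) \<in> measurable labels (count_space UNIV)" by simp
qed

lemma level_space: "level n \<omega> \<in> space config"
  by (simp add: space_config level_def)

lemma distr_level: "distr labels (Perc (level_prob n)) (level n) = Perc (level_prob n)"
  using distr_PiM_pmf_map[of E label_pmf "\<lambda>l. fst l \<and> snd l \<le> n"]
  by (simp add: map_label_pmf labels_def bernoulli_percolation_def level_def[abs_def])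

lemma distr_limit_level: "distr labels (Perc pu) limit_level = Perc pu"
proof -
  have "map_pmf (\<lambda>l. fst l) label_pmf = bernoulli_pmf pu"
    by (simp add: label_pmf_def map_fst_pair_pmf)
  then show ?thesis
    using distr_PiM_pmf_map[of E label_pmf "\<lambda>l. fst l"]
    by (simp add: labels_def bernoulli_percolation_def limit_level_def[abs_def])
qed

lemma AE_level_iff:
  assumes "Measurable.pred config Q"
  shows "(AE \<eta> in Perc (level_prob n). Q \<eta>) \<longleftrightarrow> (AE \<omega> in labels. Q (level n \<omega>))"
proof -
  have "(AE \<eta> in distr labels (Perc (level_prob n)) (level n). Q \<eta>) \<longleftrightarrow> (AE \<omega> in labels. Q (level n \<omega>))"
    by (rule AE_distr_iff) (use assms in \<open>simp_all add: pred_def cong: measurable_cong_sets\<close>)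
  then show ?thesis by (simp only: distr_level)
qed

definition shift_label :: "'a \<Rightarrow> ('a set \<Rightarrow> bool \<times> nat) \<Rightarrow> ('a set \<Rightarrow> bool \<times> nat)" where
  "shift_label g \<omega> = (\<lambda>e\<in>E. \<omega> (transl (inv g) e))"

lemma shift_label_measurable: "g \<in> V \<Longrightarrow> shift_label g \<in> measurable labels labels"
  unfolding shift_label_def[abs_def] labels_def
  by (intro measurable_restrict measurable_component_singleton) (simp add: transl_E)

lemma distr_shift_label:
  assumes g: "g \<in> V"
  shows "distr labels labels (shift_label g) = labels"
  unfolding labels_def shift_label_def[abs_def]
  by (rule distr_PiM_reindex[of E "\<lambda>_. measure_pmf label_pmf" "transl (inv g)" E])
     (use transl_inj[of "inv g"] transl_E[of "inv g"] g in \<open>auto simp: prob_space_measure_pmf\<close>)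

lemma level_shift: "g \<in> V \<Longrightarrow> level n (shift_label g \<omega>) = shift g (level n \<omega>)"
  by (auto simp: level_def shift_def shift_label_def fun_eq_iff transl_E)

text \<open>A path has finitely many edges, and each of them is open at all levels from its label
  on.\<close>

lemma conn_limit:
  assumes "conn (limit_level \<omega>) x y"
  shows "eventually (\<lambda>n. conn (level n \<omega>) x y) sequentially"
  using assms unfolding conn_def[of "limit_level \<omega>"] connected_in_def
proof (induction rule: rtrancl_induct)
  case (step y z)
  then have e: "{y, z} \<in> E" "fst (\<omega> {y, z})" by (auto simp: open_edges_def limit_level_def)
  have "eventually (\<lambda>n. n \<ge> snd (\<omega> {y, z})) sequentially" by (rule eventually_ge_at_top)
  with step.IH show ?case
    by eventually_elim (rule conn_step, use e in \<open>auto simp: level_def\<close>)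
qed simp

lemma conn_level_limit: "conn (level n \<omega>) x y \<Longrightarrow> conn (limit_level \<omega>) x y"
  by (rule conn_mono[of "level n \<omega>"]) (auto simp: level_def limit_level_def)

lemma big_limit:
  assumes "big k (limit_level \<omega>) x"
  shows "eventually (\<lambda>n. big k (level n \<omega>) x) sequentially"
proof -
  obtain A where A: "finite A" "A \<subseteq> V" "card A = k" "\<forall>y\<in>A. conn (limit_level \<omega>) x y"
    using assms by (auto simp: big_def)
  have "eventually (\<lambda>n. \<forall>y\<in>A. conn (level n \<omega>) x y) sequentially"
    using A conn_limit by (intro eventually_ball_finite) auto
  then show ?thesis by eventually_elim (use A in \<open>auto simp: big_def\<close>)
qed

lemma big_level_limit:
  assumes "big k (level n \<omega>) x"
  shows "big k (limit_level \<omega>) x"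
proof -
  obtain A where A: "A \<in> {A. finite A \<and> A \<subseteq> V \<and> card A = k}" "\<forall>y\<in>A. conn (level n \<omega>) x y"
    using assms unfolding big_def by (elim bexE)
  have "\<forall>y\<in>A. conn (limit_level \<omega>) x y"
    by (intro ballI, rule conn_level_limit[of n]) (use A(2) in simp)
  then show ?thesis using A(1) unfolding big_def by (rule bexI)
qed

text \<open>
  \<open>vert (first_big \<one> k \<eta>)\<close> is the first vertex of a fixed enumeration whose cluster
  has at least \<open>k\<close> vertices, and \<open>s \<otimes> vert (first_big s k \<eta>)\<close> is its analogue
  for the enumeration translated by \<open>s\<close>. When there is a unique infinite cluster, both lie
  in it for large \<open>k\<close>. Using large instead of infinite clusters avoids having to know that
  the levels below \<open>pu\<close> percolate.
\<close>

definition first_big :: "'a \<Rightarrow> nat \<Rightarrow> ('a set \<Rightarrow> bool) \<Rightarrow> nat" where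
  "first_big t k \<eta> = (LEAST j. big k \<eta> (t \<otimes> vert j))"

definition nearly_agree :: "'a set \<Rightarrow> nat \<Rightarrow> ('a set \<Rightarrow> bool) \<Rightarrow> bool" where
  "nearly_agree K k \<eta> \<longleftrightarrow> (\<exists>x\<in>V. big k \<eta> x) \<and>
     (\<forall>s\<in>K. conn \<eta> (vert (first_big \<one> k \<eta>)) (s \<otimes> vert (first_big s k \<eta>)))"

text \<open>The order of the limits matters. A large \<open>k\<close> rules out the finite clusters
  that precede the infinite one in the enumerations; for this \<open>k\<close>, a large
  \<open>n\<close> makes the relevant pieces of the infinite cluster visible at level
  \<open>n\<close>.\<close>

lemma nearly_agree_limit:
  assumes uniq: "unique_infinite_cluster V (open_edges E (limit_level \<omega>))"
    and K: "finite K" "K \<subseteq> V"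
  shows "eventually (\<lambda>k. eventually (\<lambda>n. nearly_agree K k (level n \<omega>)) sequentially) sequentially"
proof -
  let ?\<eta> = "limit_level \<omega>"
  let ?I = "\<lambda>x. infinite {y. conn ?\<eta> x y}"
  obtain c where c: "c \<in> V" "?I c" and one: "\<And>x y. x \<in> V \<Longrightarrow> y \<in> V \<Longrightarrow> ?I x \<Longrightarrow> ?I y \<Longrightarrow> conn ?\<eta> x y"
    using uniq unfolding unique_iff by blast
  \<comment> \<open>The position of the first vertex of the infinite cluster in the enumeration
    translated by \<open>t\<close>.\<close>
  define m where "m t = (LEAST j. ?I (t \<otimes> vert j))" for t
  have m: "?I (t \<otimes> vert (m t))" if t: "t \<in> V" for t
  proof -
    obtain j where "inv t \<otimes> c = vert j" using vert_surj[of "inv t \<otimes> c"] t c by auto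
    then have eq: "t \<otimes> vert j = c" using t c by (metis inv_cancel(2))
    have "?I (t \<otimes> vert j)" unfolding eq by (rule c(2))
    then show ?thesis unfolding m_def by (rule LeastI)
  qed
  \<comment> \<open>Only finitely many vertices come before it, all in finite clusters. A level is
    contained in the limit, so they fail to be big there as well, and \<open>first_big\<close>
    cannot stop too early.\<close>
  have small: "eventually (\<lambda>k. \<forall>j<m t. \<not> big k ?\<eta> (t \<otimes> vert j)) sequentially" if t: "t \<in> V" for t
  proof -
    have "eventually (\<lambda>k. \<not> big k ?\<eta> (t \<otimes> vert j)) sequentially" if j: "j < m t" for j
    proof -
      have fin: "finite {y. conn ?\<eta> (t \<otimes> vert j) y}" using not_less_Least[OF j[unfolded m_def]] by simp
      show ?thesis
        using eventually_gt_at_top[of "card {y. conn ?\<eta> (t \<otimes> vert j) y}"]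
      proof eventually_elim
        fix k assume k: "card {y. conn ?\<eta> (t \<otimes> vert j) y} < k"
        show "\<not> big k ?\<eta> (t \<otimes> vert j)"
        proof
          assume "big k ?\<eta> (t \<otimes> vert j)"
          then obtain A where "card A = k" "A \<subseteq> {y. conn ?\<eta> (t \<otimes> vert j) y}" by (auto simp: big_def)
          then show False using card_mono[OF fin, of A] k by simp
        qed
      qed
    qed
    then have "eventually (\<lambda>k. \<forall>j\<in>{..<m t}. \<not> big k ?\<eta> (t \<otimes> vert j)) sequentially"
      by (intro eventually_ball_finite) auto
    then show ?thesis by (simp add: lessThan_def)
  qed
  have "eventually (\<lambda>k. \<forall>t\<in>insert \<one> K. \<forall>j<m t. \<not> big k ?\<eta> (t \<otimes> vert j)) sequentially"
    by (intro eventually_ball_finite ballI small) (use K in auto)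
  then show ?thesis
  proof eventually_elim
    fix k assume sm: "\<forall>t\<in>insert \<one> K. \<forall>j<m t. \<not> big k ?\<eta> (t \<otimes> vert j)"
    have bg: "big k ?\<eta> (t \<otimes> vert (m t))" if "t \<in> V" for t
      using m[OF that] infinite_cluster_iff_big[of "t \<otimes> vert (m t)" ?\<eta>] that by auto
    have "eventually (\<lambda>n. \<forall>t\<in>insert \<one> K. big k (level n \<omega>) (t \<otimes> vert (m t))) sequentially"
      by (intro eventually_ball_finite ballI big_limit bg) (use K in auto)
    moreover have "eventually (\<lambda>n. \<forall>s\<in>K. conn (level n \<omega>) (vert (m \<one>)) (s \<otimes> vert (m s))) sequentially"
    proof (intro eventually_ball_finite K ballI conn_limit one)
      fix s assume s: "s \<in> K"
      then have sV: "s \<in> V" using K by auto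
      show "vert (m \<one>) \<in> V" "s \<otimes> vert (m s) \<in> V" "?I (s \<otimes> vert (m s))" using m[OF sV] sV by auto
      show "?I (vert (m \<one>))" using m[of \<one>] by simp
    qed
    ultimately show "eventually (\<lambda>n. nearly_agree K k (level n \<omega>)) sequentially"
    proof eventually_elim
      fix n assume b: "\<forall>t\<in>insert \<one> K. big k (level n \<omega>) (t \<otimes> vert (m t))"
        and cn: "\<forall>s\<in>K. conn (level n \<omega>) (vert (m \<one>)) (s \<otimes> vert (m s))"
      have fb: "first_big t k (level n \<omega>) = m t" if t: "t \<in> insert \<one> K" for t
        unfolding first_big_def
      proof (rule Least_equality)
        show "big k (level n \<omega>) (t \<otimes> vert (m t))" using b t by blast
        fix j assume "big k (level n \<omega>) (t \<otimes> vert j)"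
        then have "big k ?\<eta> (t \<otimes> vert j)" by (rule big_level_limit)
        then show "m t \<le> j" using sm t not_le by blast
      qed
      have "\<one> \<otimes> vert (m \<one>) \<in> V" by simp
      then show "nearly_agree K k (level n \<omega>)"
        unfolding nearly_agree_def using b cn fb by auto
    qed
  qed
qed

lemma first_big_measurable[measurable]: "first_big t k \<in> measurable config (count_space UNIV)"
  unfolding first_big_def by measurable

lemma nearly_agree_measurable: "finite K \<Longrightarrow> Measurable.pred config (nearly_agree K k)"
proof -
  assume K: "finite K"
  have "Measurable.pred config (\<lambda>\<eta>. conn \<eta> (vert (first_big \<one> k \<eta>)) (s \<otimes> vert (first_big s k \<eta>)))" for s
  proof -
    have "Measurable.pred config (\<lambda>\<eta>. \<exists>i j. first_big \<one> k \<eta> = i \<and> first_big s k \<eta> = j \<and> conn \<eta> (vert i) (s \<otimes> vert j))"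
      by measurable
    then show ?thesis by simp
  qed
  then show ?thesis unfolding nearly_agree_def[abs_def]
    by (intro pred_intros_logic(3) pred_countable_Bex pred_countable_Ball countable_V countable_finite[OF K] big_pred)
qed

lemma ex_nearly_agree:
  assumes uniq: "AE \<eta> in Perc pu. unique_infinite_cluster V (open_edges E \<eta>)"
    and K: "finite K" "K \<subseteq> V" and e: "e < 1"
  shows "\<exists>k n. e < measure labels {\<omega>\<in>space labels. nearly_agree K k (level n \<omega>)}"
proof -
  interpret prob_space labels by (rule prob_space_labels)
  have "AE \<eta> in distr labels (Perc pu) limit_level. unique_infinite_cluster V (open_edges E \<eta>)"
    unfolding distr_limit_level by (rule uniq)
  then have "AE \<omega> in labels. unique_infinite_cluster V (open_edges E (limit_level \<omega>))"
    by (rule AE_distrD[rotated]) (simp cong: measurable_cong_sets)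
  then have ae: "AE \<omega> in labels. eventually (\<lambda>k. eventually (\<lambda>n. nearly_agree K k (level n \<omega>)) sequentially) sequentially"
    by eventually_elim (rule nearly_agree_limit[OF _ K])
  have m: "Measurable.pred labels (\<lambda>\<omega>. nearly_agree K k (level n \<omega>))" for k n
    by (rule measurable_compose[OF level_measurable nearly_agree_measurable[OF K(1)]])
  have m2: "Measurable.pred labels (\<lambda>\<omega>. eventually (\<lambda>n. nearly_agree K k (level n \<omega>)) sequentially)" for k
    unfolding eventually_sequentially using m by measurable
  \<comment> \<open>The midpoint between \<open>e\<close> and 1 leaves room for the second passage
    to the limit, over \<open>n\<close> with this \<open>k\<close> fixed.\<close>
  obtain k where k: "(1 + e) / 2 < prob {\<omega>\<in>space labels. eventually (\<lambda>n. nearly_agree K k (level n \<omega>)) sequentially}"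
    using ex_prob_gt_of_eventually[OF m2 ae, of "(1 + e) / 2"] e by auto
  define A where "A N = {\<omega>\<in>space labels. \<forall>n\<ge>N. nearly_agree K k (level n \<omega>)}" for N
  have A: "A N \<in> events" for N unfolding A_def using m by (auto simp: pred_def)
  have "(\<lambda>N. prob (A N)) \<longlonglongrightarrow> prob (\<Union>N. A N)"
  proof (rule finite_Lim_measure_incseq)
    show "range A \<subseteq> events" using A by auto
    show "incseq A" by (auto simp: incseq_def A_def)
  qed
  moreover have "(\<Union>N. A N) = {\<omega>\<in>space labels. eventually (\<lambda>n. nearly_agree K k (level n \<omega>)) sequentially}"
    by (auto simp: A_def eventually_sequentially)
  ultimately have "eventually (\<lambda>N. e < prob (A N)) sequentially"
    using k e by (intro order_tendstoD(1)[of _ "prob (\<Union>N. A N)"]) auto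
  then obtain N where N: "e < prob (A N)" using eventually_happens by force
  also have "prob (A N) \<le> prob {\<omega>\<in>space labels. nearly_agree K k (level N \<omega>)}"
    using m[of k N] by (intro finite_measure_mono) (auto simp: A_def pred_def)
  finally show ?thesis by blast
qed

section \<open>Canonical representatives of clusters\<close>

definition rep :: "('a set \<Rightarrow> bool) \<Rightarrow> 'a \<Rightarrow> nat" where
  "rep \<eta> x = (LEAST j. conn \<eta> x (vert j))"

lemma conn_rep: "x \<in> V \<Longrightarrow> conn \<eta> x (vert (rep \<eta> x))"
proof -
  assume "x \<in> V"
  then obtain j where "x = vert j" using vert_surj by blast
  then have "conn \<eta> x (vert j)" by simp
  then show ?thesis unfolding rep_def by (rule LeastI)
qed

lemma rep_cong: "conn \<eta> x y \<Longrightarrow> rep \<eta> x = rep \<eta> y"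
  unfolding rep_def by (simp only: conn_cong[of \<eta> x y])

lemma rep_eqD:
  assumes "rep \<eta> x = rep \<eta> y" "x \<in> V" "y \<in> V"
  shows "conn \<eta> x y"
  using conn_trans[OF conn_rep[OF assms(2)] conn_sym[OF conn_rep[OF assms(3), of \<eta>, folded assms(1)]]] .

lemma rep_rep: "x \<in> V \<Longrightarrow> rep \<eta> (vert (rep \<eta> x)) = rep \<eta> x"
  by (rule rep_cong[OF conn_rep, symmetric])

lemma rep_measurable[measurable]: "(\<lambda>\<eta>. rep \<eta> x) \<in> measurable config (count_space UNIV)"
  unfolding rep_def by measurable

end

section \<open>The space of clusters\<close>

context coupled_percolation
begin

text \<open>
  The point \<open>((n, i), \<eta>)\<close> of \<open>reps\<close> stands for a cluster of the configuration
  \<open>\<eta>\<close> at level \<open>n\<close>, encoded by the least index \<open>i\<close> of its vertices. The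
  measure counts clusters, so its \<open>L\<^sup>2\<close> space is the direct sum over \<open>n\<close> of the
  spaces of random square-summable functions on clusters.
\<close>

definition cl_base :: "((nat \<times> nat) \<times> ('a set \<Rightarrow> bool)) measure" where
  "cl_base = count_space UNIV \<Otimes>\<^sub>M config"

definition reps :: "((nat \<times> nat) \<times> ('a set \<Rightarrow> bool)) set" where
  "reps = {z \<in> space cl_base. rep (snd z) (vert (snd (fst z))) = snd (fst z)}"

definition lift_level :: "(nat \<times> nat) \<times> ('a set \<Rightarrow> bool \<times> nat) \<Rightarrow> (nat \<times> nat) \<times> ('a set \<Rightarrow> bool)" where
  "lift_level z = (fst z, level (fst (fst z)) (snd z))"

text \<open>Labels are pushed forward to the configuration of level \<open>n\<close>, so a function
  on this space sees that level only. The selection extracted from an invariant vector is then a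
  function of a percolation configuration, to which independent edges can be added.\<close>

definition cl_measure :: "((nat \<times> nat) \<times> ('a set \<Rightarrow> bool)) measure" where
  "cl_measure = density (distr (count_space UNIV \<Otimes>\<^sub>M labels) cl_base lift_level) (indicator reps)"

lemma space_cl_base: "space cl_base = UNIV \<times> space config"
  by (simp add: cl_base_def space_pair_measure)

lemma sets_cl_measure[simp, measurable_cong]: "sets cl_measure = sets cl_base"
  by (simp add: cl_measure_def)

lemma space_cl_measure[simp]: "space cl_measure = space cl_base"
  by (simp add: cl_measure_def)

lemma measurable_cl_base:
  "(\<And>k. (\<lambda>\<eta>. f (k, \<eta>)) \<in> measurable config N) \<Longrightarrow> f \<in> measurable cl_base N"
  unfolding cl_base_def by (rule measurable_pair_measure_countable1) auto

lemma reps_sets[measurable]: "reps \<in> sets cl_base"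
proof -
  have "Measurable.pred cl_base (\<lambda>z. rep (snd z) (vert (snd (fst z))) = snd (fst z))"
    by (rule measurable_cl_base) simp
  then show ?thesis by (simp add: reps_def pred_def)
qed

lemma lift_level_measurable[measurable]: "lift_level \<in> measurable (count_space UNIV \<Otimes>\<^sub>M labels) cl_base"
proof (rule measurable_pair_measure_countable1)
  fix k :: "nat \<times> nat"
  show "(\<lambda>\<omega>. lift_level (k, \<omega>)) \<in> measurable labels cl_base"
    unfolding lift_level_def cl_base_def by simp
qed simp

definition fiber :: "((nat \<times> nat) \<times> ('a set \<Rightarrow> bool)) set \<Rightarrow> ('a set \<Rightarrow> bool \<times> nat) \<Rightarrow> (nat \<times> nat) set" where
  "fiber A \<omega> = {k. (k, level (fst k) \<omega>) \<in> A \<inter> reps}"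

text \<open>The number of clusters in \<open>A\<close>, over all levels of one labelling; it may be
  infinite.\<close>

definition cnt :: "((nat \<times> nat) \<times> ('a set \<Rightarrow> bool)) set \<Rightarrow> ('a set \<Rightarrow> bool \<times> nat) \<Rightarrow> ennreal" where
  "cnt A \<omega> = emeasure (count_space UNIV) (fiber A \<omega>)"

lemma sigma_finite_nat2: "sigma_finite_measure (count_space (UNIV :: (nat \<times> nat) set))"
  by (rule sigma_finite_measure_count_space)

lemma cnt_eq: "cnt A \<omega> = (\<integral>\<^sup>+k. indicator (A \<inter> reps) (lift_level (k, \<omega>)) \<partial>count_space UNIV)"
proof -
  have "(\<integral>\<^sup>+k. indicator (A \<inter> reps) (lift_level (k, \<omega>)) \<partial>count_space UNIV)
      = (\<integral>\<^sup>+k. indicator (fiber A \<omega>) k \<partial>count_space UNIV)"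
    by (rule nn_integral_cong) (auto simp: fiber_def lift_level_def split: split_indicator)
  then show ?thesis by (simp add: cnt_def)
qed

lemma indicator_lift_measurable:
  "A \<in> sets cl_base \<Longrightarrow> (\<lambda>z. indicator (A \<inter> reps) (lift_level z) :: ennreal) \<in> borel_measurable (count_space UNIV \<Otimes>\<^sub>M labels)"
  by (rule measurable_compose[OF lift_level_measurable borel_measurable_indicator]) auto

lemma cnt_measurable:
  assumes "A \<in> sets cl_base"
  shows "cnt A \<in> borel_measurable labels"
proof -
  interpret L: prob_space labels by (rule prob_space_labels)
  interpret K: sigma_finite_measure "count_space (UNIV :: (nat \<times> nat) set)" by (rule sigma_finite_nat2)
  have "(\<lambda>(\<omega>, k). indicator (A \<inter> reps) (lift_level (k, \<omega>)) :: ennreal) \<in> borel_measurable (labels \<Otimes>\<^sub>M count_space UNIV)"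
    using measurable_pair_swap[OF indicator_lift_measurable[OF assms]] by simp
  then show ?thesis unfolding cnt_eq[abs_def] by (rule K.borel_measurable_nn_integral)
qed

text \<open>Tonelli's theorem, after unfolding the density and the image measure. Measures of sets
  of clusters are henceforth computed as expected numbers of clusters.\<close>

lemma emeasure_cl:
  assumes [measurable]: "A \<in> sets cl_base"
  shows "emeasure cl_measure A = (\<integral>\<^sup>+\<omega>. cnt A \<omega> \<partial>labels)"
proof -
  interpret L: prob_space labels by (rule prob_space_labels)
  interpret K: sigma_finite_measure "count_space (UNIV :: (nat \<times> nat) set)" by (rule sigma_finite_nat2)
  interpret KL: pair_sigma_finite "count_space (UNIV :: (nat \<times> nat) set)" labels ..
  have "emeasure cl_measure A = (\<integral>\<^sup>+z. indicator reps z * indicator A z \<partial>distr (count_space UNIV \<Otimes>\<^sub>M labels) cl_base lift_level)"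
    unfolding cl_measure_def by (rule emeasure_density) auto
  also have "\<dots> = (\<integral>\<^sup>+z. indicator reps (lift_level z) * indicator A (lift_level z) \<partial>(count_space UNIV \<Otimes>\<^sub>M labels))"
    by (rule nn_integral_distr) auto
  also have "\<dots> = (\<integral>\<^sup>+z. indicator (A \<inter> reps) (lift_level z) \<partial>(count_space UNIV \<Otimes>\<^sub>M labels))"
    by (rule nn_integral_cong) (auto split: split_indicator)
  also have "\<dots> = (\<integral>\<^sup>+\<omega>. (\<integral>\<^sup>+k. indicator (A \<inter> reps) (lift_level (k, \<omega>)) \<partial>count_space UNIV) \<partial>labels)"
    by (rule KL.nn_integral_snd[symmetric]) (rule indicator_lift_measurable, rule assms)
  finally show ?thesis by (simp add: cnt_eq)
qed

text \<open>There are countably many pairs of a level and an index, and the counting measure charges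
  each; so almost surely all clusters of all levels avoid a given null set at once.\<close>

lemma AE_cl_measureD:
  assumes "AE z in cl_measure. Q z"
  shows "AE \<omega> in labels. \<forall>k. (k, level (fst k) \<omega>) \<in> reps \<longrightarrow> Q (k, level (fst k) \<omega>)"
proof -
  interpret L: prob_space labels by (rule prob_space_labels)
  interpret K: sigma_finite_measure "count_space (UNIV :: (nat \<times> nat) set)" by (rule sigma_finite_nat2)
  interpret KL: pair_sigma_finite "count_space (UNIV :: (nat \<times> nat) set)" labels ..
  have "AE z in distr (count_space UNIV \<Otimes>\<^sub>M labels) cl_base lift_level. 0 < (indicator reps z :: ennreal) \<longrightarrow> Q z"
    using assms unfolding cl_measure_def by (subst (asm) AE_density) auto
  then have "AE z in count_space UNIV \<Otimes>\<^sub>M labels. 0 < (indicator reps (lift_level z) :: ennreal) \<longrightarrow> Q (lift_level z)"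
    by (rule AE_distrD[OF lift_level_measurable])
  then have "AE k in count_space UNIV. AE \<omega> in labels. 0 < (indicator reps (lift_level (k, \<omega>)) :: ennreal) \<longrightarrow> Q (lift_level (k, \<omega>))"
    by (rule KL.AE_pair)
  then have *: "\<forall>k. AE \<omega> in labels. 0 < (indicator reps (lift_level (k, \<omega>)) :: ennreal) \<longrightarrow> Q (lift_level (k, \<omega>))"
    unfolding AE_count_space by blast
  show ?thesis
    unfolding AE_all_countable
  proof
    fix k
    show "AE \<omega> in labels. (k, level (fst k) \<omega>) \<in> reps \<longrightarrow> Q (k, level (fst k) \<omega>)"
      using spec[OF *, of k] by eventually_elim (simp add: lift_level_def indicator_def)
  qed
qed

text \<open>A translated cluster is renamed by its own least index. On the complement of
  \<open>reps\<close>, a null set, the identity is used so that the laws of an action hold at every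
  point.\<close>

definition cl_act :: "'a \<Rightarrow> (nat \<times> nat) \<times> ('a set \<Rightarrow> bool) \<Rightarrow> (nat \<times> nat) \<times> ('a set \<Rightarrow> bool)" where
  "cl_act g z = (if z \<in> reps then
     ((fst (fst z), rep (shift g (snd z)) (g \<otimes> vert (snd (fst z)))), shift g (snd z)) else z)"

lemma reps_iff: "((n, i), \<eta>) \<in> reps \<longleftrightarrow> \<eta> \<in> space config \<and> rep \<eta> (vert i) = i"
  by (simp add: reps_def space_cl_base)

lemma cl_act_simp: "((n, i), \<eta>) \<in> reps \<Longrightarrow> cl_act g ((n, i), \<eta>) = ((n, rep (shift g \<eta>) (g \<otimes> vert i)), shift g \<eta>)"
  by (simp add: cl_act_def)

lemma cl_act_reps:
  assumes "g \<in> V" "z \<in> reps"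
  shows "cl_act g z \<in> reps"
proof -
  obtain n i \<eta> where z: "z = ((n, i), \<eta>)" by (metis prod.collapse)
  show ?thesis using assms unfolding z by (simp add: cl_act_simp reps_iff shift_space rep_rep)
qed

text \<open>Renaming between the two translations does no harm: the old and the new representative
  lie in the same cluster, and they still do after the second shift.\<close>

lemma cl_act_mult:
  assumes g: "g \<in> V" and h: "h \<in> V"
  shows "cl_act (g \<otimes> h) z = cl_act g (cl_act h z)"
proof (cases "z \<in> reps")
  case True
  obtain n i \<eta> where z: "z = ((n, i), \<eta>)" by (metis prod.collapse)
  have 1: "cl_act h z = ((n, rep (shift h \<eta>) (h \<otimes> vert i)), shift h \<eta>)"
    using True unfolding z by (rule cl_act_simp)
  have 2: "((n, rep (shift h \<eta>) (h \<otimes> vert i)), shift h \<eta>) \<in> reps"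
    using cl_act_reps[OF h True] 1 by simp
  have "conn (shift h \<eta>) (h \<otimes> vert i) (vert (rep (shift h \<eta>) (h \<otimes> vert i)))"
    using h by (intro conn_rep) auto
  then have "conn (shift g (shift h \<eta>)) (g \<otimes> (h \<otimes> vert i)) (g \<otimes> vert (rep (shift h \<eta>) (h \<otimes> vert i)))"
    using g h by (subst conn_shift) auto
  note 3 = rep_cong[OF this]
  have "cl_act g (cl_act h z) = ((n, rep (shift g (shift h \<eta>)) (g \<otimes> vert (rep (shift h \<eta>) (h \<otimes> vert i)))), shift g (shift h \<eta>))"
    unfolding 1 by (rule cl_act_simp[OF 2])
  also have "\<dots> = cl_act (g \<otimes> h) z"
    using True g h unfolding z by (simp add: cl_act_simp 3[symmetric] shift_mult m_assoc)
  finally show ?thesis by simp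
qed (simp add: cl_act_def)

lemma cl_act_one:
  assumes "z \<in> space cl_base"
  shows "cl_act \<one> z = z"
proof (cases "z \<in> reps")
  case True
  obtain n i \<eta> where z: "z = ((n, i), \<eta>)" by (metis prod.collapse)
  have "\<eta> \<in> space config" "rep \<eta> (vert i) = i" using True by (simp_all add: z reps_iff)
  then show ?thesis using cl_act_simp[OF True[unfolded z], of \<one>] unfolding z by (simp add: shift_one)
qed (simp add: cl_act_def)

lemma cl_act_measurable:
  assumes g: "g \<in> V"
  shows "cl_act g \<in> measurable cl_base cl_base"
proof -
  have 1: "(\<lambda>z. (fst (fst z), rep (shift g (snd z)) (g \<otimes> vert (snd (fst z))))) \<in> measurable cl_base (count_space UNIV)"
  proof (rule measurable_cl_base)
    fix k :: "nat \<times> nat"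
    have "(\<lambda>\<eta>. rep (shift g \<eta>) (g \<otimes> vert (snd k))) \<in> measurable config (count_space UNIV)"
      by (rule measurable_compose[OF shift_measurable[OF g] rep_measurable])
    then have "(\<lambda>\<eta>. (\<lambda>j. (fst k, j)) (rep (shift g \<eta>) (g \<otimes> vert (snd k)))) \<in> measurable config (count_space UNIV)"
      by (rule measurable_compose) simp
    then show "(\<lambda>\<eta>. (fst (fst (k, \<eta>)), rep (shift g (snd (k, \<eta>))) (g \<otimes> vert (snd (fst (k, \<eta>)))))) \<in> measurable config (count_space UNIV)"
      by simp
  qed
  have 2: "(\<lambda>z. shift g (snd z)) \<in> measurable cl_base config"
    unfolding cl_base_def by (rule measurable_compose[OF measurable_snd shift_measurable[OF g]])
  have "(\<lambda>z. ((fst (fst z), rep (shift g (snd z)) (g \<otimes> vert (snd (fst z)))), shift g (snd z))) \<in> measurable cl_base (count_space UNIV \<Otimes>\<^sub>M config)"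
    by (rule measurable_Pair[OF 1 2])
  then have "(\<lambda>z. ((fst (fst z), rep (shift g (snd z)) (g \<otimes> vert (snd (fst z)))), shift g (snd z))) \<in> measurable cl_base cl_base"
    by (simp only: cl_base_def[symmetric])
  then show ?thesis unfolding cl_act_def[abs_def]
    by (rule measurable_If) (auto simp: Int_def[symmetric])
qed

text \<open>Translation by \<open>g\<close> maps the clusters of a labelling bijectively onto those
  of the shifted labelling, level by level; \<open>f\<close> is this bijection in terms of
  representatives.\<close>

lemma cnt_vimage:
  assumes g: "g \<in> V" and A: "A \<subseteq> space cl_base"
  shows "cnt (cl_act g -` A \<inter> space cl_base) \<omega> = cnt A (shift_label g \<omega>)"
proof -
  define f where "f k = (fst k, rep (shift g (level (fst k) \<omega>)) (g \<otimes> vert (snd k)))" for k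
  have "bij_betw f (fiber (cl_act g -` A \<inter> space cl_base) \<omega>) (fiber A (shift_label g \<omega>))"
  proof (rule bij_betw_imageI)
    show "inj_on f (fiber (cl_act g -` A \<inter> space cl_base) \<omega>)"
    proof (rule inj_onI)
      fix k k' assume k: "k \<in> fiber (cl_act g -` A \<inter> space cl_base) \<omega>" "k' \<in> fiber (cl_act g -` A \<inter> space cl_base) \<omega>"
        and eq: "f k = f k'"
      obtain n i where ki: "k = (n, i)" by (cases k)
      obtain j where kj: "k' = (n, j)" using eq ki by (cases k') (auto simp: f_def)
      have r: "rep (level n \<omega>) (vert i) = i" "rep (level n \<omega>) (vert j) = j"
        using k by (auto simp: fiber_def ki kj reps_iff)
      have "conn (shift g (level n \<omega>)) (g \<otimes> vert i) (g \<otimes> vert j)"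
        using eq g by (intro rep_eqD) (auto simp: f_def ki kj)
      then have "conn (level n \<omega>) (vert i) (vert j)" using g by (simp add: conn_shift)
      then have "i = j" using rep_cong r by metis
      then show "k = k'" by (simp add: ki kj)
    qed
    show "f ` fiber (cl_act g -` A \<inter> space cl_base) \<omega> = fiber A (shift_label g \<omega>)"
    proof (intro equalityI subsetI)
      fix k' assume "k' \<in> f ` fiber (cl_act g -` A \<inter> space cl_base) \<omega>"
      then obtain n i where k: "k' = f (n, i)" "(n, i) \<in> fiber (cl_act g -` A \<inter> space cl_base) \<omega>" by auto
      then have z: "((n, i), level n \<omega>) \<in> reps" "cl_act g ((n, i), level n \<omega>) \<in> A" by (auto simp: fiber_def)
      have "cl_act g ((n, i), level n \<omega>) = (k', level (fst k') (shift_label g \<omega>))"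
        unfolding cl_act_simp[OF z(1)] k(1) by (simp add: f_def level_shift[OF g])
      then show "k' \<in> fiber A (shift_label g \<omega>)"
        using z(2) cl_act_reps[OF g z(1)] by (simp add: fiber_def)
    next
      fix k' assume k': "k' \<in> fiber A (shift_label g \<omega>)"
      obtain n j where kj: "k' = (n, j)" by (cases k')
      let ?\<eta> = "level n \<omega>"
      define i where "i = rep ?\<eta> (inv g \<otimes> vert j)"
      have z': "((n, j), shift g ?\<eta>) \<in> A" "((n, j), shift g ?\<eta>) \<in> reps"
        using k' by (auto simp: fiber_def kj level_shift[OF g])
      have z: "((n, i), ?\<eta>) \<in> reps"
        using g by (simp add: reps_iff level_space i_def rep_rep)
      have "conn ?\<eta> (inv g \<otimes> vert j) (vert i)" unfolding i_def using g by (intro conn_rep) auto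
      then have "conn (shift g ?\<eta>) (g \<otimes> (inv g \<otimes> vert j)) (g \<otimes> vert i)"
        using g by (subst conn_shift) auto
      then have "conn (shift g ?\<eta>) (vert j) (g \<otimes> vert i)" using g by simp
      from rep_cong[OF this] have fj: "rep (shift g ?\<eta>) (g \<otimes> vert i) = j"
        using z'(2) by (simp add: reps_iff)
      have "cl_act g ((n, i), ?\<eta>) = ((n, j), shift g ?\<eta>)" unfolding cl_act_simp[OF z] fj ..
      then have "(n, i) \<in> fiber (cl_act g -` A \<inter> space cl_base) \<omega>"
        using z z'(1) by (simp add: fiber_def space_cl_base level_space)
      moreover have "f (n, i) = k'" by (simp add: f_def fj kj)
      ultimately show "k' \<in> f ` fiber (cl_act g -` A \<inter> space cl_base) \<omega>" by force
    qed
  qed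
  from bij_betw_finite[OF this] bij_betw_same_card[OF this] show ?thesis
    by (simp add: cnt_def emeasure_count_space)
qed

text \<open>Clusters are matched by the bijection above, and the law of the labels is invariant
  under shifts.\<close>

lemma distr_cl_act:
  assumes g: "g \<in> V"
  shows "distr cl_measure cl_measure (cl_act g) = cl_measure"
proof (rule measure_eqI)
  fix A assume "A \<in> sets (distr cl_measure cl_measure (cl_act g))"
  then have A: "A \<in> sets cl_base" by simp
  have m: "cl_act g \<in> measurable cl_measure cl_measure"
    using cl_act_measurable[OF g] by (simp cong: measurable_cong_sets)
  have "emeasure (distr cl_measure cl_measure (cl_act g)) A = emeasure cl_measure (cl_act g -` A \<inter> space cl_base)"
    using emeasure_distr[OF m, of A] A by simp
  also have "\<dots> = (\<integral>\<^sup>+\<omega>. cnt (cl_act g -` A \<inter> space cl_base) \<omega> \<partial>labels)"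
    by (rule emeasure_cl) (rule measurable_sets[OF cl_act_measurable[OF g] A])
  also have "\<dots> = (\<integral>\<^sup>+\<omega>. cnt A (shift_label g \<omega>) \<partial>labels)"
    using cnt_vimage[OF g sets.sets_into_space[OF A]] by simp
  also have "\<dots> = (\<integral>\<^sup>+\<omega>. cnt A \<omega> \<partial>distr labels labels (shift_label g))"
    by (rule nn_integral_distr[symmetric]) (use shift_label_measurable[OF g] cnt_measurable[OF A] in auto)
  also have "\<dots> = emeasure cl_measure A" by (simp add: distr_shift_label[OF g] emeasure_cl[OF A])
  finally show "emeasure (distr cl_measure cl_measure (cl_act g)) A = emeasure cl_measure A" .
qed simp

text \<open>Prescribing open edges is enough, since states are boolean and complements come with the
  sigma-algebra. Fixing the level and the index bounds the measure by 1, and the empty set closes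
  the family under intersection.\<close>

definition cylinders :: "((nat \<times> nat) \<times> ('a set \<Rightarrow> bool)) set set" where
  "cylinders = insert {} ((\<lambda>(k, F). {k} \<times> {\<eta> \<in> space config. \<forall>e\<in>F. \<eta> e}) ` (UNIV \<times> {F. finite F \<and> F \<subseteq> E}))"

lemma countable_cylinders: "countable cylinders"
  unfolding cylinders_def
  by (intro countable_insert countable_image countable_SIGMA countable_Collect_finite_subset countable_E) auto

lemma cylinder_sets: "finite F \<Longrightarrow> F \<subseteq> E \<Longrightarrow> {k} \<times> {\<eta> \<in> space config. \<forall>e\<in>F. \<eta> e} \<in> sets cl_base"
proof -
  assume F: "finite F" "F \<subseteq> E"
  have "Measurable.pred config (\<lambda>\<eta>. \<forall>e\<in>F. \<eta> e)"
    by (intro pred_countable_Ball countable_finite F(1) config_component) (use F in auto)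
  then show ?thesis unfolding cl_base_def by (intro pair_measureI) (auto simp: pred_def)
qed

lemma cylinders_gen: "sets cl_base = sigma_sets (space cl_base) cylinders"
proof
  have sub: "cylinders \<subseteq> Pow (space cl_base)" by (auto simp: cylinders_def space_cl_base)
  show "sigma_sets (space cl_base) cylinders \<subseteq> sets cl_base"
    by (rule sets.sigma_sets_subset) (auto simp: cylinders_def intro!: cylinder_sets)
  define N where "N = sigma (space cl_base) cylinders"
  have N: "sets N = sigma_sets (space cl_base) cylinders" "space N = space cl_base"
    using sub by (auto simp: N_def)
  have cyl: "{k} \<times> {\<eta> \<in> space config. \<forall>e\<in>F. \<eta> e} \<in> sets N" if "finite F" "F \<subseteq> E" for k F
    unfolding N by (rule sigma_sets.Basic) (use that in \<open>auto simp: cylinders_def\<close>)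
  \<comment> \<open>This is the identity written in coordinates, so measurability need only be
    checked for the index and for single edges.\<close>
  have "(\<lambda>z. (fst z, (\<lambda>e\<in>E. snd z e))) \<in> measurable N (count_space UNIV \<Otimes>\<^sub>M config)"
  proof (intro measurable_Pair measurable_into_config)
    show "fst \<in> measurable N (count_space UNIV)"
    proof (rule measurableI)
      fix a :: "(nat \<times> nat) set"
      have "fst -` a \<inter> space N = (\<Union>k\<in>a. {k} \<times> {\<eta> \<in> space config. \<forall>e\<in>{}. \<eta> e})"
        by (auto simp: N space_cl_base)
      also have "\<dots> \<in> sets N" by (rule sets.countable_UN') (use cyl[of "{}"] in auto)
      finally show "fst -` a \<inter> space N \<in> sets N" .
    qed simp
    fix e assume e: "e \<in> E"
    have "{z \<in> space N. snd z e} = (\<Union>k. {k} \<times> {\<eta> \<in> space config. \<forall>e\<in>{e}. \<eta> e})"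
      by (auto simp: N space_cl_base)
    also have "\<dots> \<in> sets N" by (rule sets.countable_UN') (use cyl[of "{e}"] e in auto)
    finally show "Measurable.pred N (\<lambda>z. snd z e)" by (simp add: pred_def)
  qed
  then have "(\<lambda>z. (fst z, (\<lambda>e\<in>E. snd z e))) \<in> measurable N cl_base" by (simp only: cl_base_def)
  moreover have "(fst z, (\<lambda>e\<in>E. snd z e)) = z" if "z \<in> space N" for z
    using that by (auto simp: N space_cl_base space_config extensional_restrict)
  ultimately have id: "(\<lambda>z. z) \<in> measurable N cl_base"
    by (subst measurable_cong[where g="\<lambda>z. (fst z, (\<lambda>e\<in>E. snd z e))"]) auto
  show "sets cl_base \<subseteq> sigma_sets (space cl_base) cylinders"
  proof
    fix A assume A: "A \<in> sets cl_base"
    have "(\<lambda>z. z) -` A \<inter> space N \<in> sets N" by (rule measurable_sets[OF id A])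
    moreover have "(\<lambda>z. z) -` A \<inter> space N = A" using sets.sets_into_space[OF A] by (auto simp: N)
    ultimately show "A \<in> sigma_sets (space cl_base) cylinders" by (simp add: N)
  qed
qed

lemma cylinders_stable: "Int_stable cylinders"
proof (rule Int_stableI)
  fix A B assume A: "A \<in> cylinders" and B: "B \<in> cylinders"
  show "A \<inter> B \<in> cylinders"
  proof (cases "A \<inter> B = {}")
    case False
    obtain k F where F: "A = {k} \<times> {\<eta> \<in> space config. \<forall>e\<in>F. \<eta> e}" "finite F" "F \<subseteq> E"
      using A False by (auto simp: cylinders_def)
    obtain l F' where F': "B = {l} \<times> {\<eta> \<in> space config. \<forall>e\<in>F'. \<eta> e}" "finite F'" "F' \<subseteq> E"
      using B False by (auto simp: cylinders_def)
    have "k = l" using False F F' by auto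
    then have "A \<inter> B = {k} \<times> {\<eta> \<in> space config. \<forall>e\<in>F \<union> F'. \<eta> e}" using F F' by auto
    then show ?thesis unfolding cylinders_def using F F' by (intro insertI2 image_eqI[of _ _ "(k, F \<union> F')"]) auto
  qed (simp add: cylinders_def)
qed

lemma cl_measure_cylinder: "A \<in> cylinders \<Longrightarrow> emeasure cl_measure A < \<infinity>"
proof -
  assume "A \<in> cylinders"
  then consider "A = {}" | k F where "A = {k} \<times> {\<eta> \<in> space config. \<forall>e\<in>F. \<eta> e}" "finite F" "F \<subseteq> E"
    by (auto simp: cylinders_def)
  then show ?thesis
  proof cases
    case 2
    interpret prob_space labels by (rule prob_space_labels)
    have "cnt A \<omega> \<le> 1" for \<omega>
    proof -
      have "fiber A \<omega> \<subseteq> {k}" by (auto simp: fiber_def 2)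
      then have "emeasure (count_space UNIV) (fiber A \<omega>) \<le> emeasure (count_space UNIV) {k}"
        by (intro emeasure_mono) auto
      then show ?thesis by (simp add: cnt_def)
    qed
    then have "(\<integral>\<^sup>+\<omega>. cnt A \<omega> \<partial>labels) \<le> (\<integral>\<^sup>+\<omega>. 1 \<partial>labels)" by (intro nn_integral_mono)
    then show ?thesis using emeasure_cl[of A] cylinder_sets[OF 2(2,3), of k] 2(1)
      by (simp add: emeasure_space_1 order_le_less_trans)
  qed simp
qed

lemma cl_action: "measure_preserving_action cl_measure (from_nat_into cylinders) G cl_act"
proof -
  have r: "range (from_nat_into cylinders) = cylinders"
    by (rule range_from_nat_into[OF _ countable_cylinders]) (simp add: cylinders_def)
  have cyl: "from_nat_into cylinders k \<in> cylinders" for k using r by blast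
  interpret pi_generated_measure cl_measure "from_nat_into cylinders"
  proof
    show "Int_stable (range (from_nat_into cylinders))" unfolding r by (rule cylinders_stable)
    show "range (from_nat_into cylinders) \<subseteq> Pow (space cl_measure)" unfolding r
      by (auto simp: cylinders_def space_cl_base)
    show "sets cl_measure = sigma_sets (space cl_measure) (range (from_nat_into cylinders))"
      unfolding r using cylinders_gen by simp
    show "\<Union>(range (from_nat_into cylinders)) = space cl_measure" unfolding r
    proof (rule equalityI)
      show "\<Union>cylinders \<subseteq> space cl_measure" by (auto simp: cylinders_def space_cl_base)
      show "space cl_measure \<subseteq> \<Union>cylinders"
      proof
        fix z assume "z \<in> space cl_measure"
        then have "z \<in> {fst z} \<times> {\<eta> \<in> space config. \<forall>e\<in>{}. \<eta> e}" by (auto simp: space_cl_base)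
        moreover have "{fst z} \<times> {\<eta> \<in> space config. \<forall>e\<in>{}. \<eta> e} \<in> cylinders"
          unfolding cylinders_def by (intro insertI2 image_eqI[of _ _ "(fst z, {})"]) auto
        ultimately show "z \<in> \<Union>cylinders" by (rule UnionI[rotated])
      qed
    qed
    show "emeasure cl_measure (from_nat_into cylinders k) < \<infinity>" for k
      by (rule cl_measure_cylinder[OF cyl])
  qed
  show ?thesis
  proof
    fix g assume g: "g \<in> V"
    show "cl_act g \<in> measurable cl_measure cl_measure"
      using cl_act_measurable[OF g] by (simp cong: measurable_cong_sets)
    show "distr cl_measure cl_measure (cl_act g) = cl_measure" by (rule distr_cl_act[OF g])
  qed (simp_all add: cl_act_mult cl_act_one)
qed

end

section \<open>The theorem\<close>

context coupled_percolation
begin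

text \<open>Contains at most one cluster of a configuration. The condition that a big vertex exists
  guards against the unspecified value of \<open>LEAST\<close>.\<close>

definition first_big_set :: "nat \<Rightarrow> nat \<Rightarrow> ((nat \<times> nat) \<times> ('a set \<Rightarrow> bool)) set" where
  "first_big_set n k = {z \<in> space cl_base. fst (fst z) = n \<and> (\<exists>x\<in>V. big k (snd z) x) \<and>
     snd (fst z) = first_big \<one> k (snd z)}"

lemma first_big_set_sets: "first_big_set n k \<in> sets cl_base"
proof -
  have "Measurable.pred cl_base (\<lambda>z. fst (fst z) = n \<and> (\<exists>x\<in>V. big k (snd z) x) \<and> snd (fst z) = first_big \<one> k (snd z))"
  proof (rule measurable_cl_base)
    fix l :: "nat \<times> nat"
    have "Measurable.pred config (\<lambda>\<eta>. \<exists>x\<in>V. big k \<eta> x)" by (intro pred_countable_Bex countable_V big_pred)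
    then show "Measurable.pred config (\<lambda>\<eta>. fst (fst (l, \<eta>)) = n \<and> (\<exists>x\<in>V. big k (snd (l, \<eta>)) x) \<and>
        snd (fst (l, \<eta>)) = first_big \<one> k (snd (l, \<eta>)))" by simp
  qed
  then show ?thesis by (simp add: first_big_set_def pred_def)
qed

lemma big_first_big:
  assumes "\<exists>x\<in>V. big k \<eta> x"
  shows "big k \<eta> (vert (first_big \<one> k \<eta>))"
proof -
  obtain j where "big k \<eta> (vert j)" using assms vert_surj by blast
  then have "big k \<eta> (\<one> \<otimes> vert j)" by simp
  then have "big k \<eta> (\<one> \<otimes> vert (first_big \<one> k \<eta>))" unfolding first_big_def by (rule LeastI)
  then show ?thesis by simp
qed

lemma rep_first_big:
  assumes "\<exists>x\<in>V. big k \<eta> x"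
  shows "rep \<eta> (vert (first_big \<one> k \<eta>)) = first_big \<one> k \<eta>"
  unfolding rep_def
proof (rule Least_equality)
  fix j assume "conn \<eta> (vert (first_big \<one> k \<eta>)) (vert j)"
  then have "big k \<eta> (\<one> \<otimes> vert j)" using big_cong big_first_big[OF assms] by simp
  then show "first_big \<one> k \<eta> \<le> j" unfolding first_big_def by (rule Least_le)
qed simp

lemma first_big_shift:
  assumes s: "s \<in> V"
  shows "first_big \<one> k (shift (inv s) \<eta>) = first_big s k \<eta>"
proof -
  have "big k (shift (inv s) \<eta>) (\<one> \<otimes> vert j) \<longleftrightarrow> big k \<eta> (s \<otimes> vert j)" for j
    using big_shift[of "inv s" "s \<otimes> vert j" k \<eta>] s by simp
  then show ?thesis by (simp add: first_big_def)
qed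

text \<open>Pulling the rule back along the shift by \<open>inv s\<close> replaces the enumeration
  by its translate under \<open>s\<close>. Near agreement says that both enumerations pick the same
  cluster.\<close>

lemma first_big_set_act:
  assumes z: "((n, i), \<eta>) \<in> reps" and s: "s \<in> V" and ag: "nearly_agree {s} k \<eta>"
  shows "((n, i), \<eta>) \<in> first_big_set m k \<longleftrightarrow> cl_act (inv s) ((n, i), \<eta>) \<in> first_big_set m k"
proof -
  let ?\<eta> = "shift (inv s) \<eta>"
  have s': "inv s \<in> V" using s by simp
  have \<eta>: "\<eta> \<in> space config" "rep \<eta> (vert i) = i" using z by (auto simp: reps_iff)
  have ex: "\<exists>x\<in>V. big k \<eta> x" and cn: "conn \<eta> (vert (first_big \<one> k \<eta>)) (s \<otimes> vert (first_big s k \<eta>))"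
    using ag by (auto simp: nearly_agree_def)
  have ex': "\<exists>x\<in>V. big k ?\<eta> x"
    using ex bex_V_transl[OF s', of "\<lambda>x. big k ?\<eta> x"] big_shift[OF s'] by simp
  have sp: "?\<eta> \<in> space config" by (rule shift_space[OF s' \<eta>(1)])
  have "cl_act (inv s) ((n, i), \<eta>) \<in> first_big_set m k
      \<longleftrightarrow> n = m \<and> rep ?\<eta> (inv s \<otimes> vert i) = first_big s k \<eta>"
    unfolding cl_act_simp[OF z] using ex' sp by (simp add: first_big_set_def space_cl_base first_big_shift[OF s])
  also have "rep ?\<eta> (inv s \<otimes> vert i) = first_big s k \<eta> \<longleftrightarrow> conn ?\<eta> (inv s \<otimes> vert i) (vert (first_big s k \<eta>))"
  proof
    assume eq: "rep ?\<eta> (inv s \<otimes> vert i) = first_big s k \<eta>"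
    show "conn ?\<eta> (inv s \<otimes> vert i) (vert (first_big s k \<eta>))"
      using conn_rep[of "inv s \<otimes> vert i" ?\<eta>] s' unfolding eq by simp
  next
    assume "conn ?\<eta> (inv s \<otimes> vert i) (vert (first_big s k \<eta>))"
    from rep_cong[OF this] show "rep ?\<eta> (inv s \<otimes> vert i) = first_big s k \<eta>"
      using rep_first_big[OF ex'] first_big_shift[OF s] by simp
  qed
  also have "\<dots> \<longleftrightarrow> conn \<eta> (vert i) (s \<otimes> vert (first_big s k \<eta>))"
    using conn_shift[OF s', of "vert i" "s \<otimes> vert (first_big s k \<eta>)" \<eta>] s by simp
  also have "\<dots> \<longleftrightarrow> conn \<eta> (vert i) (vert (first_big \<one> k \<eta>))"
    using conn_cong[OF cn] conn_commute by blast
  also have "\<dots> \<longleftrightarrow> i = first_big \<one> k \<eta>"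
    using rep_cong[of \<eta> "vert i" "vert (first_big \<one> k \<eta>)"] \<eta>(2) rep_first_big[OF ex] by auto
  also have "n = m \<and> i = first_big \<one> k \<eta> \<longleftrightarrow> ((n, i), \<eta>) \<in> first_big_set m k"
    using \<eta>(1) ex by (simp add: first_big_set_def space_cl_base)
  finally show ?thesis by simp
qed

lemma fiber_first_big_set:
  "fiber (first_big_set n k) \<omega> = (if \<exists>x\<in>V. big k (level n \<omega>) x then {(n, first_big \<one> k (level n \<omega>))} else {})"
proof (cases "\<exists>x\<in>V. big k (level n \<omega>) x")
  case True
  then show ?thesis using rep_first_big[OF True]
    by (auto simp: fiber_def first_big_set_def space_cl_base reps_iff level_space)
qed (auto simp: fiber_def first_big_set_def)

lemma cnt_first_big_set:
  "cnt (first_big_set n k) \<omega> = (if \<exists>x\<in>V. big k (level n \<omega>) x then 1 else 0)"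
  unfolding cnt_def fiber_first_big_set by simp

text \<open>The set holds at most one cluster, and holds one with high probability; it differs from
  its translate only where \<open>nearly_agree\<close> fails, an event of small probability.\<close>

lemma almost_invariant_set:
  assumes uniq: "AE \<eta> in Perc pu. unique_infinite_cluster V (open_edges E \<eta>)"
    and e: "e > 0" and K: "finite K" "K \<subseteq> V"
  shows "\<exists>A\<in>sets cl_measure. 0 < measure cl_measure A \<and> emeasure cl_measure A < \<infinity> \<and>
    (\<forall>s\<in>K. measure cl_measure {x\<in>space cl_measure. (x \<in> A) \<noteq> (cl_act (inv s) x \<in> A)} < e * measure cl_measure A)"
proof -
  interpret prob_space labels by (rule prob_space_labels)
  \<comment> \<open>The bound \<open>1/2\<close> keeps the measure of the set at least
    \<open>1/2\<close>. With \<open>e/4\<close>, the symmetric difference has measure less than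
    \<open>2 * d\<close>, hence less than \<open>e\<close> times the measure of the set.\<close>
  define d where "d = min (1/2) (e/4)"
  have d: "0 < d" "d \<le> 1/2" "2 * d \<le> e / 2" using e by (auto simp: d_def)
  obtain k n where kn: "1 - d < prob {\<omega>\<in>space labels. nearly_agree K k (level n \<omega>)}"
    using ex_nearly_agree[OF uniq K, of "1 - d"] d by auto
  define G where "G = {\<omega>\<in>space labels. nearly_agree K k (level n \<omega>)}"
  have G: "G \<in> events"
    using measurable_compose[OF level_measurable nearly_agree_measurable[OF K(1)]] by (auto simp: G_def pred_def)
  let ?A = "first_big_set n k"
  have A: "?A \<in> sets cl_base" by (rule first_big_set_sets)
  have up: "emeasure cl_measure ?A \<le> 1"
  proof -
    have "(\<integral>\<^sup>+\<omega>. cnt ?A \<omega> \<partial>labels) \<le> (\<integral>\<^sup>+\<omega>. 1 \<partial>labels)"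
      by (intro nn_integral_mono) (simp add: cnt_first_big_set)
    then show ?thesis by (simp add: emeasure_cl[OF A] emeasure_space_1)
  qed
  have lo: "ennreal (1/2) \<le> emeasure cl_measure ?A"
  proof -
    have "ennreal (1/2) \<le> ennreal (prob G)" using kn d by (intro ennreal_leI) (simp add: G_def)
    also have "\<dots> = (\<integral>\<^sup>+\<omega>. indicator G \<omega> \<partial>labels)" using G by (simp add: emeasure_eq_measure)
    also have "\<dots> \<le> (\<integral>\<^sup>+\<omega>. cnt ?A \<omega> \<partial>labels)"
      by (intro nn_integral_mono) (auto simp: cnt_first_big_set G_def nearly_agree_def split: split_indicator)
    finally show ?thesis by (simp add: emeasure_cl[OF A])
  qed
  have fin: "emeasure cl_measure ?A < \<infinity>" using up by (simp add: order_le_less_trans)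
  have "enn2real (ennreal (1/2)) \<le> measure cl_measure ?A"
    unfolding measure_def by (rule enn2real_mono[OF lo]) (use fin in simp)
  moreover have "enn2real (ennreal (1/2)) = 1/2" by (rule enn2real_ennreal) simp
  ultimately have mA: "1/2 \<le> measure cl_measure ?A" by linarith
  have "measure cl_measure {x\<in>space cl_measure. (x \<in> ?A) \<noteq> (cl_act (inv s) x \<in> ?A)} < e * measure cl_measure ?A"
    if s: "s \<in> K" for s
  proof -
    have sV: "s \<in> V" "inv s \<in> V" using s K by auto
    let ?A' = "cl_act (inv s) -` ?A \<inter> space cl_base"
    let ?D = "{x\<in>space cl_measure. (x \<in> ?A) \<noteq> (cl_act (inv s) x \<in> ?A)}"
    have A': "?A' \<in> sets cl_base" by (rule measurable_sets[OF cl_act_measurable[OF sV(2)] A])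
    have "?D = (?A - ?A') \<union> (?A' - ?A)" using sets.sets_into_space[OF A] by auto
    then have D: "?D \<in> sets cl_base" using A A' by auto
    \<comment> \<open>Off \<open>G\<close> the set and its translate contribute at most one cluster
      each, hence the factor 2.\<close>
    have "cnt ?D \<omega> \<le> 2 * indicator (space labels - G) \<omega>" if \<omega>: "\<omega> \<in> space labels" for \<omega>
    proof (cases "\<omega> \<in> G")
      case True
      then have ag: "nearly_agree {s} k (level n \<omega>)" using s by (auto simp: G_def nearly_agree_def)
      have "fiber ?D \<omega> = {}"
      proof (rule ccontr)
        assume "fiber ?D \<omega> \<noteq> {}"
        then obtain m i where mi: "((m, i), level m \<omega>) \<in> ?D" "((m, i), level m \<omega>) \<in> reps" by (auto simp: fiber_def)
        have "m = n"
          using mi(1) unfolding cl_act_simp[OF mi(2)] mem_Collect_eq by (auto simp: first_big_set_def)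
        then show False using mi first_big_set_act[OF _ sV(1) ag, of n i n] by auto
      qed
      then show ?thesis by (simp add: cnt_def)
    next
      case False
      have "fiber ?D \<omega> \<subseteq> fiber ?A \<omega> \<union> fiber ?A' \<omega>" by (auto simp: fiber_def)
      then have "cnt ?D \<omega> \<le> emeasure (count_space UNIV) (fiber ?A \<omega> \<union> fiber ?A' \<omega>)"
        unfolding cnt_def by (intro emeasure_mono) auto
      also have "\<dots> \<le> cnt ?A \<omega> + cnt ?A' \<omega>" unfolding cnt_def by (rule emeasure_subadditive) auto
      also have "cnt ?A' \<omega> = cnt ?A (shift_label (inv s) \<omega>)"
        by (rule cnt_vimage[OF sV(2) sets.sets_into_space[OF A]])
      also have "cnt ?A \<omega> + cnt ?A (shift_label (inv s) \<omega>) \<le> 1 + 1"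
        by (intro add_mono) (simp_all add: cnt_first_big_set)
      finally show ?thesis using False \<omega> by simp
    qed
    then have "emeasure cl_measure ?D \<le> (\<integral>\<^sup>+\<omega>. 2 * indicator (space labels - G) \<omega> \<partial>labels)"
      unfolding emeasure_cl[OF D] by (rule nn_integral_mono)
    also have "\<dots> = 2 * emeasure labels (space labels - G)"
      using G by (simp add: nn_integral_cmult)
    also have "\<dots> = ennreal 2 * ennreal (1 - prob G)"
      using G by (simp add: emeasure_eq_measure prob_compl)
    also have "\<dots> = ennreal (2 * (1 - prob G))"
      by (rule ennreal_mult[symmetric]) (simp_all add: prob_le_1)
    finally have "measure cl_measure ?D \<le> 2 * (1 - prob G)"
      unfolding measure_def[of cl_measure] by (rule enn2real_leI[rotated]) (simp add: prob_le_1)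
    also have "\<dots> < 2 * d" using kn by (simp add: G_def)
    also have "\<dots> \<le> e * (1/2)" using d by simp
    also have "\<dots> \<le> e * measure cl_measure ?A" using mA e by (intro mult_left_mono) auto
    finally show ?thesis .
  qed
  then show ?thesis using mA fin A by (intro bexI[of _ ?A]) auto
qed

text \<open>The invariant set \<open>B\<close> of finite positive measure is read as a random set of
  clusters: finite measure makes it finite at every level, positive measure makes it nonempty at
  some level.\<close>

lemma ex_selection:
  assumes uniq: "AE \<eta> in Perc pu. unique_infinite_cluster V (open_edges E \<eta>)"
    and T: "relative_property_T G H" and H: "H \<lhd> G"
  shows "\<exists>n M. selection (level_prob n) H M \<and> \<not> (AE \<eta> in Perc (level_prob n). M \<eta> = {})"
proof -
  interpret L: prob_space labels by (rule prob_space_labels)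
  interpret A: measure_preserving_action cl_measure "from_nat_into cylinders" G cl_act by (rule cl_action)
  have HV: "H \<subseteq> V" using normal_imp_subgroup[OF H] subgroup.subset by blast
  obtain B where B: "B \<in> sets cl_base" "0 < emeasure cl_measure B" "emeasure cl_measure B < \<infinity>"
    and inv: "\<And>h. h \<in> H \<Longrightarrow> AE z in cl_measure. cl_act (inv h) z \<in> B \<longleftrightarrow> z \<in> B"
    using A.relative_property_T_invariant_set[OF T HV almost_invariant_set[OF uniq]] by auto
  have Bsp: "B \<subseteq> space cl_base" by (rule sets.sets_into_space[OF B(1)])
  \<comment> \<open>Membership is decided by the canonical index, so whole clusters are
    selected.\<close>
  define M where "M n \<eta> = {x \<in> V. ((n, rep \<eta> x), \<eta>) \<in> B}" for n \<eta>
  have M_meas: "Measurable.pred config (\<lambda>\<eta>. x \<in> M n \<eta>)" for n x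
  proof (cases "x \<in> V")
    case True
    have "Measurable.pred config (\<lambda>\<eta>. ((n, j), \<eta>) \<in> B)" for j
    proof -
      have "(\<lambda>\<eta>. ((n, j), \<eta>)) \<in> measurable config cl_base" unfolding cl_base_def by simp
      from measurable_sets[OF this B(1)]
      show ?thesis by (simp add: pred_def vimage_def Int_def conj_commute)
    qed
    then have "Measurable.pred config (\<lambda>\<eta>. \<exists>j. rep \<eta> x = j \<and> ((n, j), \<eta>) \<in> B)" by measurable
    then show ?thesis using True by (simp add: M_def)
  qed (simp add: M_def)
  have MV: "M n \<eta> \<subseteq> V" for n \<eta> by (auto simp: M_def)
  have sel: "selection (level_prob n) H (M n)" for n
    unfolding selection_def
  proof (intro conjI ballI allI)
    fix x show "Measurable.pred config (\<lambda>\<eta>. x \<in> M n \<eta>)" by (rule M_meas)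
  next
    fix \<eta> show "M n \<eta> \<subseteq> V" by (rule MV)
  next
    \<comment> \<open>The expected number of clusters in \<open>B\<close> is finite, so almost
      surely there are finitely many.\<close>
    have "(\<integral>\<^sup>+\<omega>. cnt B \<omega> \<partial>labels) \<noteq> \<infinity>" using B emeasure_cl[OF B(1)] by simp
    then have "AE \<omega> in labels. cnt B \<omega> \<noteq> \<infinity>"
      by (rule nn_integral_noteq_infinite[OF cnt_measurable[OF B(1)]])
    then have fin: "AE \<omega> in labels. \<exists>A\<in>{A. finite A \<and> A \<subseteq> V}. \<forall>x\<in>V. x \<in> M n (level n \<omega>) \<longrightarrow> (\<exists>a\<in>A. conn (level n \<omega>) a x)"
    proof eventually_elim
      fix \<omega> assume "cnt B \<omega> \<noteq> \<infinity>"
      then have f: "finite (fiber B \<omega>)" by (auto simp: cnt_def emeasure_count_space split: if_splits)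
      have "\<exists>a\<in>(\<lambda>k. vert (snd k)) ` fiber B \<omega>. conn (level n \<omega>) a x" if x: "x \<in> M n (level n \<omega>)" for x
      proof -
        have "x \<in> V" "(n, rep (level n \<omega>) x) \<in> fiber B \<omega>"
          using x by (auto simp: M_def fiber_def reps_iff level_space rep_rep)
        moreover from this have "conn (level n \<omega>) (vert (rep (level n \<omega>) x)) x"
          using conn_sym[OF conn_rep] by blast
        ultimately show ?thesis by force
      qed
      then show "\<exists>A\<in>{A. finite A \<and> A \<subseteq> V}. \<forall>x\<in>V. x \<in> M n (level n \<omega>) \<longrightarrow> (\<exists>a\<in>A. conn (level n \<omega>) a x)"
        using f by (intro bexI[of _ "(\<lambda>k. vert (snd k)) ` fiber B \<omega>"]) auto
    qed
    have "Measurable.pred config (\<lambda>\<eta>. \<exists>A\<in>{A. finite A \<and> A \<subseteq> V}. \<forall>x\<in>V. x \<in> M n \<eta> \<longrightarrow> (\<exists>a\<in>A. conn \<eta> a x))"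
      by (intro pred_countable_Bex pred_countable_Ball countable_finsets countable_V pred_intros_logic(4) M_meas conn_measurable)
         (auto intro: countable_finite)
    from iffD2[OF AE_level_iff[OF this] fin]
    show "AE \<eta> in Perc (level_prob n). \<exists>A. finite A \<and> A \<subseteq> V \<and> (\<forall>x\<in>M n \<eta>. \<exists>a\<in>A. conn \<eta> a x)"
    proof eventually_elim
      fix \<eta> assume "\<exists>A\<in>{A. finite A \<and> A \<subseteq> V}. \<forall>x\<in>V. x \<in> M n \<eta> \<longrightarrow> (\<exists>a\<in>A. conn \<eta> a x)"
      then obtain A where "finite A" "A \<subseteq> V" "\<forall>x\<in>V. x \<in> M n \<eta> \<longrightarrow> (\<exists>a\<in>A. conn \<eta> a x)" by blast
      then show "\<exists>A. finite A \<and> A \<subseteq> V \<and> (\<forall>x\<in>M n \<eta>. \<exists>a\<in>A. conn \<eta> a x)"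
        using MV[of n \<eta>] by (intro exI[of _ A]) auto
    qed
  next
    fix h assume h: "h \<in> H"
    then have hV: "h \<in> V" using HV by auto
    \<comment> \<open>The invariance of \<open>B\<close> is stated for inverses and is applied to
      \<open>inv h\<close> to obtain it for \<open>h\<close>.\<close>
    have h': "inv h \<in> H" using h normal_imp_subgroup[OF H] by (rule subgroup.m_inv_closed[rotated])
    have "AE z in cl_measure. cl_act h z \<in> B \<longleftrightarrow> z \<in> B" using inv[OF h'] hV by simp
    from AE_cl_measureD[OF this]
    have ae: "AE \<omega> in labels. \<forall>x\<in>V. h \<otimes> x \<in> M n (shift h (level n \<omega>)) \<longleftrightarrow> x \<in> M n (level n \<omega>)"
    proof eventually_elim
      fix \<omega> assume *: "\<forall>k. (k, level (fst k) \<omega>) \<in> reps \<longrightarrow>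
        (cl_act h (k, level (fst k) \<omega>) \<in> B \<longleftrightarrow> (k, level (fst k) \<omega>) \<in> B)"
      show "\<forall>x\<in>V. h \<otimes> x \<in> M n (shift h (level n \<omega>)) \<longleftrightarrow> x \<in> M n (level n \<omega>)"
      proof
        fix x assume x: "x \<in> V"
        let ?\<eta> = "level n \<omega>"
        have r: "((n, rep ?\<eta> x), ?\<eta>) \<in> reps" using x by (simp add: reps_iff level_space rep_rep)
        have "conn (shift h ?\<eta>) (h \<otimes> x) (h \<otimes> vert (rep ?\<eta> x))"
          using conn_rep[OF x] conn_shift[OF hV x vert_V] by simp
        note eq = rep_cong[OF this]
        have "cl_act h ((n, rep ?\<eta> x), ?\<eta>) \<in> B \<longleftrightarrow> ((n, rep ?\<eta> x), ?\<eta>) \<in> B"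
          using *[rule_format, of "(n, rep ?\<eta> x)"] r by simp
        then show "h \<otimes> x \<in> M n (shift h ?\<eta>) \<longleftrightarrow> x \<in> M n ?\<eta>"
          unfolding cl_act_simp[OF r] using x hV by (simp add: M_def eq)
      qed
    qed
    have "Measurable.pred config (\<lambda>\<eta>. \<forall>x\<in>V. h \<otimes> x \<in> M n (shift h \<eta>) \<longleftrightarrow> x \<in> M n \<eta>)"
      by (intro pred_countable_Ball countable_V pred_intros_logic(6) M_meas
          measurable_compose[OF shift_measurable[OF hV] M_meas])
    from iffD2[OF AE_level_iff[OF this] ae]
    show "AE \<eta> in Perc (level_prob n). \<forall>x\<in>V. h \<otimes> x \<in> M n (shift h \<eta>) \<longleftrightarrow> x \<in> M n \<eta>" .
  qed
  \<comment> \<open>If all levels selected nothing, the expected number of clusters in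
    \<open>B\<close>, and with it the measure of \<open>B\<close>, would vanish.\<close>
  have "\<exists>n. \<not> (AE \<eta> in Perc (level_prob n). M n \<eta> = {})"
  proof (rule ccontr)
    assume "\<not> (\<exists>n. \<not> (AE \<eta> in Perc (level_prob n). M n \<eta> = {}))"
    then have e: "AE \<eta> in Perc (level_prob n). M n \<eta> = {}" for n by blast
    have "AE \<omega> in labels. M n (level n \<omega>) = {}" for n
    proof -
      have eq: "M n \<eta> = {} \<longleftrightarrow> \<not> (\<exists>x\<in>V. x \<in> M n \<eta>)" for \<eta> using MV by blast
      have "Measurable.pred config (\<lambda>\<eta>. M n \<eta> = {})"
        unfolding eq by (intro pred_intros_logic(2) pred_countable_Bex countable_V M_meas)
      from iffD1[OF AE_level_iff[OF this] e] show ?thesis .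
    qed
    then have "AE \<omega> in labels. \<forall>n. M n (level n \<omega>) = {}" by (simp add: AE_all_countable)
    then have "AE \<omega> in labels. cnt B \<omega> = 0"
    proof eventually_elim
      fix \<omega> assume em: "\<forall>n. M n (level n \<omega>) = {}"
      have "fiber B \<omega> = {}"
      proof (rule ccontr)
        assume "fiber B \<omega> \<noteq> {}"
        then obtain n i where ni: "((n, i), level n \<omega>) \<in> B" "((n, i), level n \<omega>) \<in> reps" by (auto simp: fiber_def)
        then have "vert i \<in> M n (level n \<omega>)" by (simp add: M_def reps_iff)
        then show False using em by simp
      qed
      then show "cnt B \<omega> = 0" by (simp add: cnt_def)
    qed
    then have "(\<integral>\<^sup>+\<omega>. cnt B \<omega> \<partial>labels) = 0"
      by (subst nn_integral_0_iff_AE[OF cnt_measurable[OF B(1)]])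
    then show False using B(2) emeasure_cl[OF B(1)] by simp
  qed
  then show ?thesis using sel by blast
qed

lemma uniqueness_below:
  assumes uniq: "AE \<eta> in Perc pu. unique_infinite_cluster V (open_edges E \<eta>)"
    and T: "relative_property_T G H" and H: "H \<lhd> G" "infinite H"
  shows "\<exists>p. 0 \<le> p \<and> p < pu \<and> (AE \<eta> in Perc p. unique_infinite_cluster V (open_edges E \<eta>))"
proof -
  obtain n M where M: "selection (level_prob n) H M" "\<not> (AE \<eta> in Perc (level_prob n). M \<eta> = {})"
    using ex_selection[OF uniq T H(1)] by blast
  define p where "p = level_prob n"
  have p: "0 \<le> p" "p < pu" "p \<le> 1" using level_prob_bounds[of n] pu by (auto simp: p_def)
  \<comment> \<open>Half of the gap: the new parameter is at most \<open>p + q\<close>, which is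
    still below \<open>pu\<close>.\<close>
  define q where "q = (pu - p) / 2"
  have q: "0 < q" "q \<le> 1" using p pu by (auto simp: q_def)
  have "AE \<eta> in Perc (p + q - p * q). unique_infinite_cluster V (open_edges E \<eta>)"
    by (rule selection_imp_unique[OF M(1)[folded p_def] H M(2)[folded p_def] p(1,3) q])
  moreover have "0 \<le> p * q" using p q by simp
  moreover have "p * q \<le> q" using p q by (intro mult_left_le_one_le) auto
  moreover have "p + q < pu" using p by (simp add: q_def field_simps)
  ultimately show ?thesis using p by (intro exI[of _ "p + q - p * q"]) auto
qed

end

context cayley_graph
begin

text \<open>Uniqueness is a shift-invariant event. This turns the negation of the claim at the
  threshold into almost sure uniqueness there.\<close>

lemma unique_zero_one:
  assumes "\<not> (AE \<eta> in Perc p. \<not> unique_infinite_cluster V (open_edges E \<eta>))"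
  shows "AE \<eta> in Perc p. unique_infinite_cluster V (open_edges E \<eta>)"
proof -
  interpret prob_space "Perc p" by (rule prob_space_Perc)
  define A where "A = {\<eta>\<in>space config. unique_infinite_cluster V (open_edges E \<eta>)}"
  have A: "A \<in> sets config" using unique_measurable by (simp add: A_def pred_def)
  have "measure (Perc p) A = 0 \<or> measure (Perc p) A = 1"
    by (rule shift_invariant_trivial[OF A]) (auto simp: A_def unique_shift shift_space intro!: AE_I2)
  moreover have "measure (Perc p) A \<noteq> 0"
  proof
    assume "measure (Perc p) A = 0"
    then have "AE \<eta> in Perc p. \<eta> \<notin> A"
      using A by (intro AE_not_in null_setsI) (auto simp: emeasure_eq_measure)
    then have "AE \<eta> in Perc p. \<not> unique_infinite_cluster V (open_edges E \<eta>)"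
      using AE_space by eventually_elim (auto simp: A_def)
    then show False using assms by simp
  qed
  ultimately have "AE \<eta> in Perc p. \<eta> \<in> A" using A by (simp add: prob_eq_1)
  then show ?thesis by eventually_elim (simp add: A_def)
qed

text \<open>Excludes a threshold equal to 0, where there would be no level below.\<close>

lemma not_unique_at_zero: "AE \<eta> in Perc 0. \<not> unique_infinite_cluster V (open_edges E \<eta>)"
proof -
  have "AE \<eta> in Perc 0. \<forall>e\<in>E. \<not> \<eta> e"
    unfolding bernoulli_percolation_def
  proof (subst AE_ball_countable[OF countable_E], intro ballI)
    fix e assume "e \<in> E"
    then show "AE \<eta> in PiM E (\<lambda>_. measure_pmf (bernoulli_pmf 0)). \<not> \<eta> e"
      by (rule AE_PiM_component[OF prob_space_measure_pmf, where P="\<lambda>b. \<not> b"])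
         (auto simp: AE_measure_pmf_iff set_pmf_iff)
  qed
  then show ?thesis
  proof eventually_elim
    fix \<eta> assume "\<forall>e\<in>E. \<not> \<eta> e"
    then have "open_edges E \<eta> = {}" by (auto simp: open_edges_def)
    then have "conn \<eta> x y \<Longrightarrow> x = y" for x y by (simp add: conn_def connected_in_def)
    then have "{y. conn \<eta> x y} \<subseteq> {x}" for x by blast
    then have "finite {y. conn \<eta> x y}" for x by (rule finite_subset) simp
    then show "\<not> unique_infinite_cluster V (open_edges E \<eta>)" by (simp add: unique_iff)
  qed
qed

text \<open>Ensures that the infimum defining the threshold is over a nonempty set, and hence lies
  in the unit interval. With all edges open, words connect any two vertices.\<close>

lemma unique_at_one: "AE \<eta> in Perc 1. unique_infinite_cluster V (open_edges E \<eta>)"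
proof -
  have one: "y" if "y \<in> set_pmf (bernoulli_pmf 1)" for y
    using that by (cases y) (auto simp: set_pmf_iff)
  have "AE \<eta> in Perc 1. \<forall>e\<in>E. \<eta> e"
    unfolding bernoulli_percolation_def
  proof (subst AE_ball_countable[OF countable_E], intro ballI)
    fix e assume "e \<in> E"
    then show "AE \<eta> in PiM E (\<lambda>_. measure_pmf (bernoulli_pmf 1)). \<eta> e"
      by (rule AE_PiM_component[OF prob_space_measure_pmf, where P="\<lambda>b. b"])
         (use one in \<open>auto simp: AE_measure_pmf_iff\<close>)
  qed
  then show ?thesis
  proof eventually_elim
    fix \<eta> assume op: "\<forall>e\<in>E. \<eta> e"
    have w: "conn \<eta> v (v \<otimes> word w)" if "w \<in> lists S" "v \<in> V" for w v
      using that
    proof (induction w arbitrary: v)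
      case (Cons s w)
      then have s: "s \<in> S" "w \<in> lists S" by auto
      have e: "{v, v \<otimes> s} \<in> E" using Cons.prems s by (auto simp: cayley_edges_def)
      have "conn \<eta> v (v \<otimes> s)" by (rule conn_step[OF conn_refl e]) (rule bspec[OF op e])
      moreover have "conn \<eta> (v \<otimes> s) ((v \<otimes> s) \<otimes> word w)" using Cons s by auto
      ultimately have "conn \<eta> v ((v \<otimes> s) \<otimes> word w)" by (rule conn_trans)
      then show ?case using Cons.prems s by (simp add: m_assoc)
    qed simp
    have all: "conn \<eta> x y" if xy: "x \<in> V" "y \<in> V" for x y
    proof -
      obtain u where u: "u \<in> lists S" "inv x \<otimes> y = word u" using ex_word[of "inv x \<otimes> y"] xy by auto
      have "x \<otimes> word u = y" unfolding u(2)[symmetric] using xy by simp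
      then show ?thesis using w[OF u(1) xy(1)] by simp
    qed
    then have "V \<subseteq> {y. conn \<eta> x y}" if "x \<in> V" for x using that by blast
    then have "infinite {y. conn \<eta> x y}" if "x \<in> V" for x
      using that infinite_carrier finite_subset by blast
    then show "unique_infinite_cluster V (open_edges E \<eta>)"
      unfolding unique_iff using all by blast
  qed
qed

text \<open>Otherwise the zero-one law gives almost sure uniqueness at the infimum, and
  \<open>uniqueness_below\<close> provides a smaller parameter with the same property.\<close>

lemma not_unique_at_threshold:
  assumes T: "relative_property_T G H" and H: "H \<lhd> G" "infinite H"
  shows "AE \<eta> in Perc (uniqueness_threshold V E). \<not> unique_infinite_cluster V (open_edges E \<eta>)"
proof (rule ccontr)
  define U where "U = {p \<in> {0..1}. AE \<eta> in Perc p. unique_infinite_cluster V (open_edges E \<eta>)}"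
  define pu where "pu = uniqueness_threshold V E"
  assume "\<not> (AE \<eta> in Perc (uniqueness_threshold V E). \<not> unique_infinite_cluster V (open_edges E \<eta>))"
  then have n: "\<not> (AE \<eta> in Perc pu. \<not> unique_infinite_cluster V (open_edges E \<eta>))" unfolding pu_def .
  then have uniq: "AE \<eta> in Perc pu. unique_infinite_cluster V (open_edges E \<eta>)" by (rule unique_zero_one)
  have Inf: "pu = Inf U" by (simp add: pu_def U_def uniqueness_threshold_def)
  have bdd: "bdd_below U" by (rule bdd_belowI[of _ 0]) (simp add: U_def)
  have one: "1 \<in> U" using unique_at_one by (simp add: U_def)
  have "0 \<le> pu" unfolding Inf by (rule cInf_greatest) (use one in \<open>auto simp: U_def\<close>)
  moreover have "pu \<noteq> 0" using n not_unique_at_zero by auto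
  moreover have "pu \<le> 1" unfolding Inf by (rule cInf_lower[OF one bdd])
  ultimately interpret coupled_percolation G S pu by unfold_locales auto
  obtain p where p: "0 \<le> p" "p < pu" "AE \<eta> in Perc p. unique_infinite_cluster V (open_edges E \<eta>)"
    using uniqueness_below[OF uniq T H] by blast
  then have "p \<in> U" using \<open>pu \<le> 1\<close> by (simp add: U_def)
  then have "pu \<le> p" unfolding Inf by (rule cInf_lower[OF _ bdd])
  then show False using p by simp
qed

end

text \<open>Almost invariant vectors exist for every tolerance and finite set, in particular for the
  pair that witnesses property (T). This reduces the second claim to the first with the whole group
  as \<open>H\<close>.\<close>

lemma property_T_imp_relative:
  assumes "property_T G"
  shows "relative_property_T G (carrier G)"
  using assms unfolding property_T_def relative_property_T_def almost_has_invariant_vectors_def by blast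

theorem theorem4p4:
  fixes \<Gamma> :: "('a, 'b) monoid_scheme" and S :: "'a set"
  assumes "group \<Gamma>"
    and "finite_symmetric_generating_set \<Gamma> S"
  shows "(\<forall>H. H \<lhd> \<Gamma> \<and> infinite H \<and> relative_property_T \<Gamma> H \<longrightarrow>
            (AE \<omega> in bernoulli_percolation (cayley_edges \<Gamma> S)
                        (uniqueness_threshold (carrier \<Gamma>) (cayley_edges \<Gamma> S)).
               \<not> unique_infinite_cluster (carrier \<Gamma>) (open_edges (cayley_edges \<Gamma> S) \<omega>)))
       \<and> (countable (carrier \<Gamma>) \<and> infinite (carrier \<Gamma>) \<and> property_T \<Gamma> \<longrightarrow>
            (AE \<omega> in bernoulli_percolation (cayley_edges \<Gamma> S)
                        (uniqueness_threshold (carrier \<Gamma>) (cayley_edges \<Gamma> S)).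
               \<not> unique_infinite_cluster (carrier \<Gamma>) (open_edges (cayley_edges \<Gamma> S) \<omega>)))"
proof -
  interpret \<Gamma>: group \<Gamma> by (rule assms(1))
  have rel: "AE \<omega> in bernoulli_percolation (cayley_edges \<Gamma> S)
                        (uniqueness_threshold (carrier \<Gamma>) (cayley_edges \<Gamma> S)).
               \<not> unique_infinite_cluster (carrier \<Gamma>) (open_edges (cayley_edges \<Gamma> S) \<omega>)"
    if H: "H \<lhd> \<Gamma>" "infinite H" "relative_property_T \<Gamma> H" for H
  proof -
    have "H \<subseteq> carrier \<Gamma>" using normal_imp_subgroup[OF H(1)] subgroup.subset by blast
    then have "infinite (carrier \<Gamma>)" using H(2) finite_subset by blast
    then interpret cayley_graph \<Gamma> S by unfold_locales (use assms(2) in auto)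
    show ?thesis by (rule not_unique_at_threshold[OF H(3,1,2)])
  qed
  have "carrier \<Gamma> \<lhd> \<Gamma>"
    by (simp add: \<Gamma>.normal_inv_iff \<Gamma>.subgroup_self)
  then show ?thesis using rel property_T_imp_relative by blast
qed

end
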